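(* Let $\Bbbk$ be a field, $Q$ a commutative Noetherian monoid, and $I\subset\Bbbk[Q]$ a coprincipal binomial ideal. Then the irreducible closure $\operatorname{Irr}(I)$ has a unique minimal primary decomposition, and every primary component in it is an irreducible ideal of $\Bbbk[Q]$.
   Context: Monoids. $Q$ is commutative, Noetherian (equivalently finitely generated), written additively. An ideal of a monoid is a subset closed under adding arbitrary elements; $\langle q\rangle$ is the ideal generated by $q$. A nil is an absorbing element $\infty$; nilpotent means some positive multiple is nil; $c$ is cancellative if $a+c=b+c\Rightarrow a=b$. A prime $P\subset Q$ is a proper, possibly empty, ideal whose complement is a submonoid. $Q_P$ is the localization inverting $Q\smallsetminus P$, with unit group $G_P$. For a congruence $\sim$ on $Q$ (also denoting the congruence it generates on $Q_P$), $\overline Q=Q/{\sim}$, $\overline Q_P=Q_P/{\sim}$, and $\bar q$ is the image of $q$ in $\overline Q_P$. Green's preorder: $a\le b$ iff $\langle b\rangle\subseteq\langle a\rangle$. $q$ is a key aide for $w$ (with respect to $\sim$, $P$) if $\bar w\ne\bar q$, $\bar w+\bar p=\bar q+\bar p$ for all $p\in P$, and not $\bar q<\bar w$ strictly in Green's preorder; $w$ is a key witness for $P$ if it has a key aide; a key witness $w$ is a cogenerator of $\sim$ if $w+p$ is nil modulo $\sim$ for all $p\in P$. $\sim$ is $P$-primary if each $p\in P$ is nilpotent and each $f\in Q\smallsetminus P$ cancellative in $\overline Q$; $P$-mesoprimary if moreover $q+a=q+b\ne\infty\Rightarrow a=b$ for all $q\in\overline Q$ and cancellative $a,b\in\overline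 Q$; $P$-coprincipal if moreover all cogenerators of $\sim$ generate the same ideal of $\overline Q_P$. Binomial ideals. $\Bbbk[Q]$ has basis $\mathbf t^a$, $a\in Q$. A binomial is $\mathbf t^a-\lambda\mathbf t^b$ with $\lambda\in\Bbbk$ (possibly $0$); an ideal is binomial if generated by binomials. $I$ induces the congruence $a\sim_I b$ iff $\mathbf t^a-\lambda\mathbf t^b\in I$ for some $\lambda\ne0$. Subscript $P$ denotes inverting all monomials $\mathbf t^f$, $f\in Q\smallsetminus P$, so $\Bbbk[Q]_P=\Bbbk[Q_P]$. $I$ is $P$-coprincipal if $\sim_I$ is $P$-coprincipal and $I$ is maximal among proper binomial ideals inducing $\sim_I$; it is coprincipal if it is $P$-coprincipal for some prime $P$. It is cogenerated by $w\in Q$ if $\mathbf t^w\notin I_P$ and $\mathbf t^{w+p}\in I_P$ for all $p\in P$; coprincipal ideals are understood to come with such a cogenerator. Irreducible closure. Let $I$ be $P$-coprincipal cogenerated by $w$. Put $R_P=\Bbbk[Q_P]/I_P$, which is graded by $Q_P/{\sim_I}$. Let $\bar w^\perp$ be the unique graded $\Bbbk$-vector subspace of $R_P$ with $R_P=(\Bbbk[G_P]\cdot\mathbf t^{\bar w})\oplus\bar w^\perp$, let $\bar w^\perp_\infty$ be the largest $\Bbbk[Q_P]$-submodule of $R_P$ contained in $\bar w^\perp$, and put $\overline R_P=R_P/\bar w^\perp_\infty$. Then $\operatorname{Irr}(I)=\ker(\Bbbk[Q]\to\overline R_P)$. An ideal is irreducible if it is not an intersection of two ideals properly containing it. *)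

theory Defs
  imports
    "HOL-Algebra.QuotRing"
    "HOL-Algebra.Algebraic_Closure_Type"
    "HOL-Library.Poly_Mapping"
begin

section \<open>Commutative monoids\<close>

text \<open>
  The ambient monoid \<open>Q\<close> is a type of class \<open>comm_monoid_add\<close>. Its localizations and quotients
  depend on parameters, so they are monoid records of HOL-Algebra, which are written
  multiplicatively. \<open>type_monoid\<close> is \<open>Q\<close> itself as such a record.
\<close>

definition type_monoid :: "'q::comm_monoid_add monoid" where
  "type_monoid = \<lparr>carrier = UNIV, monoid.mult = (+), one = 0\<rparr>"

definition finitely_generated_monoid :: "('m, 'x) monoid_scheme \<Rightarrow> bool" where
  "finitely_generated_monoid M \<longleftrightarrow>
     (\<exists>S. finite S \<and> S \<subseteq> carrier M \<and> (\<forall>T. submonoid T M \<and> S \<subseteq> T \<longrightarrow> T = carrier M))"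

definition monoid_ideal :: "('m, 'x) monoid_scheme \<Rightarrow> 'm set \<Rightarrow> bool" where
  "monoid_ideal M T \<longleftrightarrow>
     T \<subseteq> carrier M \<and> (\<forall>t\<in>T. \<forall>a\<in>carrier M. t \<otimes>\<^bsub>M\<^esub> a \<in> T)"

definition monoid_ideal_gen :: "('m, 'x) monoid_scheme \<Rightarrow> 'm \<Rightarrow> 'm set" where
  "monoid_ideal_gen M q = \<Inter>{T. monoid_ideal M T \<and> q \<in> T}"

definition monoid_prime :: "('m, 'x) monoid_scheme \<Rightarrow> 'm set \<Rightarrow> bool" where
  "monoid_prime M P \<longleftrightarrow>
     monoid_ideal M P \<and> P \<noteq> carrier M \<and> submonoid (carrier M - P) M"

definition green_le :: "('m, 'x) monoid_scheme \<Rightarrow> 'm \<Rightarrow> 'm \<Rightarrow> bool" where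
  "green_le M a b \<longleftrightarrow> monoid_ideal_gen M b \<subseteq> monoid_ideal_gen M a"

definition green_less :: "('m, 'x) monoid_scheme \<Rightarrow> 'm \<Rightarrow> 'm \<Rightarrow> bool" where
  "green_less M a b \<longleftrightarrow> green_le M a b \<and> \<not> green_le M b a"

definition is_nil :: "('m, 'x) monoid_scheme \<Rightarrow> 'm \<Rightarrow> bool" where
  "is_nil M z \<longleftrightarrow> z \<in> carrier M \<and> (\<forall>a\<in>carrier M. z \<otimes>\<^bsub>M\<^esub> a = z)"

definition is_nilpotent :: "('m, 'x) monoid_scheme \<Rightarrow> 'm \<Rightarrow> bool" where
  "is_nilpotent M a \<longleftrightarrow> (\<exists>n::nat. n > 0 \<and> is_nil M (a [^]\<^bsub>M\<^esub> n))"

definition is_cancellative :: "('m, 'x) monoid_scheme \<Rightarrow> 'm \<Rightarrow> bool" where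
  "is_cancellative M c \<longleftrightarrow>
     (\<forall>a\<in>carrier M. \<forall>b\<in>carrier M. a \<otimes>\<^bsub>M\<^esub> c = b \<otimes>\<^bsub>M\<^esub> c \<longrightarrow> a = b)"

subsection \<open>Congruences and quotients\<close>

definition monoid_congruence :: "('m, 'x) monoid_scheme \<Rightarrow> 'm rel \<Rightarrow> bool" where
  "monoid_congruence M r \<longleftrightarrow>
     equiv (carrier M) r \<and>
     (\<forall>(a, b)\<in>r. \<forall>c\<in>carrier M. (a \<otimes>\<^bsub>M\<^esub> c, b \<otimes>\<^bsub>M\<^esub> c) \<in> r)"

definition congruence_gen :: "('m, 'x) monoid_scheme \<Rightarrow> 'm rel \<Rightarrow> 'm rel" where
  "congruence_gen M S = \<Inter>{r. monoid_congruence M r \<and> S \<subseteq> r}"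

definition quot_monoid :: "('m, 'x) monoid_scheme \<Rightarrow> 'm rel \<Rightarrow> 'm set monoid" where
  "quot_monoid M r =
     \<lparr>carrier = carrier M // r,
      monoid.mult = (\<lambda>A B. \<Union>a\<in>A. \<Union>b\<in>B. r `` {a \<otimes>\<^bsub>M\<^esub> b}),
      one = r `` {\<one>\<^bsub>M\<^esub>}\<rparr>"

subsection \<open>Localization at a prime\<close>

definition loc_rel :: "('m, 'x) monoid_scheme \<Rightarrow> 'm set \<Rightarrow> ('m \<times> 'm) rel" where
  "loc_rel M P =
     {((a, s), (b, t)). a \<in> carrier M \<and> b \<in> carrier M \<and>
        s \<in> carrier M - P \<and> t \<in> carrier M - P \<and>
        (\<exists>u\<in>carrier M - P. a \<otimes>\<^bsub>M\<^esub> t \<otimes>\<^bsub>M\<^esub> u = b \<otimes>\<^bsub>M\<^esub> s \<otimes>\<^bsub>M\<^esub> u)}"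

text \<open>\<open>frac M P a s\<close> is the element \<open>a - s\<close> of the localization.\<close>

definition frac :: "('m, 'x) monoid_scheme \<Rightarrow> 'm set \<Rightarrow> 'm \<Rightarrow> 'm \<Rightarrow> ('m \<times> 'm) set" where
  "frac M P a s = loc_rel M P `` {(a, s)}"

definition localization :: "('m, 'x) monoid_scheme \<Rightarrow> 'm set \<Rightarrow> ('m \<times> 'm) set monoid" where
  "localization M P =
     \<lparr>carrier = (carrier M \<times> (carrier M - P)) // loc_rel M P,
      monoid.mult = (\<lambda>x y. \<Union>(a, s)\<in>x. \<Union>(b, t)\<in>y. frac M P (a \<otimes>\<^bsub>M\<^esub> b) (s \<otimes>\<^bsub>M\<^esub> t)),
      one = frac M P \<one>\<^bsub>M\<^esub> \<one>\<^bsub>M\<^esub>\<rparr>"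

definition loc_map :: "('m, 'x) monoid_scheme \<Rightarrow> 'm set \<Rightarrow> 'm \<Rightarrow> ('m \<times> 'm) set" where
  "loc_map M P a = frac M P a \<one>\<^bsub>M\<^esub>"

definition loc_congruence ::
    "('m, 'x) monoid_scheme \<Rightarrow> 'm set \<Rightarrow> 'm rel \<Rightarrow> ('m \<times> 'm) set rel" where
  "loc_congruence M P r =
     congruence_gen (localization M P) {(loc_map M P a, loc_map M P b) | a b. (a, b) \<in> r}"

text \<open>The monoid \<open>Q\<^sub>P/\<sim>\<close>, and the image in it of an element of \<open>Q\<close>.\<close>

definition loc_quot ::
    "('m, 'x) monoid_scheme \<Rightarrow> 'm set \<Rightarrow> 'm rel \<Rightarrow> ('m \<times> 'm) set set monoid" where
  "loc_quot M P r = quot_monoid (localization M P) (loc_congruence M P r)"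

definition loc_quot_map ::
    "('m, 'x) monoid_scheme \<Rightarrow> 'm set \<Rightarrow> 'm rel \<Rightarrow> 'm \<Rightarrow> ('m \<times> 'm) set set" where
  "loc_quot_map M P r a = loc_congruence M P r `` {loc_map M P a}"

subsection \<open>Key witnesses and coprincipal congruences\<close>

definition key_aide ::
    "('m, 'x) monoid_scheme \<Rightarrow> 'm set \<Rightarrow> 'm rel \<Rightarrow> 'm \<Rightarrow> 'm \<Rightarrow> bool" where
  "key_aide M P r w q \<longleftrightarrow>
     q \<in> carrier M \<and>
     loc_quot_map M P r w \<noteq> loc_quot_map M P r q \<and>
     (\<forall>p\<in>P. loc_quot_map M P r w \<otimes>\<^bsub>loc_quot M P r\<^esub> loc_quot_map M P r p
            = loc_quot_map M P r q \<otimes>\<^bsub>loc_quot M P r\<^esub> loc_quot_map M P r p) \<and>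
     \<not> green_less (loc_quot M P r) (loc_quot_map M P r q) (loc_quot_map M P r w)"

definition key_witness ::
    "('m, 'x) monoid_scheme \<Rightarrow> 'm set \<Rightarrow> 'm rel \<Rightarrow> 'm \<Rightarrow> bool" where
  "key_witness M P r w \<longleftrightarrow> w \<in> carrier M \<and> (\<exists>q. key_aide M P r w q)"

definition congruence_cogenerator ::
    "('m, 'x) monoid_scheme \<Rightarrow> 'm set \<Rightarrow> 'm rel \<Rightarrow> 'm \<Rightarrow> bool" where
  "congruence_cogenerator M P r w \<longleftrightarrow>
     key_witness M P r w \<and> (\<forall>p\<in>P. is_nil (quot_monoid M r) (r `` {w \<otimes>\<^bsub>M\<^esub> p}))"

definition primary_congruence ::
    "('m, 'x) monoid_scheme \<Rightarrow> 'm set \<Rightarrow> 'm rel \<Rightarrow> bool" where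
  "primary_congruence M P r \<longleftrightarrow>
     monoid_congruence M r \<and>
     (\<forall>p\<in>P. is_nilpotent (quot_monoid M r) (r `` {p})) \<and>
     (\<forall>f\<in>carrier M - P. is_cancellative (quot_monoid M r) (r `` {f}))"

definition mesoprimary_congruence ::
    "('m, 'x) monoid_scheme \<Rightarrow> 'm set \<Rightarrow> 'm rel \<Rightarrow> bool" where
  "mesoprimary_congruence M P r \<longleftrightarrow>
     primary_congruence M P r \<and>
     (let N = quot_monoid M r in
       \<forall>q\<in>carrier N. \<forall>a\<in>carrier N. \<forall>b\<in>carrier N.
         is_cancellative N a \<and> is_cancellative N b \<and>
         q \<otimes>\<^bsub>N\<^esub> a = q \<otimes>\<^bsub>N\<^esub> b \<and> \<not> is_nil N (q \<otimes>\<^bsub>N\<^esub> a) \<longrightarrow> a = b)"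

definition coprincipal_congruence ::
    "('m, 'x) monoid_scheme \<Rightarrow> 'm set \<Rightarrow> 'm rel \<Rightarrow> bool" where
  "coprincipal_congruence M P r \<longleftrightarrow>
     mesoprimary_congruence M P r \<and>
     (\<forall>w w'. congruence_cogenerator M P r w \<and> congruence_cogenerator M P r w' \<longrightarrow>
        monoid_ideal_gen (loc_quot M P r) (loc_quot_map M P r w) =
        monoid_ideal_gen (loc_quot M P r) (loc_quot_map M P r w'))"

section \<open>Monoid algebras and binomial ideals\<close>

text \<open>
  For the monoid type \<open>'q\<close>, the algebra \<open>\<bbbk>[Q]\<close> is the library's ring \<open>'q \<Rightarrow>\<^sub>0 'k\<close>, whose basis element
  \<open>t\<^sup>a\<close> is \<open>Poly_Mapping.single a 1\<close>. For a monoid record, whose operation is not the addition of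
  its element type, the algebra has to be a ring record.
\<close>

abbreviation type_alg :: "('q::comm_monoid_add \<Rightarrow>\<^sub>0 'k::field) ring" where
  "type_alg \<equiv> ring_of_type_algebra"

definition monoid_alg :: "('m, 'x) monoid_scheme \<Rightarrow> ('m \<Rightarrow>\<^sub>0 'k::field) ring" where
  "monoid_alg M =
     \<lparr>carrier = {f. Poly_Mapping.keys f \<subseteq> carrier M},
      monoid.mult = (\<lambda>f g. \<Sum>x\<in>Poly_Mapping.keys f. \<Sum>y\<in>Poly_Mapping.keys g.
                Poly_Mapping.single (x \<otimes>\<^bsub>M\<^esub> y) (Poly_Mapping.lookup f x * Poly_Mapping.lookup g y)),
      one = Poly_Mapping.single \<one>\<^bsub>M\<^esub> 1,
      zero = 0,
      add = (+)\<rparr>"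

definition binomials :: "('q::comm_monoid_add \<Rightarrow>\<^sub>0 'k::field) set" where
  "binomials = {Poly_Mapping.single a 1 - Poly_Mapping.single b c | a b c. True}"

definition binomial_ideal :: "('q::comm_monoid_add \<Rightarrow>\<^sub>0 'k::field) set \<Rightarrow> bool" where
  "binomial_ideal I \<longleftrightarrow> (\<exists>B\<subseteq>binomials. I = genideal type_alg B)"

definition induced_congruence :: "('q::comm_monoid_add \<Rightarrow>\<^sub>0 'k::field) set \<Rightarrow> 'q rel" where
  "induced_congruence I =
     {(a, b). \<exists>c. c \<noteq> 0 \<and> Poly_Mapping.single a 1 - Poly_Mapping.single b c \<in> I}"

definition coprincipal_ideal ::
    "'q set \<Rightarrow> ('q::comm_monoid_add \<Rightarrow>\<^sub>0 'k::field) set \<Rightarrow> bool" where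
  "coprincipal_ideal P I \<longleftrightarrow>
     monoid_prime type_monoid P \<and>
     coprincipal_congruence type_monoid P (induced_congruence I) \<and>
     binomial_ideal I \<and> I \<noteq> UNIV \<and>
     (\<forall>J. binomial_ideal J \<and> J \<noteq> UNIV \<and> induced_congruence J = induced_congruence I \<and> I \<subseteq> J
        \<longrightarrow> J = I)"

subsection \<open>Localizing ideals\<close>

text \<open>The ring \<open>\<bbbk>[Q\<^sub>P]\<close>, the map \<open>\<bbbk>[Q] \<rightarrow> \<bbbk>[Q\<^sub>P]\<close>, and the extension \<open>I\<^sub>P\<close> of \<open>I\<close>.\<close>

definition loc_alg ::
    "'q set \<Rightarrow> (('q::comm_monoid_add \<times> 'q) set \<Rightarrow>\<^sub>0 'k::field) ring" where
  "loc_alg P = monoid_alg (localization type_monoid P)"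

definition loc_alg_map ::
    "'q set \<Rightarrow> ('q::comm_monoid_add \<Rightarrow>\<^sub>0 'k::field) \<Rightarrow> (('q \<times> 'q) set \<Rightarrow>\<^sub>0 'k)" where
  "loc_alg_map P f =
     (\<Sum>a\<in>Poly_Mapping.keys f.
        Poly_Mapping.single (loc_map type_monoid P a) (Poly_Mapping.lookup f a))"

definition loc_ideal ::
    "'q set \<Rightarrow> ('q::comm_monoid_add \<Rightarrow>\<^sub>0 'k::field) set \<Rightarrow> (('q \<times> 'q) set \<Rightarrow>\<^sub>0 'k) set" where
  "loc_ideal P I = genideal (loc_alg P) (loc_alg_map P ` I)"

definition cogenerated_by ::
    "'q set \<Rightarrow> ('q::comm_monoid_add \<Rightarrow>\<^sub>0 'k::field) set \<Rightarrow> 'q \<Rightarrow> bool" where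
  "cogenerated_by P I w \<longleftrightarrow>
     loc_alg_map P (Poly_Mapping.single w 1) \<notin> loc_ideal P I \<and>
     (\<forall>p\<in>P. loc_alg_map P (Poly_Mapping.single (w + p) 1) \<in> loc_ideal P I)"

section \<open>The irreducible closure\<close>

text \<open>The ring \<open>R\<^sub>P = \<bbbk>[Q\<^sub>P]/I\<^sub>P\<close>, whose elements are cosets, and the projection onto it.\<close>

definition RP ::
    "'q set \<Rightarrow> ('q::comm_monoid_add \<Rightarrow>\<^sub>0 'k::field) set \<Rightarrow> (('q \<times> 'q) set \<Rightarrow>\<^sub>0 'k) set ring" where
  "RP P I = loc_alg P Quot loc_ideal P I"

definition RP_proj ::
    "'q set \<Rightarrow> ('q::comm_monoid_add \<Rightarrow>\<^sub>0 'k::field) set \<Rightarrow>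
     (('q \<times> 'q) set \<Rightarrow>\<^sub>0 'k) \<Rightarrow> (('q \<times> 'q) set \<Rightarrow>\<^sub>0 'k) set" where
  "RP_proj P I f = loc_ideal P I +>\<^bsub>loc_alg P\<^esub> f"

definition RP_subspace ::
    "'q set \<Rightarrow> ('q::comm_monoid_add \<Rightarrow>\<^sub>0 'k::field) set \<Rightarrow>
     (('q \<times> 'q) set \<Rightarrow>\<^sub>0 'k) set set \<Rightarrow> bool" where
  "RP_subspace P I V \<longleftrightarrow>
     additive_subgroup V (RP P I) \<and>
     (\<forall>c. \<forall>v\<in>V.
        RP_proj P I (Poly_Mapping.single \<one>\<^bsub>localization type_monoid P\<^esub> c) \<otimes>\<^bsub>RP P I\<^esub> v \<in> V)"

text \<open>The homogeneous component of degree \<open>d\<close>, for \<open>d\<close> in \<open>Q\<^sub>P/\<sim>\<^sub>I\<close>; such a \<open>d\<close> is a subset of \<open>Q\<^sub>P\<close>.\<close>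

definition RP_component ::
    "'q set \<Rightarrow> ('q::comm_monoid_add \<Rightarrow>\<^sub>0 'k::field) set \<Rightarrow>
     ('q \<times> 'q) set set \<Rightarrow> (('q \<times> 'q) set \<Rightarrow>\<^sub>0 'k) set set" where
  "RP_component P I d = RP_proj P I ` {f. Poly_Mapping.keys f \<subseteq> d}"

definition RP_graded_subspace ::
    "'q set \<Rightarrow> ('q::comm_monoid_add \<Rightarrow>\<^sub>0 'k::field) set \<Rightarrow>
     (('q \<times> 'q) set \<Rightarrow>\<^sub>0 'k) set set \<Rightarrow> bool" where
  "RP_graded_subspace P I V \<longleftrightarrow>
     RP_subspace P I V \<and>
     (\<forall>v\<in>V. \<exists>D u.
        finite D \<and> D \<subseteq> carrier (loc_quot type_monoid P (induced_congruence I)) \<and>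
        (\<forall>d\<in>D. u d \<in> V \<inter> RP_component P I d) \<and> v = finsum (RP P I) u D)"

text \<open>The subspace \<open>\<bbbk>[G\<^sub>P] \<cdot> t\<^sup>w\<close> of \<open>R\<^sub>P\<close>, where \<open>G\<^sub>P\<close> is the unit group of \<open>Q\<^sub>P\<close>.\<close>

definition unit_span ::
    "'q set \<Rightarrow> ('q::comm_monoid_add \<Rightarrow>\<^sub>0 'k::field) set \<Rightarrow> 'q \<Rightarrow>
     (('q \<times> 'q) set \<Rightarrow>\<^sub>0 'k) set set" where
  "unit_span P I w =
     {RP_proj P I g \<otimes>\<^bsub>RP P I\<^esub> RP_proj P I (loc_alg_map P (Poly_Mapping.single w 1)) | g.
        Poly_Mapping.keys g \<subseteq> Units (localization type_monoid P)}"

definition perp ::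
    "'q set \<Rightarrow> ('q::comm_monoid_add \<Rightarrow>\<^sub>0 'k::field) set \<Rightarrow> 'q \<Rightarrow>
     (('q \<times> 'q) set \<Rightarrow>\<^sub>0 'k) set set" where
  "perp P I w =
     (THE V. RP_graded_subspace P I V \<and>
        unit_span P I w \<inter> V = {\<zero>\<^bsub>RP P I\<^esub>} \<and>
        unit_span P I w <+>\<^bsub>RP P I\<^esub> V = carrier (RP P I))"

text \<open>
  Since \<open>R\<^sub>P\<close> is a quotient ring of \<open>\<bbbk>[Q\<^sub>P]\<close>, its \<open>\<bbbk>[Q\<^sub>P]\<close>-submodules are its ideals.
  \<open>Greatest\<close> refers to the order on sets, i.e. inclusion.
\<close>

definition perp_inf ::
    "'q set \<Rightarrow> ('q::comm_monoid_add \<Rightarrow>\<^sub>0 'k::field) set \<Rightarrow> 'q \<Rightarrow>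
     (('q \<times> 'q) set \<Rightarrow>\<^sub>0 'k) set set" where
  "perp_inf P I w = (GREATEST N. ideal N (RP P I) \<and> N \<subseteq> perp P I w)"

definition irr_closure ::
    "'q set \<Rightarrow> ('q::comm_monoid_add \<Rightarrow>\<^sub>0 'k::field) set \<Rightarrow> 'q \<Rightarrow> ('q \<Rightarrow>\<^sub>0 'k) set" where
  "irr_closure P I w =
     a_kernel type_alg (RP P I Quot perp_inf P I w)
       (\<lambda>f. perp_inf P I w +>\<^bsub>RP P I\<^esub> RP_proj P I (loc_alg_map P f))"

section \<open>Irreducible ideals and primary decomposition\<close>

definition irreducible_ideal :: "('a, 'x) ring_scheme \<Rightarrow> 'a set \<Rightarrow> bool" where
  "irreducible_ideal R J \<longleftrightarrow>
     ideal J R \<and> \<not> (\<exists>A B. ideal A R \<and> ideal B R \<and> J \<subset> A \<and> J \<subset> B \<and> J = A \<inter> B)"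

definition primary_ideal :: "('a, 'x) ring_scheme \<Rightarrow> 'a set \<Rightarrow> bool" where
  "primary_ideal R J \<longleftrightarrow>
     ideal J R \<and> J \<noteq> carrier R \<and>
     (\<forall>a\<in>carrier R. \<forall>b\<in>carrier R.
        a \<otimes>\<^bsub>R\<^esub> b \<in> J \<longrightarrow> a \<in> J \<or> (\<exists>n::nat. b [^]\<^bsub>R\<^esub> n \<in> J))"

definition ideal_radical :: "('a, 'x) ring_scheme \<Rightarrow> 'a set \<Rightarrow> 'a set" where
  "ideal_radical R J = {a \<in> carrier R. \<exists>n::nat. a [^]\<^bsub>R\<^esub> n \<in> J}"

text \<open>
  A decomposition is the finite set of its components; minimal means that no component is
  redundant and that the components have pairwise distinct radicals.
\<close>

definition minimal_primary_decomposition ::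
    "('a, 'x) ring_scheme \<Rightarrow> 'a set \<Rightarrow> 'a set set \<Rightarrow> bool" where
  "minimal_primary_decomposition R J C \<longleftrightarrow>
     finite C \<and> (\<forall>A\<in>C. primary_ideal R A) \<and>
     J = carrier R \<inter> \<Inter>C \<and>
     (\<forall>A\<in>C. J \<noteq> carrier R \<inter> \<Inter>(C - {A})) \<and>
     inj_on (ideal_radical R) C"

section \<open>Well-formedness of the constructions\<close>

lemma comm_monoid_type_monoid: "comm_monoid (type_monoid :: 'q::comm_monoid_add monoid)"
  by unfold_locales (auto simp: type_monoid_def Units_def ac_simps)

lemma comm_monoid_quot_monoid:
  assumes M: "comm_monoid M" and r: "monoid_congruence M r"
  shows "comm_monoid (quot_monoid M r)"
    and "\<And>a b. a \<in> carrier M \<Longrightarrow> b \<in> carrier M \<Longrightarrow>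
           r `` {a} \<otimes>\<^bsub>quot_monoid M r\<^esub> r `` {b} = r `` {a \<otimes>\<^bsub>M\<^esub> b}"
proof -
  interpret comm_monoid M by fact
  have eq: "equiv (carrier M) r"
    and comp: "\<And>a b c. (a, b) \<in> r \<Longrightarrow> c \<in> carrier M \<Longrightarrow> (a \<otimes>\<^bsub>M\<^esub> c, b \<otimes>\<^bsub>M\<^esub> c) \<in> r"
    using r by (auto simp: monoid_congruence_def)
  have sub: "a \<in> carrier M" "b \<in> carrier M" if "(a, b) \<in> r" for a b
    using that eq by (auto simp: equiv_def refl_on_def)
  show mult: "r `` {a} \<otimes>\<^bsub>quot_monoid M r\<^esub> r `` {b} = r `` {a \<otimes>\<^bsub>M\<^esub> b}"
    if ab: "a \<in> carrier M" "b \<in> carrier M" for a b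
  proof -
    have "r `` {a' \<otimes>\<^bsub>M\<^esub> b'} = r `` {a \<otimes>\<^bsub>M\<^esub> b}" if "(a, a') \<in> r" "(b, b') \<in> r" for a' b'
    proof -
      have "(a \<otimes>\<^bsub>M\<^esub> b, a' \<otimes>\<^bsub>M\<^esub> b) \<in> r" using comp that ab by blast
      moreover have "(b \<otimes>\<^bsub>M\<^esub> a', b' \<otimes>\<^bsub>M\<^esub> a') \<in> r" using comp that sub by blast
      ultimately have "(a \<otimes>\<^bsub>M\<^esub> b, a' \<otimes>\<^bsub>M\<^esub> b') \<in> r"
        using eq sub that ab by (metis equiv_def m_comm transE)
      then show ?thesis using eq by (metis equiv_class_eq)
    qed
    note wd = this
    have "(a, a) \<in> r" "(b, b) \<in> r" using eq ab by (auto simp: equiv_def refl_on_def)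
    then have "(\<Union>a'\<in>r `` {a}. \<Union>b'\<in>r `` {b}. r `` {a' \<otimes>\<^bsub>M\<^esub> b'}) = r `` {a \<otimes>\<^bsub>M\<^esub> b}"
      by (intro SUP_eq_const wd) blast+
    then show ?thesis by (simp add: quot_monoid_def)
  qed
  have one: "\<one>\<^bsub>quot_monoid M r\<^esub> = r `` {\<one>\<^bsub>M\<^esub>}" by (simp add: quot_monoid_def)
  have car: "\<And>x. x \<in> carrier (quot_monoid M r) \<longleftrightarrow> (\<exists>a\<in>carrier M. x = r `` {a})"
    by (auto simp: quot_monoid_def quotient_def)
  show "comm_monoid (quot_monoid M r)"
  proof (rule comm_monoidI)
    show "\<one>\<^bsub>quot_monoid M r\<^esub> \<in> carrier (quot_monoid M r)" unfolding car one by blast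
  next
    fix x y assume "x \<in> carrier (quot_monoid M r)" "y \<in> carrier (quot_monoid M r)"
    then show "x \<otimes>\<^bsub>quot_monoid M r\<^esub> y \<in> carrier (quot_monoid M r)"
      unfolding car by (metis mult m_closed)
  qed (auto simp: car one mult m_ac)
qed

lemma comm_monoid_localization:
  assumes M: "comm_monoid M" and P: "submonoid (carrier M - P) M"
  shows "comm_monoid (localization M P)"
    and "\<And>a b s t. a \<in> carrier M \<Longrightarrow> b \<in> carrier M \<Longrightarrow> s \<in> carrier M - P \<Longrightarrow> t \<in> carrier M - P \<Longrightarrow>
           frac M P a s \<otimes>\<^bsub>localization M P\<^esub> frac M P b t = frac M P (a \<otimes>\<^bsub>M\<^esub> b) (s \<otimes>\<^bsub>M\<^esub> t)"
    and "equiv (carrier M \<times> (carrier M - P)) (loc_rel M P)"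
proof -
  interpret comm_monoid M by fact
  interpret S: submonoid "carrier M - P" M by fact
  let ?A = "carrier M \<times> (carrier M - P)"
  show eq: "equiv ?A (loc_rel M P)"
  proof (rule equivI)
    show "loc_rel M P \<subseteq> ?A \<times> ?A" by (auto simp: loc_rel_def)
    show "refl_on ?A (loc_rel M P)"
      using S.one_closed by (auto simp: refl_on_def loc_rel_def)
    show "sym (loc_rel M P)" by (auto simp: sym_def loc_rel_def intro: sym)
    show "trans (loc_rel M P)"
    proof (rule transI, clarsimp simp: loc_rel_def simp del: S.one_closed)
      fix a s b t c v u u'
      assume c: "a \<in> carrier M" "s \<in> carrier M" "b \<in> carrier M" "t \<in> carrier M" "c \<in> carrier M" 
          "v \<in> carrier M" "u \<in> carrier M" "u' \<in> carrier M" and nP: "t \<notin> P" "u \<notin> P" "u' \<notin> P"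
        and e1: "a \<otimes>\<^bsub>M\<^esub> t \<otimes>\<^bsub>M\<^esub> u = b \<otimes>\<^bsub>M\<^esub> s \<otimes>\<^bsub>M\<^esub> u"
        and e2: "b \<otimes>\<^bsub>M\<^esub> v \<otimes>\<^bsub>M\<^esub> u' = c \<otimes>\<^bsub>M\<^esub> t \<otimes>\<^bsub>M\<^esub> u'"
      let ?w = "t \<otimes>\<^bsub>M\<^esub> u \<otimes>\<^bsub>M\<^esub> u'"
      have w: "?w \<in> carrier M - P" using c nP by (intro S.m_closed) auto
      have "a \<otimes>\<^bsub>M\<^esub> v \<otimes>\<^bsub>M\<^esub> ?w = (a \<otimes>\<^bsub>M\<^esub> t \<otimes>\<^bsub>M\<^esub> u) \<otimes>\<^bsub>M\<^esub> (v \<otimes>\<^bsub>M\<^esub> u')"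
        using c by (simp add: m_assoc m_lcomm[of v t] m_lcomm[of v u])
      also have "\<dots> = (b \<otimes>\<^bsub>M\<^esub> s \<otimes>\<^bsub>M\<^esub> u) \<otimes>\<^bsub>M\<^esub> (v \<otimes>\<^bsub>M\<^esub> u')"
        by (simp only: e1)
      also have "\<dots> = (b \<otimes>\<^bsub>M\<^esub> v \<otimes>\<^bsub>M\<^esub> u') \<otimes>\<^bsub>M\<^esub> (s \<otimes>\<^bsub>M\<^esub> u)"
        using c by (simp add: m_assoc m_lcomm[of u v] m_lcomm[of s v] m_lcomm[of u' s] m_comm[of u' u])
      also have "\<dots> = (c \<otimes>\<^bsub>M\<^esub> t \<otimes>\<^bsub>M\<^esub> u') \<otimes>\<^bsub>M\<^esub> (s \<otimes>\<^bsub>M\<^esub> u)"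
        by (simp only: e2)
      also have "\<dots> = c \<otimes>\<^bsub>M\<^esub> s \<otimes>\<^bsub>M\<^esub> ?w"
        using c by (simp add: m_assoc m_lcomm[of u' s] m_lcomm[of t s] m_comm[of u' u])
      finally show "\<exists>u\<in>carrier M - P. a \<otimes>\<^bsub>M\<^esub> v \<otimes>\<^bsub>M\<^esub> u = c \<otimes>\<^bsub>M\<^esub> s \<otimes>\<^bsub>M\<^esub> u"
        using w by blast
    qed
  qed
  show mult: "frac M P a s \<otimes>\<^bsub>localization M P\<^esub> frac M P b t = frac M P (a \<otimes>\<^bsub>M\<^esub> b) (s \<otimes>\<^bsub>M\<^esub> t)"
    if ab: "a \<in> carrier M" "b \<in> carrier M" "s \<in> carrier M - P" "t \<in> carrier M - P" for a b s t
  proof -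
    have "frac M P (a' \<otimes>\<^bsub>M\<^esub> b') (s' \<otimes>\<^bsub>M\<^esub> t') = frac M P (a \<otimes>\<^bsub>M\<^esub> b) (s \<otimes>\<^bsub>M\<^esub> t)"
      if h: "((a, s), (a', s')) \<in> loc_rel M P" "((b, t), (b', t')) \<in> loc_rel M P" for a' s' b' t'
    proof -
      from h obtain u u' where u: "u \<in> carrier M - P" "u' \<in> carrier M - P"
        and c: "a' \<in> carrier M" "b' \<in> carrier M" "s' \<in> carrier M - P" "t' \<in> carrier M - P"
        and e1: "a \<otimes>\<^bsub>M\<^esub> s' \<otimes>\<^bsub>M\<^esub> u = a' \<otimes>\<^bsub>M\<^esub> s \<otimes>\<^bsub>M\<^esub> u"
        and e2: "b \<otimes>\<^bsub>M\<^esub> t' \<otimes>\<^bsub>M\<^esub> u' = b' \<otimes>\<^bsub>M\<^esub> t \<otimes>\<^bsub>M\<^esub> u'"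
        by (auto simp: loc_rel_def)
      have cM: "a \<in> carrier M" "b \<in> carrier M" "s \<in> carrier M" "t \<in> carrier M" "a' \<in> carrier M"
        "b' \<in> carrier M" "s' \<in> carrier M" "t' \<in> carrier M" "u \<in> carrier M" "u' \<in> carrier M"
        using u c ab by auto
      have ac: "(a \<otimes>\<^bsub>M\<^esub> b) \<otimes>\<^bsub>M\<^esub> (c \<otimes>\<^bsub>M\<^esub> d) \<otimes>\<^bsub>M\<^esub> (x \<otimes>\<^bsub>M\<^esub> y)
          = (a \<otimes>\<^bsub>M\<^esub> c \<otimes>\<^bsub>M\<^esub> x) \<otimes>\<^bsub>M\<^esub> (b \<otimes>\<^bsub>M\<^esub> d \<otimes>\<^bsub>M\<^esub> y)"
        if "a \<in> carrier M" "b \<in> carrier M" "c \<in> carrier M" "d \<in> carrier M" "x \<in> carrier M"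
          "y \<in> carrier M" for a b c d x y
        using that by (simp add: m_assoc m_lcomm[of b c] m_lcomm[of d x] m_lcomm[of b x])
      have "(a \<otimes>\<^bsub>M\<^esub> b) \<otimes>\<^bsub>M\<^esub> (s' \<otimes>\<^bsub>M\<^esub> t') \<otimes>\<^bsub>M\<^esub> (u \<otimes>\<^bsub>M\<^esub> u')
          = (a \<otimes>\<^bsub>M\<^esub> s' \<otimes>\<^bsub>M\<^esub> u) \<otimes>\<^bsub>M\<^esub> (b \<otimes>\<^bsub>M\<^esub> t' \<otimes>\<^bsub>M\<^esub> u')"
        by (rule ac; fact cM)
      also have "\<dots> = (a' \<otimes>\<^bsub>M\<^esub> s \<otimes>\<^bsub>M\<^esub> u) \<otimes>\<^bsub>M\<^esub> (b' \<otimes>\<^bsub>M\<^esub> t \<otimes>\<^bsub>M\<^esub> u')"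
        by (simp only: e1 e2)
      also have "\<dots> = (a' \<otimes>\<^bsub>M\<^esub> b') \<otimes>\<^bsub>M\<^esub> (s \<otimes>\<^bsub>M\<^esub> t) \<otimes>\<^bsub>M\<^esub> (u \<otimes>\<^bsub>M\<^esub> u')"
        by (rule ac[symmetric]; fact cM)
      finally have e: "(a \<otimes>\<^bsub>M\<^esub> b) \<otimes>\<^bsub>M\<^esub> (s' \<otimes>\<^bsub>M\<^esub> t') \<otimes>\<^bsub>M\<^esub> (u \<otimes>\<^bsub>M\<^esub> u')
          = (a' \<otimes>\<^bsub>M\<^esub> b') \<otimes>\<^bsub>M\<^esub> (s \<otimes>\<^bsub>M\<^esub> t) \<otimes>\<^bsub>M\<^esub> (u \<otimes>\<^bsub>M\<^esub> u')" .
      have "((a \<otimes>\<^bsub>M\<^esub> b, s \<otimes>\<^bsub>M\<^esub> t), (a' \<otimes>\<^bsub>M\<^esub> b', s' \<otimes>\<^bsub>M\<^esub> t')) \<in> loc_rel M P"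
        unfolding loc_rel_def mem_Collect_eq prod.case
        using e S.m_closed[OF u] S.m_closed[OF c(3,4)] S.m_closed[OF ab(3,4)] m_closed[OF cM(1,2)]
          m_closed[OF cM(5,6)] by blast
      then show ?thesis unfolding frac_def using eq by (metis equiv_class_eq)
    qed
    note wd = this
    have "(a, s) \<in> frac M P a s" "(b, t) \<in> frac M P b t"
      using ab eq by (auto simp: frac_def equiv_def refl_on_def)
    then have "(\<Union>p\<in>frac M P a s. \<Union>q\<in>frac M P b t.
        frac M P (fst p \<otimes>\<^bsub>M\<^esub> fst q) (snd p \<otimes>\<^bsub>M\<^esub> snd q)) = frac M P (a \<otimes>\<^bsub>M\<^esub> b) (s \<otimes>\<^bsub>M\<^esub> t)"
    proof (intro SUP_eq_const)
      fix p q assume "p \<in> frac M P a s" "q \<in> frac M P b t"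
      then show "frac M P (fst p \<otimes>\<^bsub>M\<^esub> fst q) (snd p \<otimes>\<^bsub>M\<^esub> snd q) = frac M P (a \<otimes>\<^bsub>M\<^esub> b) (s \<otimes>\<^bsub>M\<^esub> t)"
        using wd[of "fst p" "snd p" "fst q" "snd q"] by (simp add: frac_def)
    qed blast+
    then show ?thesis by (simp add: localization_def case_prod_unfold)
  qed
  have one: "\<one>\<^bsub>localization M P\<^esub> = frac M P \<one>\<^bsub>M\<^esub> \<one>\<^bsub>M\<^esub>" by (simp add: localization_def)
  have car: "\<And>x. x \<in> carrier (localization M P) \<longleftrightarrow>
      (\<exists>a\<in>carrier M. \<exists>s\<in>carrier M - P. x = frac M P a s)"
    by (auto simp: localization_def quotient_def frac_def)
  have P1: "\<one>\<^bsub>M\<^esub> \<in> carrier M - P" by (rule S.one_closed)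
  show "comm_monoid (localization M P)"
  proof (rule comm_monoidI)
    fix x y assume "x \<in> carrier (localization M P)" "y \<in> carrier (localization M P)"
    then show "x \<otimes>\<^bsub>localization M P\<^esub> y \<in> carrier (localization M P)"
      unfolding car by (metis mult m_closed S.m_closed)
  next
    show "\<one>\<^bsub>localization M P\<^esub> \<in> carrier (localization M P)"
      unfolding car one using P1 by blast
  next
    fix x y z assume "x \<in> carrier (localization M P)" "y \<in> carrier (localization M P)"
      "z \<in> carrier (localization M P)"
    then obtain a s b t c v where h: "a \<in> carrier M" "s \<in> carrier M - P" "b \<in> carrier M"
        "t \<in> carrier M - P" "c \<in> carrier M" "v \<in> carrier M - P"
        "x = frac M P a s" "y = frac M P b t" "z = frac M P c v"
      unfolding car by blast
    then show "x \<otimes>\<^bsub>localization M P\<^esub> y \<otimes>\<^bsub>localization M P\<^esub> z =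
        x \<otimes>\<^bsub>localization M P\<^esub> (y \<otimes>\<^bsub>localization M P\<^esub> z)"
      using S.m_closed[of s t] S.m_closed[of t v]
      by (simp add: mult m_assoc)
  next
    fix x assume "x \<in> carrier (localization M P)"
    then show "\<one>\<^bsub>localization M P\<^esub> \<otimes>\<^bsub>localization M P\<^esub> x = x"
      unfolding car one using P1 by (auto simp: mult)
  next
    fix x y assume "x \<in> carrier (localization M P)" "y \<in> carrier (localization M P)"
    then show "x \<otimes>\<^bsub>localization M P\<^esub> y = y \<otimes>\<^bsub>localization M P\<^esub> x"
      unfolding car by (auto simp: mult m_comm)
  qed
qed

lemma poly_mapping_eq_sum_single:
  "f = (\<Sum>x\<in>Poly_Mapping.keys f. Poly_Mapping.single x (Poly_Mapping.lookup f x))"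
  by (rule poly_mapping_eqI)
    (simp add: lookup_sum lookup_single when_def in_keys_iff)

lemma monoid_alg_mult:
  assumes "finite A" "finite B" "Poly_Mapping.keys f \<subseteq> A" "Poly_Mapping.keys g \<subseteq> B"
  shows "f \<otimes>\<^bsub>monoid_alg M\<^esub> g = (\<Sum>x\<in>A. \<Sum>y\<in>B.
           Poly_Mapping.single (x \<otimes>\<^bsub>M\<^esub> y) (Poly_Mapping.lookup f x * Poly_Mapping.lookup g y))"
proof -
  have "(\<Sum>x\<in>A. \<Sum>y\<in>B.
           Poly_Mapping.single (x \<otimes>\<^bsub>M\<^esub> y) (Poly_Mapping.lookup f x * Poly_Mapping.lookup g y))
     = (\<Sum>x\<in>Poly_Mapping.keys f. \<Sum>y\<in>B.
           Poly_Mapping.single (x \<otimes>\<^bsub>M\<^esub> y) (Poly_Mapping.lookup f x * Poly_Mapping.lookup g y))"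
    using assms by (intro sum.mono_neutral_right) (auto simp: in_keys_iff)
  also have "\<dots> = (\<Sum>x\<in>Poly_Mapping.keys f. \<Sum>y\<in>Poly_Mapping.keys g.
           Poly_Mapping.single (x \<otimes>\<^bsub>M\<^esub> y) (Poly_Mapping.lookup f x * Poly_Mapping.lookup g y))"
    using assms by (intro sum.cong sum.mono_neutral_right refl) (auto simp: in_keys_iff)
  also have "\<dots> = f \<otimes>\<^bsub>monoid_alg M\<^esub> g"
    by (simp add: monoid_alg_def)
  finally show ?thesis ..
qed

lemma monoid_alg_type_monoid:
  "monoid_alg (type_monoid :: 'q::comm_monoid_add monoid) = (type_alg :: ('q \<Rightarrow>\<^sub>0 'k::field) ring)"
proof -
  have "(\<Sum>x\<in>Poly_Mapping.keys f. \<Sum>y\<in>Poly_Mapping.keys g.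
           Poly_Mapping.single (x + y) (Poly_Mapping.lookup f x * Poly_Mapping.lookup g y)) = f * g"
    for f g :: "'q \<Rightarrow>\<^sub>0 'k"
  proof -
    have "f * g = (\<Sum>x\<in>Poly_Mapping.keys f. Poly_Mapping.single x (Poly_Mapping.lookup f x)) *
        (\<Sum>y\<in>Poly_Mapping.keys g. Poly_Mapping.single y (Poly_Mapping.lookup g y))"
      using poly_mapping_eq_sum_single by metis
    then show ?thesis by (simp add: sum_product mult_single)
  qed
  then show ?thesis
    by (simp add: monoid_alg_def type_monoid_def ring_of_type_algebra_def fun_eq_iff)
qed

lemma cring_monoid_alg:
  assumes M: "comm_monoid M"
  shows "cring (monoid_alg M :: ('m \<Rightarrow>\<^sub>0 'k::field) ring)"
proof -
  interpret comm_monoid M by fact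
  let ?R = "monoid_alg M :: ('m \<Rightarrow>\<^sub>0 'k) ring"
  let ?s = Poly_Mapping.single
  have car: "f \<in> carrier ?R \<longleftrightarrow> Poly_Mapping.keys f \<subseteq> carrier M" for f
    by (simp add: monoid_alg_def)
  have add: "f \<oplus>\<^bsub>?R\<^esub> g = f + g" for f g by (simp add: monoid_alg_def)
  have zero: "\<zero>\<^bsub>?R\<^esub> = 0" by (simp add: monoid_alg_def)
  have one: "\<one>\<^bsub>?R\<^esub> = ?s \<one>\<^bsub>M\<^esub> 1" by (simp add: monoid_alg_def)
  have distl: "(f + g) \<otimes>\<^bsub>?R\<^esub> h = f \<otimes>\<^bsub>?R\<^esub> h + g \<otimes>\<^bsub>?R\<^esub> h" for f g h
  proof -
    let ?A = "Poly_Mapping.keys f \<union> Poly_Mapping.keys g" and ?B = "Poly_Mapping.keys h"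
    show ?thesis
      using keys_add[of f g]
      by (simp add: monoid_alg_mult[of ?A ?B] lookup_add distrib_right single_add sum.distrib)
  qed
  have distr: "h \<otimes>\<^bsub>?R\<^esub> (f + g) = h \<otimes>\<^bsub>?R\<^esub> f + h \<otimes>\<^bsub>?R\<^esub> g" for f g h
  proof -
    let ?A = "Poly_Mapping.keys f \<union> Poly_Mapping.keys g" and ?B = "Poly_Mapping.keys h"
    show ?thesis
      using keys_add[of f g]
      by (simp add: monoid_alg_mult[of ?B ?A] lookup_add distrib_left single_add sum.distrib)
  qed
  have z: "0 \<otimes>\<^bsub>?R\<^esub> f = 0" "f \<otimes>\<^bsub>?R\<^esub> 0 = 0" for f by (simp_all add: monoid_alg_def)
  have suml: "(\<Sum>i\<in>A. F i) \<otimes>\<^bsub>?R\<^esub> h = (\<Sum>i\<in>A. F i \<otimes>\<^bsub>?R\<^esub> h)"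
    and sumr: "h \<otimes>\<^bsub>?R\<^esub> (\<Sum>i\<in>A. F i) = (\<Sum>i\<in>A. h \<otimes>\<^bsub>?R\<^esub> F i)"
    if "finite A" for A :: "'m set" and F h
    using that by (induction A) (simp_all add: z distl distr)
  have ss: "?s x c \<otimes>\<^bsub>?R\<^esub> ?s y d = ?s (x \<otimes>\<^bsub>M\<^esub> y) (c * d)" for x y c d
    using monoid_alg_mult[of "{x}" "{y}" "?s x c" "?s y d" M] by simp
  have closed: "f \<otimes>\<^bsub>?R\<^esub> g \<in> carrier ?R" if "f \<in> carrier ?R" "g \<in> carrier ?R" for f g
  proof -
    have "Poly_Mapping.keys (\<Sum>x\<in>Poly_Mapping.keys f. \<Sum>y\<in>Poly_Mapping.keys g.
       ?s (x \<otimes>\<^bsub>M\<^esub> y) (Poly_Mapping.lookup f x * Poly_Mapping.lookup g y))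
       \<subseteq> (\<Union>x\<in>Poly_Mapping.keys f. \<Union>y\<in>Poly_Mapping.keys g. {x \<otimes>\<^bsub>M\<^esub> y})"
      by (intro order_trans[OF keys_sum] UN_mono) auto
    with that show ?thesis
      unfolding car by (auto simp: monoid_alg_def intro!: m_closed)
  qed
  have ind: "Q f" if "f \<in> carrier ?R" "Q 0" "\<And>x c. x \<in> carrier M \<Longrightarrow> Q (?s x c)"
    "\<And>f g. Q f \<Longrightarrow> Q g \<Longrightarrow> Q (f + g)" for Q f
  proof -
    have "Q (\<Sum>x\<in>A. ?s x (Poly_Mapping.lookup f x))" if "finite A" "A \<subseteq> carrier M" for A
      using that \<open>Q 0\<close> \<open>\<And>x c. x \<in> carrier M \<Longrightarrow> Q (?s x c)\<close> \<open>\<And>f g. Q f \<Longrightarrow> Q g \<Longrightarrow> Q (f + g)\<close>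
      by (induction A) auto
    from this[OF finite_keys] that(1) show ?thesis
      unfolding car by (subst poly_mapping_eq_sum_single)
  qed
  have comm: "f \<otimes>\<^bsub>?R\<^esub> g = g \<otimes>\<^bsub>?R\<^esub> f" if "f \<in> carrier ?R" "g \<in> carrier ?R" for f g
    using that(1)
  proof (rule ind)
    fix x c assume x: "x \<in> carrier M"
    show "?s x c \<otimes>\<^bsub>?R\<^esub> g = g \<otimes>\<^bsub>?R\<^esub> ?s x c" using that(2)
      by (rule ind) (simp_all add: z distl distr ss x m_comm mult.commute)
  qed (simp_all add: z distl distr)
  have assoc: "f \<otimes>\<^bsub>?R\<^esub> g \<otimes>\<^bsub>?R\<^esub> h = f \<otimes>\<^bsub>?R\<^esub> (g \<otimes>\<^bsub>?R\<^esub> h)"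
    if "f \<in> carrier ?R" "g \<in> carrier ?R" "h \<in> carrier ?R" for f g h
    using that(1)
  proof (rule ind)
    fix x c assume x: "x \<in> carrier M"
    show "?s x c \<otimes>\<^bsub>?R\<^esub> g \<otimes>\<^bsub>?R\<^esub> h = ?s x c \<otimes>\<^bsub>?R\<^esub> (g \<otimes>\<^bsub>?R\<^esub> h)" using that(2)
    proof (rule ind)
      fix y d assume y: "y \<in> carrier M"
      show "?s x c \<otimes>\<^bsub>?R\<^esub> ?s y d \<otimes>\<^bsub>?R\<^esub> h = ?s x c \<otimes>\<^bsub>?R\<^esub> (?s y d \<otimes>\<^bsub>?R\<^esub> h)" using that(3)
        by (rule ind) (simp_all add: z distl distr ss x y m_assoc mult.assoc)
    qed (simp_all add: z distl distr)
  qed (simp_all add: z distl distr)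
  have onel: "\<one>\<^bsub>?R\<^esub> \<otimes>\<^bsub>?R\<^esub> f = f" if "f \<in> carrier ?R" for f
    using that by (rule ind) (simp_all add: one z distl distr ss)
  show ?thesis
  proof (rule cringI)
    show "abelian_group ?R"
    proof (rule abelian_groupI)
      fix f assume "f \<in> carrier ?R"
      then show "\<exists>g\<in>carrier ?R. g \<oplus>\<^bsub>?R\<^esub> f = \<zero>\<^bsub>?R\<^esub>"
        by (intro bexI[of _ "- f"]) (auto simp: car add zero in_keys_iff)
    next
      fix f g assume "f \<in> carrier ?R" "g \<in> carrier ?R"
      then show "f \<oplus>\<^bsub>?R\<^esub> g \<in> carrier ?R" using keys_add[of f g] by (auto simp: car add)
    qed (simp_all add: car add zero ac_simps)
    show "comm_monoid ?R"
      by (rule comm_monoidI) (auto intro: closed assoc onel comm simp: car[of "?s \<one>\<^bsub>M\<^esub> 1"] onel[unfolded one] one)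
  qed (simp add: add distl)
qed

end

theory Submission
  imports Defs
begin

text \<open>
  Write \<open>F = Q - P\<close>. Unwinding the orthogonal complement, \<open>f\<close> lies in \<open>Irr(I)\<close> iff for all \<open>b \<in> Q\<close> and
  \<open>h \<in> F\<close> the coefficient of \<open>t\<^sup>b f\<close> in the class of \<open>w + h\<close> vanishes. Choose elements \<open>g\<^sub>1, \<dots>, g\<^sub>r\<close> of \<open>F\<close>
  that are independent modulo the congruence, with \<open>r\<close> maximal, and let \<open>S\<close> be the polynomial subring
  they generate. Collecting the coefficients in the classes \<open>w + \<Sum> n\<^sub>i g\<^sub>i\<close>, \<open>n \<in> \<int>\<^sup>r\<close>, into one Laurent
  polynomial gives an \<open>S\<close>-linear functional \<open>C\<close>, and \<open>Irr(I)\<close> is the largest ideal in its kernel. Every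
  generator of \<open>Q\<close> has a power that is a scalar in \<open>Frac(S)\<close> modulo \<open>Irr(I)\<close>: those in \<open>P\<close> are nilpotent,
  those in \<open>F\<close> are torsion over the \<open>g\<^sub>i\<close>. So over \<open>Frac(S)\<close> the quotient by \<open>Irr(I)\<close> is a
  finite-dimensional commutative Frobenius algebra, hence a product of local ones, each with simple
  socle. Its primitive idempotents \<open>e\<close> yield the components \<open>(Irr(I) : e)\<close>. They are primary and
  irreducible, and their radicals are pairwise incomparable, which forces uniqueness.
\<close>

section \<open>Ideals of a commutative ring type\<close>

text \<open>The form attached to \<open>C\<close> is nondegenerate by the very definition of the
  ideal, so the work lies in finiteness. Over the base field the quotient has infinite dimension as
  soon as the units have positive rank; this is why coefficients are collected into a Laurent
  polynomial instead of being taken one at a time. That this is well defined rests on mesoprimarity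
  at \<open>w\<close>: for units \<open>a\<close>, \<open>b\<close> the classes of
  \<open>w + a\<close> and \<open>w + b\<close> agree only if those of \<open>a\<close> and
  \<open>b\<close> do, so a class determines its exponents. Torsion among the units is what remains
  over the fractions, and it may split the algebra into several factors; splitting by idempotents
  rather than by characters needs neither roots of unity nor a condition on the characteristic.
  Irreducibility is a count of dimensions: for socle elements \<open>x\<close>, \<open>y\<close> of
  a local factor whose residue field has dimension \<open>m\<close>, a relation
  \<open>x u + y v = 0\<close> amounts to \<open>m\<close> equations in \<open>2 m\<close> unknowns.
  No field of fractions is formed; denominators are cleared throughout, which is harmless because
  multiplication by a nonzero scalar is injective modulo the ideal.\<close>

definition idl :: "'a::comm_ring_1 set \<Rightarrow> bool" where
  "idl N \<longleftrightarrow> 0 \<in> N \<and> (\<forall>x\<in>N. \<forall>y\<in>N. x + y \<in> N) \<and> (\<forall>x\<in>N. \<forall>r. r * x \<in> N)"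

definition radical_of :: "'a::comm_ring_1 set \<Rightarrow> 'a set" where
  "radical_of N = {a. \<exists>n::nat. a ^ n \<in> N}"

definition primary_idl :: "'a::comm_ring_1 set \<Rightarrow> bool" where
  "primary_idl N \<longleftrightarrow> idl N \<and> 1 \<notin> N \<and> (\<forall>a b. a * b \<in> N \<longrightarrow> a \<in> N \<or> b \<in> radical_of N)"

text \<open>Any two nonzero principal ideals of the quotient ring meet nontrivially. This
  elementwise form of irreducibility can be checked on single elements, without intersections of
  ideals.\<close>

definition irreducible_idl :: "'a::comm_ring_1 set \<Rightarrow> bool" where
  "irreducible_idl N \<longleftrightarrow>
     idl N \<and> (\<forall>f g. f \<notin> N \<longrightarrow> g \<notin> N \<longrightarrow> (\<exists>a b. a * f \<notin> N \<and> a * f - b * g \<in> N))"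

lemma idl_zero: "idl N \<Longrightarrow> 0 \<in> N"
  and idl_add: "idl N \<Longrightarrow> x \<in> N \<Longrightarrow> y \<in> N \<Longrightarrow> x + y \<in> N"
  and idl_mult: "idl N \<Longrightarrow> x \<in> N \<Longrightarrow> r * x \<in> N"
  by (auto simp: idl_def)

lemma idl_mult_right: "idl N \<Longrightarrow> x \<in> N \<Longrightarrow> x * r \<in> N"
  using idl_mult[of N x r] by (simp add: mult.commute)

lemma idl_uminus: "idl N \<Longrightarrow> x \<in> N \<Longrightarrow> - x \<in> N"
  using idl_mult[of N x "-1"] by simp

lemma idl_diff: "idl N \<Longrightarrow> x \<in> N \<Longrightarrow> y \<in> N \<Longrightarrow> x - y \<in> N"
  using idl_add[of N x "- y"] idl_uminus[of N y] by simp

lemma idl_sum: "idl N \<Longrightarrow> (\<And>x. x \<in> A \<Longrightarrow> f x \<in> N) \<Longrightarrow> sum f A \<in> N"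
  by (induction A rule: infinite_finite_induct) (auto simp: idl_zero idl_add)

lemma idl_diff_cong: "idl N \<Longrightarrow> x - y \<in> N \<Longrightarrow> x \<in> N \<longleftrightarrow> y \<in> N"
  using idl_add[of N "x - y" y] idl_diff[of N x "x - y"] by auto

lemma idl_diff_trans: "idl N \<Longrightarrow> x - y \<in> N \<Longrightarrow> y - z \<in> N \<Longrightarrow> x - z \<in> N"
  using idl_add[of N "x - y" "y - z"] by simp

lemma idl_diff_sym: "idl N \<Longrightarrow> x - y \<in> N \<Longrightarrow> y - x \<in> N"
  using idl_uminus[of N "x - y"] by simp

lemma idl_power_le: "idl N \<Longrightarrow> x ^ n \<in> N \<Longrightarrow> n \<le> m \<Longrightarrow> x ^ m \<in> N"
  using idl_mult[of N "x ^ n" "x ^ (m - n)"] by (simp flip: power_add)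

lemma idl_nilpotent_add:
  assumes N: "idl N" and "x ^ m \<in> N" "y ^ n \<in> N"
  shows "(x + y) ^ (m + n) \<in> N"
proof -
  have "of_nat ((m + n) choose k) * x ^ k * y ^ (m + n - k) \<in> N" for k
  proof (cases "m \<le> k")
    case True
    then have "x ^ k \<in> N" using idl_power_le assms by blast
    then show ?thesis using N by (simp add: idl_mult idl_mult_right)
  next
    case False
    then have "y ^ (m + n - k) \<in> N" using idl_power_le[OF N assms(3)] by simp
    then show ?thesis using N by (simp add: idl_mult)
  qed
  then show ?thesis unfolding binomial_ring by (intro idl_sum[OF N]) auto
qed

lemma idl_radical_of: "idl N \<Longrightarrow> idl (radical_of N)"
  unfolding idl_def[of "radical_of N"]
proof (intro conjI ballI allI)
  assume N: "idl N"
  show "0 \<in> radical_of N" using idl_zero[OF N] by (auto simp: radical_of_def intro!: exI[of _ 1])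
  show "x + y \<in> radical_of N" if "x \<in> radical_of N" "y \<in> radical_of N" for x y
    using that idl_nilpotent_add[OF N] unfolding radical_of_def by blast
  show "r * x \<in> radical_of N" if "x \<in> radical_of N" for x r
    using that idl_mult[OF N] unfolding radical_of_def by (force simp: power_mult_distrib)
qed

lemma subset_radical_of: "N \<subseteq> radical_of N"
  by (auto simp: radical_of_def intro: exI[of _ 1])

lemma radical_of_mono: "idl N \<Longrightarrow> M \<subseteq> radical_of N \<Longrightarrow> radical_of M \<subseteq> radical_of N"
  unfolding radical_of_def by (force simp flip: power_mult)

lemma primary_radical_prime:
  assumes N: "primary_idl N" and ab: "a * b \<in> radical_of N"
  shows "a \<in> radical_of N \<or> b \<in> radical_of N"
proof -
  obtain n where "a ^ n * b ^ n \<in> N" using ab by (auto simp: radical_of_def power_mult_distrib)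
  then have "a ^ n \<in> N \<or> b ^ n \<in> radical_of N" using N by (auto simp: primary_idl_def)
  then show ?thesis by (auto simp: radical_of_def simp flip: power_mult)
qed

lemma primary_idl_one_notin_radical: "primary_idl N \<Longrightarrow> 1 \<notin> radical_of N"
  by (auto simp: primary_idl_def radical_of_def)

text \<open>The radical of a primary ideal is prime, so a product of elements outside it, one from
  each member of \<open>C\<close>, stays outside it and lies in every member.\<close>

lemma ex_Inter_notin_radical:
  assumes "finite C" "primary_idl A" "\<And>B. B \<in> C \<Longrightarrow> idl B" "\<And>B. B \<in> C \<Longrightarrow> \<not> B \<subseteq> radical_of A"
  shows "\<exists>z\<in>\<Inter>C. z \<notin> radical_of A"
  using assms
proof (induction C rule: finite_induct)
  case empty
  then show ?case using primary_idl_one_notin_radical by auto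
next
  case (insert B C)
  then obtain z x where z: "z \<in> \<Inter>C" "z \<notin> radical_of A" and x: "x \<in> B" "x \<notin> radical_of A"
    by (metis insert_iff subsetI)
  have "x * z \<notin> radical_of A" using primary_radical_prime[OF insert.prems(1)] x z by blast
  moreover have "x * z \<in> \<Inter>(insert B C)"
    using insert.prems x z by (auto intro: idl_mult idl_mult_right)
  ultimately show ?case by blast
qed

section \<open>Uniqueness of minimal primary decompositions\<close>

lemma ideal_type_alg: "ideal J (ring_of_type_algebra :: 'a::comm_ring_1 ring) \<longleftrightarrow> idl J"
proof
  assume "ideal J (ring_of_type_algebra :: 'a ring)"
  then interpret ideal J "ring_of_type_algebra :: 'a ring" .
  show "idl J"
    unfolding idl_def using I_l_closed additive_subgroup.zero_closed[OF is_additive_subgroup]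
      additive_subgroup.a_closed[OF is_additive_subgroup]
    by (auto simp: ring_of_type_algebra_def)
next
  assume J: "idl J"
  interpret R: cring "ring_of_type_algebra :: 'a ring" by (rule cring_from_type_algebra)
  show "ideal J (ring_of_type_algebra :: 'a ring)"
  proof (rule idealI)
    show "subgroup J (add_monoid (ring_of_type_algebra :: 'a ring))"
    proof (rule R.add.subgroupI)
      fix a assume a: "a \<in> J"
      have "\<ominus>\<^bsub>ring_of_type_algebra\<^esub> a = - a"
        by (rule R.minus_equality) (auto simp: ring_of_type_algebra_def)
      then show "\<ominus>\<^bsub>ring_of_type_algebra\<^esub> a \<in> J" using idl_uminus[OF J a] by simp
    qed (use idl_zero[OF J] idl_add[OF J] in \<open>auto simp: ring_of_type_algebra_def\<close>)
  qed (use idl_mult[OF J] idl_mult_right[OF J] R.ring_axioms in \<open>auto simp: ring_of_type_algebra_def\<close>)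
qed

lemma type_alg_pow: "x [^]\<^bsub>(ring_of_type_algebra :: 'a::comm_ring_1 ring)\<^esub> (n::nat) = x ^ n"
  by (induction n) (simp_all add: nat_pow_def ring_of_type_algebra_def mult.commute)

lemma ideal_radical_type_alg: "ideal_radical ring_of_type_algebra J = radical_of J"
  unfolding ideal_radical_def radical_of_def type_alg_pow by (simp add: ring_of_type_algebra_def)

lemma primary_ideal_type_alg: "primary_ideal ring_of_type_algebra J \<longleftrightarrow> primary_idl J"
proof -
  have "J \<noteq> UNIV \<longleftrightarrow> 1 \<notin> J" if "idl J"
    using that idl_mult[of J 1] by auto
  then show ?thesis
    unfolding primary_ideal_def primary_idl_def type_alg_pow ideal_type_alg radical_of_def
    by (auto simp: ring_of_type_algebra_def)
qed

text \<open>If \<open>J\<close> is \<open>A \<inter> B\<close>, then a common multiple modulo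
  \<open>J\<close> of some \<open>f\<close> in \<open>A - J\<close> and some \<open>g\<close> in
  \<open>B - J\<close> lies in both ideals, yet not in \<open>J\<close>.\<close>

lemma irreducible_ideal_type_alg:
  assumes "irreducible_idl J"
  shows "irreducible_ideal ring_of_type_algebra J"
  unfolding irreducible_ideal_def ideal_type_alg
proof (intro conjI notI)
  show J: "idl J" using assms by (simp add: irreducible_idl_def)
  assume "\<exists>A B. idl A \<and> idl B \<and> J \<subset> A \<and> J \<subset> B \<and> J = A \<inter> B"
  then obtain A B where A: "idl A" "J \<subset> A" and B: "idl B" "J \<subset> B" and eq: "J = A \<inter> B" by blast
  from A B obtain f g where fg: "f \<in> A" "f \<notin> J" "g \<in> B" "g \<notin> J" by blast
  then obtain a b where ab: "a * f \<notin> J" "a * f - b * g \<in> J"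
    using assms unfolding irreducible_idl_def by meson
  have "a * f \<in> B" using idl_diff_cong[OF B(1)] ab(2) idl_mult[OF B(1) fg(3)] B(2) by blast
  then show False using ab(1) eq idl_mult[OF A(1) fg(1)] by blast
qed

lemma minimal_primary_decomposition_type_alg:
  "minimal_primary_decomposition ring_of_type_algebra J C \<longleftrightarrow>
     finite C \<and> (\<forall>A\<in>C. primary_idl A) \<and> J = \<Inter>C \<and> (\<forall>A\<in>C. J \<noteq> \<Inter>(C - {A})) \<and> inj_on radical_of C"
proof -
  have [simp]: "ideal_radical \<lparr>carrier = UNIV, monoid.mult = (*), one = 1, zero = 0, add = (+)\<rparr>
      = (radical_of :: 'a set \<Rightarrow> _)"
    unfolding ring_of_type_algebra_def[symmetric]
    by (rule ext) (rule ideal_radical_type_alg)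
  show ?thesis
    unfolding minimal_primary_decomposition_def primary_ideal_type_alg
    by (simp add: ring_of_type_algebra_def)
qed

text \<open>Incomparable radicals leave no embedded components, so the intersection determines each
  component \<open>A\<close>: take \<open>z\<close> in all other components but outside the radical
  of \<open>A\<close>; then \<open>x\<close> lies in \<open>A\<close> iff \<open>x * z\<close> lies
  in the intersection.\<close>

lemma unique_minimal_primary_decomposition:
  fixes C :: "'a::comm_ring_1 set set"
  assumes C: "finite C" and prim: "\<And>A. A \<in> C \<Longrightarrow> primary_idl A"
    and incomp: "\<And>A B. A \<in> C \<Longrightarrow> B \<in> C \<Longrightarrow> radical_of A \<subseteq> radical_of B \<Longrightarrow> A = B"
  shows "minimal_primary_decomposition ring_of_type_algebra (\<Inter>C) C"
    and "minimal_primary_decomposition ring_of_type_algebra (\<Inter>C) C' \<Longrightarrow> C' = C"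
proof -
  have idl: "idl A" if "A \<in> C" for A using prim[OF that] by (simp add: primary_idl_def)
  \<comment> \<open>Otherwise \<open>ex_Inter_notin_radical\<close> would give an element of
    \<open>\<Inter>D\<close>, hence of \<open>A\<close>, outside the radical of
    \<open>A\<close>.\<close>
  have below: "\<exists>B\<in>D. radical_of B \<subseteq> radical_of A"
    if "finite D" "\<And>B. B \<in> D \<Longrightarrow> idl B" "\<Inter>D \<subseteq> A" "primary_idl A" for A :: "'a set" and D
    using ex_Inter_notin_radical[OF that(1,4,2)] that(3) subset_radical_of[of A]
      radical_of_mono[of A] that(4)
    by (metis primary_idl_def subset_iff)
  have outside: "\<exists>z\<in>\<Inter>(C - {A}). z \<notin> radical_of A" if "A \<in> C" for A
  proof (rule ex_Inter_notin_radical)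
    show "\<not> B \<subseteq> radical_of A" if "B \<in> C - {A}" for B
      using incomp[of B A] radical_of_mono[OF idl[OF \<open>A \<in> C\<close>], of B] that \<open>A \<in> C\<close> by blast
  qed (use C prim idl that in auto)
  show "minimal_primary_decomposition ring_of_type_algebra (\<Inter>C) C"
    unfolding minimal_primary_decomposition_type_alg
  proof (intro conjI ballI)
    show "\<Inter>C \<noteq> \<Inter>(C - {A})" if "A \<in> C" for A
      using outside[OF that] that subset_radical_of[of A] by blast
    show "inj_on radical_of C" by (rule inj_onI) (use incomp in blast)
  qed (use C prim in auto)
  assume "minimal_primary_decomposition ring_of_type_algebra (\<Inter>C) C'"
  note conj = this[unfolded minimal_primary_decomposition_type_alg]
  note C' = conj[THEN conjunct1] conj[THEN conjunct2, THEN conjunct1, THEN bspec]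
    conj[THEN conjunct2, THEN conjunct2, THEN conjunct1]
    conj[THEN conjunct2, THEN conjunct2, THEN conjunct2, THEN conjunct1, THEN bspec]
    conj[THEN conjunct2, THEN conjunct2, THEN conjunct2, THEN conjunct2]
  have idl': "idl A" if "A \<in> C'" for A using C'(2)[OF that] by (simp add: primary_idl_def)
  have "A \<in> C'" if A: "A \<in> C" for A
  proof -
    have sub: "\<Inter>C' \<subseteq> A" unfolding C'(3)[symmetric] using A by (rule Inter_lower)
    obtain A' where A': "A' \<in> C'" "radical_of A' \<subseteq> radical_of A"
      using below[OF C'(1) idl' sub prim[OF A]] by fast
    \<comment> \<open>\<open>below\<close> yields some \<open>B\<close> in \<open>C\<close> whose
      radical lies under that of \<open>B'\<close>. Incomparability forces \<open>B = A\<close>, so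
      the radicals of \<open>A\<close>, \<open>B\<close> and \<open>B'\<close> coincide.\<close>
    have rad_eq: "radical_of B' = radical_of A" if B': "B' \<in> C'" "radical_of B' \<subseteq> radical_of A" for B'
    proof -
      have "\<Inter>C \<subseteq> B'" unfolding C'(3) using B'(1) by (rule Inter_lower)
      then obtain B where B: "B \<in> C" "radical_of B \<subseteq> radical_of B'"
        using below[OF C idl _ C'(2)[OF B'(1)]] by fast
      then have "B = A" using incomp[OF B(1) A] B'(2) by (meson order_trans)
      then show ?thesis using B(2) B'(2) by simp
    qed
    obtain z where z: "z \<in> \<Inter>(C - {A})" "z \<notin> radical_of A" using outside[OF A] by fast
    have "A \<subseteq> A'"
    proof
      fix x assume x: "x \<in> A"
      have "x * z \<in> B" if B: "B \<in> C" for B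
        by (cases "B = A") (use x z B idl[OF B] in \<open>auto intro: idl_mult idl_mult_right\<close>)
      then have "x * z \<in> \<Inter>C" by blast
      then have "x * z \<in> A'" unfolding C'(3) using A'(1) by blast
      then show "x \<in> A'" using C'(2)[OF A'(1)] rad_eq[OF A'] z(2)
        unfolding primary_idl_def by blast
    qed
    moreover have "A' \<subseteq> A"
    proof
      have "\<exists>z\<in>\<Inter>(C' - {A'}). z \<notin> radical_of A"
      proof (rule ex_Inter_notin_radical)
        show "\<not> B \<subseteq> radical_of A" if B: "B \<in> C' - {A'}" for B
        proof
          assume "B \<subseteq> radical_of A"
          then have "radical_of B = radical_of A'"
            using rad_eq[of B] rad_eq[OF A'] B radical_of_mono[OF idl[OF A], of B] by simp
          then show False using inj_onD[OF C'(5)] B A'(1) by blast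
        qed
      qed (use C'(1) idl' prim[OF A] in simp_all)
      then obtain z where z: "z \<in> \<Inter>(C' - {A'})" "z \<notin> radical_of A" by fast
      fix x assume x: "x \<in> A'"
      have "x * z \<in> B" if B: "B \<in> C'" for B
        by (cases "B = A'") (use x z B idl'[OF B] in \<open>auto intro: idl_mult idl_mult_right\<close>)
      then have "x * z \<in> A" using sub by blast
      then show "x \<in> A" using prim[OF A] z(2) unfolding primary_idl_def by blast
    qed
    ultimately show ?thesis using A'(1) by simp
  qed
  then have "C \<subseteq> C'" by blast
  moreover have "C' \<subseteq> C"
  proof
    fix A' assume A': "A' \<in> C'"
    show "A' \<in> C"
    proof (rule ccontr)
      \<comment> \<open>All of \<open>C\<close> would then occur among the other members of
        \<open>C'\<close>, which makes \<open>A'\<close> redundant.\<close>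
      assume "A' \<notin> C"
      then have "C \<subseteq> C' - {A'}" using \<open>C \<subseteq> C'\<close> by blast
      then have "\<Inter>(C' - {A'}) \<subseteq> \<Inter>C" by (rule Inter_anti_mono)
      moreover have "\<Inter>C \<subseteq> \<Inter>(C' - {A'})" unfolding C'(3) by (rule Inter_anti_mono) blast
      ultimately show False using C'(4)[OF A'] by blast
    qed
  qed
  ultimately show "C' = C" by blast
qed

section \<open>Finite-dimensional algebras with a nondegenerate functional\<close>

text \<open>Gaussian elimination without division: the pivot \<open>a i j0\<close> is removed from
  the other equations by cross-multiplication, so the reduced coefficients are minors and the
  solution stays in the subring \<open>S\<close>.\<close>

lemma homogeneous_system_solvable:
  fixes a :: "'i \<Rightarrow> 'j \<Rightarrow> 's::idom"
  assumes S: "1 \<in> S" "\<And>x y. x \<in> S \<Longrightarrow> y \<in> S \<Longrightarrow> x - y \<in> S" "\<And>x y. x \<in> S \<Longrightarrow> y \<in> S \<Longrightarrow> x * y \<in> S"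
    and "finite I" "finite J" "card I < card J" and "\<And>i j. i \<in> I \<Longrightarrow> j \<in> J \<Longrightarrow> a i j \<in> S"
  shows "\<exists>c. (\<exists>j\<in>J. c j \<noteq> 0) \<and> (\<forall>j. c j \<in> S) \<and> (\<forall>i\<in>I. (\<Sum>j\<in>J. a i j * c j) = 0)"
  using assms(4-)
proof (induction I arbitrary: J a rule: finite_induct)
  case empty
  then obtain j where "j \<in> J" by fastforce
  then show ?case using S(1) by (intro exI[of _ "\<lambda>_. 1"]) auto
next
  case (insert i I)
  show ?case
  proof (cases "\<forall>j\<in>J. a i j = 0")
    case True
    obtain c where "\<exists>j\<in>J. c j \<noteq> 0" "\<forall>j. c j \<in> S" "\<forall>i\<in>I. (\<Sum>j\<in>J. a i j * c j) = 0"
      using insert.IH[of J a] insert.prems insert.hyps by auto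
    then show ?thesis using True by (intro exI[of _ c]) auto
  next
    case False
    then obtain j0 where j0: "j0 \<in> J" "a i j0 \<noteq> 0" by blast
    let ?J = "J - {j0}"
    have "card I < card ?J" using insert j0 by (simp add: card_Diff_singleton)
    moreover have "a i' j * a i j0 - a i' j0 * a i j \<in> S" if "i' \<in> I" "j \<in> ?J" for i' j
      using insert.prems(3) that j0(1) S by simp
    ultimately obtain c where c: "\<exists>j\<in>?J. c j \<noteq> 0" "\<forall>j. c j \<in> S"
        "\<forall>i'\<in>I. (\<Sum>j\<in>?J. (a i' j * a i j0 - a i' j0 * a i j) * c j) = 0"
      using insert.IH[of ?J "\<lambda>i' j. a i' j * a i j0 - a i' j0 * a i j"] insert.prems by auto
    define s where "s = (\<Sum>j\<in>?J. a i j * c j)"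
    \<comment> \<open>Scaling the other unknowns by the pivot makes equation \<open>i\<close>
      solvable for unknown \<open>j0\<close> without a division.\<close>
    define c' where "c' j = (if j = j0 then - s else a i j0 * c j)" for j
    have split: "(\<Sum>j\<in>J. a i' j * c' j) = a i' j0 * (- s) + (\<Sum>j\<in>?J. a i' j * (a i j0 * c j))" for i'
      using insert.prems j0 by (subst sum.remove[of _ j0]) (auto simp: c'_def intro!: sum.cong)
    have "(\<Sum>j\<in>?J. a i j * (a i j0 * c j)) = a i j0 * s"
      unfolding s_def sum_distrib_left by (intro sum.cong refl) (simp add: mult_ac)
    then have "(\<Sum>j\<in>J. a i j * c' j) = 0" by (simp add: split)
    moreover have "(\<Sum>j\<in>J. a i' j * c' j) = 0" if "i' \<in> I" for i'
    proof -
      have "0 = (\<Sum>j\<in>?J. a i' j * (a i j0 * c j) - a i' j0 * (a i j * c j))"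
        using c(3) that by (simp add: algebra_simps)
      also have "\<dots> = (\<Sum>j\<in>?J. a i' j * (a i j0 * c j)) - a i' j0 * s"
        by (simp add: sum_subtractf s_def sum_distrib_left)
      finally show ?thesis unfolding split by simp
    qed
    moreover have "\<exists>j\<in>J. c' j \<noteq> 0" using c(1) j0(2) by (auto simp: c'_def)
    moreover have "c' j \<in> S" for j
    proof -
      have zero: "0 \<in> S" using S(2)[OF S(1,1)] by simp
      have neg: "- x \<in> S" if "x \<in> S" for x using S(2)[OF zero that] by simp
      have plus: "x + y \<in> S" if "x \<in> S" "y \<in> S" for x y using S(2)[OF that(1) neg[OF that(2)]] by simp
      have sums: "sum f A \<in> S" if "\<And>x. x \<in> A \<Longrightarrow> f x \<in> S" for f and A :: "'j set"
        using that by (induction A rule: infinite_finite_induct) (auto simp: zero plus)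
      have "s \<in> S" unfolding s_def by (rule sums, rule S(3)) (use c(2) insert.prems(3) in auto)
      then show ?thesis using c(2) S(3) insert.prems(3) j0(1) neg by (simp add: c'_def)
    qed
    ultimately show ?thesis by blast
  qed
qed

text \<open>
  The quotient by \<open>N\<close> becomes a finite-dimensional algebra over the field of fractions of \<open>F\<close>, with
  \<open>C\<close> inducing a nondegenerate bilinear form. The argument below works without passing to fractions:
  all statements hold up to multiplication by \<open>regulars\<close>, the images of nonzero scalars.
\<close>

locale frobenius_quotient =
  fixes F :: "'s::idom set" and \<kappa> :: "'s \<Rightarrow> 'r::comm_ring_1" and C :: "'r \<Rightarrow> 's"
    and N :: "'r set" and Y :: "'r set"
  assumes F_one: "1 \<in> F" and F_diff: "\<And>c d. c \<in> F \<Longrightarrow> d \<in> F \<Longrightarrow> c - d \<in> F"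
    and F_mult: "\<And>c d. c \<in> F \<Longrightarrow> d \<in> F \<Longrightarrow> c * d \<in> F"
    and \<kappa>_add: "\<And>c d. c \<in> F \<Longrightarrow> d \<in> F \<Longrightarrow> \<kappa> (c + d) = \<kappa> c + \<kappa> d"
    and \<kappa>_mult: "\<And>c d. c \<in> F \<Longrightarrow> d \<in> F \<Longrightarrow> \<kappa> (c * d) = \<kappa> c * \<kappa> d" and \<kappa>_one: "\<kappa> 1 = 1"
    and C_add: "\<And>x y. C (x + y) = C x + C y"
    and C_scale: "\<And>c x. c \<in> F \<Longrightarrow> C (\<kappa> c * x) = c * C x"
    and C_denom: "\<And>x. \<exists>d. d \<in> F \<and> d \<noteq> 0 \<and> d * C x \<in> F"
    and N_def: "N = {f. \<forall>g. C (f * g) = 0}"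
    and finite_Y: "finite Y"
    and span_Y: "\<And>f. \<exists>d c. d \<in> F \<and> d \<noteq> 0 \<and> (\<forall>y. c y \<in> F) \<and> \<kappa> d * f - (\<Sum>y\<in>Y. \<kappa> (c y) * y) \<in> N"
begin

lemma F_zero: "0 \<in> F"
  using F_diff[OF F_one F_one] by simp

lemma F_uminus: "c \<in> F \<Longrightarrow> - c \<in> F"
  using F_diff[OF F_zero] by force

lemma F_add: "c \<in> F \<Longrightarrow> d \<in> F \<Longrightarrow> c + d \<in> F"
  using F_diff[of c "- d"] F_uminus[of d] by simp

lemma F_sum: "(\<And>x. x \<in> A \<Longrightarrow> f x \<in> F) \<Longrightarrow> sum f A \<in> F"
  by (induction A rule: infinite_finite_induct) (auto simp: F_zero F_add)

lemma C_zero: "C 0 = 0"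
  using C_add[of 0 0] by (metis add.right_neutral add_left_cancel)

lemma C_sum: "C (sum f A) = (\<Sum>x\<in>A. C (f x))"
  by (induction A rule: infinite_finite_induct) (simp_all add: C_zero C_add)

lemma \<kappa>_zero: "\<kappa> 0 = 0"
  using \<kappa>_add[OF F_zero F_zero] by (metis add.right_neutral add_left_cancel)

lemma \<kappa>_diff: "c \<in> F \<Longrightarrow> d \<in> F \<Longrightarrow> \<kappa> (c - d) = \<kappa> c - \<kappa> d"
  using \<kappa>_add[OF F_diff, of c d d] by (simp add: algebra_simps)

lemma \<kappa>_sum: "(\<And>x. x \<in> A \<Longrightarrow> f x \<in> F) \<Longrightarrow> \<kappa> (sum f A) = (\<Sum>x\<in>A. \<kappa> (f x))"
  by (induction A rule: infinite_finite_induct) (auto simp: \<kappa>_zero \<kappa>_add F_sum)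

lemma idl_N: "idl N"
  unfolding idl_def N_def by (auto simp: C_zero C_add distrib_right mult.assoc) (metis mult.left_commute)

lemma N_I: "(\<And>g. C (f * g) = 0) \<Longrightarrow> f \<in> N"
  by (simp add: N_def)

lemma C_N: "f \<in> N \<Longrightarrow> C f = 0"
  unfolding N_def by (auto dest: spec[of _ 1])

section \<open>Linear algebra modulo \<open>N\<close> with cleared denominators\<close>

definition regulars :: "'r set" where
  "regulars = \<kappa> ` (F - {0})"

lemma regulars_I: "c \<in> F \<Longrightarrow> c \<noteq> 0 \<Longrightarrow> \<kappa> c \<in> regulars"
  by (simp add: regulars_def)

lemma regulars_one: "1 \<in> regulars"
  using regulars_I[OF F_one] by (simp add: \<kappa>_one)

lemma regulars_mult: "s \<in> regulars \<Longrightarrow> t \<in> regulars \<Longrightarrow> s * t \<in> regulars"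
proof -
  assume "s \<in> regulars" "t \<in> regulars"
  then obtain c d where "c \<in> F" "c \<noteq> 0" "s = \<kappa> c" "d \<in> F" "d \<noteq> 0" "t = \<kappa> d"
    by (auto simp: regulars_def)
  then show "s * t \<in> regulars" using regulars_I[of "c * d"] by (simp add: F_mult \<kappa>_mult)
qed

lemma regulars_power: "s \<in> regulars \<Longrightarrow> s ^ n \<in> regulars"
  by (induction n) (simp_all add: regulars_one regulars_mult)

text \<open>\<open>C\<close> is linear over \<open>F\<close> and takes values in a domain, so a
  nonzero scalar can be divided out of \<open>C (\<kappa> c * (x * g)) = 0\<close> for every
  \<open>g\<close>. This replaces the passage to fractions.\<close>

lemma regulars_cancel:
  assumes "s \<in> regulars" "s * x \<in> N"
  shows "x \<in> N"
proof (rule N_I)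
  fix g
  obtain c where c: "c \<in> F" "c \<noteq> 0" "s = \<kappa> c" using assms(1) by (auto simp: regulars_def)
  have "C (\<kappa> c * (x * g)) = 0" using assms(2) unfolding N_def c(3) by (simp add: mult.assoc)
  then show "C (x * g) = 0" using c by (simp add: C_scale)
qed

text \<open>The values of \<open>C\<close> need not lie in \<open>F\<close>. Each equation is
  multiplied by a common denominator of its coefficients, which does not change its
  solutions.\<close>

lemma scaled_system_solvable:
  assumes "finite I" "finite J" "card I < card J"
  shows "\<exists>c. (\<exists>j\<in>J. c j \<noteq> 0) \<and> (\<forall>j. c j \<in> F) \<and> (\<forall>i\<in>I. (\<Sum>j\<in>J. C (x i j) * c j) = 0)"
proof -
  have "\<exists>d. d \<in> F \<and> d \<noteq> 0 \<and> (\<forall>j\<in>J. d * C (x i j) \<in> F)" for i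
    using assms(2)
  proof (induction J rule: finite_induct)
    case (insert j J)
    then obtain d where d: "d \<in> F" "d \<noteq> 0" "\<forall>j\<in>J. d * C (x i j) \<in> F" by blast
    obtain d' where d': "d' \<in> F" "d' \<noteq> 0" "d' * C (x i j) \<in> F" using C_denom by blast
    have "d * d' * C (x i j) \<in> F" using F_mult[OF d(1) d'(3)] by (simp add: mult_ac)
    moreover have "d * d' * C (x i k) \<in> F" if "k \<in> J" for k
      using F_mult[OF d'(1) d(3)[rule_format, OF that]] by (simp add: mult_ac)
    ultimately show ?case using d d' F_mult by (intro exI[of _ "d * d'"]) auto
  qed (use F_one in \<open>auto intro: exI[of _ 1]\<close>)
  then obtain d where d: "\<And>i. d i \<in> F" "\<And>i. d i \<noteq> 0" "\<And>i j. j \<in> J \<Longrightarrow> d i * C (x i j) \<in> F" by metis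
  obtain c where c: "\<exists>j\<in>J. c j \<noteq> 0" "\<forall>j. c j \<in> F" "\<And>i. i \<in> I \<Longrightarrow> (\<Sum>j\<in>J. d i * C (x i j) * c j) = 0"
    using homogeneous_system_solvable[OF F_one F_diff F_mult assms, of "\<lambda>i j. d i * C (x i j)"] d(3)
    by blast
  have "(\<Sum>j\<in>J. C (x i j) * c j) = 0" if "i \<in> I" for i
    using c(3)[OF that] d(2)[of i] by (simp add: mult.assoc flip: sum_distrib_left)
  then show ?thesis using c(1,2) by blast
qed

text \<open>The dimension is at most \<open>card Y\<close>: a linear relation is found among the
  coordinate vectors of the \<open>x j\<close> with respect to \<open>Y\<close>, and the
  denominators \<open>d j\<close> of the coordinates are absorbed into its coefficients.\<close>

lemma dependent:
  assumes "finite J" "card Y < card J"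
  shows "\<exists>c. (\<exists>j\<in>J. c j \<noteq> 0) \<and> (\<forall>j. c j \<in> F) \<and> (\<Sum>j\<in>J. \<kappa> (c j) * x j) \<in> N"
proof -
  have "\<forall>j. \<exists>d a. d \<in> F \<and> d \<noteq> 0 \<and> (\<forall>y. a y \<in> F) \<and> \<kappa> d * x j - (\<Sum>y\<in>Y. \<kappa> (a y) * y) \<in> N"
    using span_Y by blast
  then obtain d a where d: "\<And>j. d j \<in> F" "\<And>j. d j \<noteq> 0" and a: "\<And>j y. a j y \<in> F"
      "\<And>j. \<kappa> (d j) * x j - (\<Sum>y\<in>Y. \<kappa> (a j y) * y) \<in> N" by metis
  obtain c where c: "\<exists>j\<in>J. c j \<noteq> 0" "\<And>j. c j \<in> F" "\<And>y. y \<in> Y \<Longrightarrow> (\<Sum>j\<in>J. a j y * c j) = 0"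
    using homogeneous_system_solvable[OF F_one F_diff F_mult finite_Y assms, of "\<lambda>y j. a j y"] a(1)
    by blast
  have "(\<Sum>y\<in>Y. \<kappa> (\<Sum>j\<in>J. a j y * c j) * y) = (\<Sum>j\<in>J. \<kappa> (c j) * (\<Sum>y\<in>Y. \<kappa> (a j y) * y))"
    using a(1) c(2) unfolding sum_distrib_left
    by (subst sum.swap) (simp add: \<kappa>_sum F_mult \<kappa>_mult sum_distrib_right sum_distrib_left mult_ac)
  then have "(\<Sum>j\<in>J. \<kappa> (c j * d j) * x j) = (\<Sum>j\<in>J. \<kappa> (c j) * (\<kappa> (d j) * x j - (\<Sum>y\<in>Y. \<kappa> (a j y) * y)))
      + (\<Sum>y\<in>Y. \<kappa> (\<Sum>j\<in>J. a j y * c j) * y)"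
    using d(1) c(2) by (simp add: right_diff_distrib sum_subtractf \<kappa>_mult mult.assoc)
  also have "\<dots> \<in> N"
  proof (rule idl_add[OF idl_N]; rule idl_sum[OF idl_N])
    show "\<kappa> (c j) * (\<kappa> (d j) * x j - (\<Sum>y\<in>Y. \<kappa> (a j y) * y)) \<in> N" for j
      by (rule idl_mult[OF idl_N a(2)])
    show "\<kappa> (\<Sum>j\<in>J. a j y * c j) * y \<in> N" if "y \<in> Y" for y
      using c(3)[OF that] by (simp add: \<kappa>_zero idl_zero[OF idl_N])
  qed
  finally show ?thesis using c(1,2) d F_mult by (intro exI[of _ "\<lambda>j. c j * d j"]) auto
qed

text \<open>Singles out the first nonzero coefficient of a relation among \<open>card Y + 1\<close>
  elements. When the later members of the sequence are multiples of \<open>x i\<close>, a factor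
  \<open>x i\<close> can then be split off.\<close>

lemma dependent_least:
  fixes x :: "nat \<Rightarrow> 'r"
  shows "\<exists>i s q. s \<in> regulars \<and> s * x i + (\<Sum>j\<in>{i<..card Y}. q j * x j) \<in> N"
proof -
  obtain c where c: "\<exists>j\<in>{..card Y}. c j \<noteq> 0" "\<And>j. c j \<in> F" "(\<Sum>j\<in>{..card Y}. \<kappa> (c j) * x j) \<in> N"
    using dependent[of "{..card Y}" x] by auto
  define i where "i = (LEAST j. c j \<noteq> 0)"
  obtain j where j: "j \<le> card Y" "c j \<noteq> 0" using c(1) by auto
  have i: "c i \<noteq> 0" "i \<le> card Y"
    using LeastI[of "\<lambda>j. c j \<noteq> 0", OF j(2)] Least_le[of "\<lambda>j. c j \<noteq> 0", OF j(2)] j(1)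
    unfolding i_def by simp_all
  have i0: "c j = 0" if "j < i" for j using not_less_Least[of j "\<lambda>j. c j \<noteq> 0"] that i_def by blast
  have "(\<Sum>j\<in>{..card Y}. \<kappa> (c j) * x j) = (\<Sum>j\<in>insert i {i<..card Y}. \<kappa> (c j) * x j)"
  proof (rule sum.mono_neutral_right)
    show "\<forall>j\<in>{..card Y} - insert i {i<..card Y}. \<kappa> (c j) * x j = 0"
      using i0 by (auto simp: \<kappa>_zero dest!: not_less_iff_gr_or_eq[THEN iffD1])
  qed (use i(2) in auto)
  also have "\<dots> = \<kappa> (c i) * x i + (\<Sum>j\<in>{i<..card Y}. \<kappa> (c j) * x j)" by simp
  finally have "\<kappa> (c i) * x i + (\<Sum>j\<in>{i<..card Y}. \<kappa> (c j) * x j) \<in> N" using c(3) by simp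
  then show ?thesis using regulars_I[OF c(2) i(1)]
    by (intro exI[of _ i] exI[of _ "\<kappa> (c i)"] exI[of _ "\<lambda>j. \<kappa> (c j)"] conjI)
qed

text \<open>Fitting's lemma: a relation among the powers of \<open>b\<close> gives
  \<open>s * b ^ i = b ^ Suc i * c\<close> modulo \<open>N\<close>. Every further use trades a
  factor \<open>b * c\<close> for a factor \<open>s\<close>, so after \<open>n\<close> uses
  \<open>b ^ n * c ^ n\<close> acts on \<open>b ^ n\<close> as a regular scalar; up to this scalar
  it is idempotent.\<close>

lemma fitting: "\<exists>n c s. n > 0 \<and> s \<in> regulars \<and> b ^ n * c ^ n * b ^ n - s * b ^ n \<in> N"
proof -
  obtain i s q where s: "s \<in> regulars" and q: "s * b ^ i + (\<Sum>j\<in>{i<..card Y}. q j * b ^ j) \<in> N"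
    using dependent_least[of "\<lambda>i. b ^ i"] by blast
  define c where "c = - (\<Sum>j\<in>{i<..card Y}. q j * b ^ (j - Suc i))"
  have "(\<Sum>j\<in>{i<..card Y}. q j * b ^ j) = - (b ^ Suc i * c)"
    unfolding c_def mult_minus_right minus_minus sum_distrib_left
    by (intro sum.cong refl) (simp add: power_add[symmetric] mult.left_commute del: power_Suc)
  then have "s * b ^ i - b ^ Suc i * c \<in> N" using q by simp
  then have step: "b ^ Suc i * c - s * b ^ i \<in> N" by (rule idl_diff_sym[OF idl_N])
  \<comment> \<open>\<open>Suc i\<close> instead of \<open>i\<close> makes \<open>n\<close>
    positive, so that a factor \<open>b\<close> can later be split off \<open>b ^ n\<close>.\<close>
  define n where "n = Suc i"
  have "b ^ (n + k) * c ^ k - s ^ k * b ^ n \<in> N" for k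
  proof (induction k)
    case (Suc k)
    have "b ^ (n + Suc k) * c ^ Suc k - s * (b ^ (n + k) * c ^ k)
        = b ^ Suc k * c ^ k * (b ^ Suc i * c - s * b ^ i)"
      by (simp add: n_def algebra_simps power_add)
    also have "\<dots> \<in> N" using step by (rule idl_mult[OF idl_N])
    finally have 1: "b ^ (n + Suc k) * c ^ Suc k - s * (b ^ (n + k) * c ^ k) \<in> N" .
    have "s * (b ^ (n + k) * c ^ k) - s ^ Suc k * b ^ n = s * (b ^ (n + k) * c ^ k - s ^ k * b ^ n)"
      by (simp add: algebra_simps)
    then have "s * (b ^ (n + k) * c ^ k) - s ^ Suc k * b ^ n \<in> N" using idl_mult[OF idl_N Suc] by simp
    then show ?case using 1 idl_diff_trans[OF idl_N] by blast
  qed (simp add: idl_zero[OF idl_N])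
  from this[of n] have "b ^ n * c ^ n * b ^ n - s ^ n * b ^ n \<in> N" by (simp add: power_add mult_ac)
  then show ?thesis
    by (intro exI[of _ n] exI[of _ c] exI[of _ "s ^ n"]) (simp add: n_def regulars_mult regulars_power s)
qed

text \<open>The elements \<open>e i\<close> stand for the idempotents \<open>e i / s\<close>.\<close>

definition idempotent_system :: "nat \<Rightarrow> 'r \<Rightarrow> (nat \<Rightarrow> 'r) \<Rightarrow> bool" where
  "idempotent_system n s e \<longleftrightarrow> s \<in> regulars \<and> (\<forall>i<n. e i \<notin> N \<and> e i * e i - s * e i \<in> N) \<and>
     (\<forall>i<n. \<forall>j<n. i \<noteq> j \<longrightarrow> e i * e j \<in> N) \<and> s - (\<Sum>i<n. e i) \<in> N"

text \<open>In fractions: every idempotent \<open>d / t\<close> below \<open>e / s\<close>, that is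
  with \<open>(d / t) * (e / s) = d / t\<close>, is \<open>0\<close> or
  \<open>e / s\<close>.\<close>

definition primitive_idempotent :: "'r \<Rightarrow> 'r \<Rightarrow> bool" where
  "primitive_idempotent s e \<longleftrightarrow> s \<in> regulars \<and> e \<notin> N \<and> e * e - s * e \<in> N \<and>
     (\<forall>d t. t \<in> regulars \<longrightarrow> d * d - t * d \<in> N \<longrightarrow> d * e - s * d \<in> N \<longrightarrow> d \<in> N \<or> s * d - t * e \<in> N)"

text \<open>Nonzero orthogonal idempotents are linearly independent: multiplication by
  \<open>e i\<close> isolates the \<open>i\<close>-th term of a relation.\<close>

lemma idempotent_system_bound:
  assumes "idempotent_system n s e"
  shows "n \<le> card Y"
proof (rule ccontr)
  assume "\<not> n \<le> card Y"
  then obtain c where c: "\<exists>i\<in>{..<n}. c i \<noteq> 0" "\<And>i. c i \<in> F" "(\<Sum>i<n. \<kappa> (c i) * e i) \<in> N"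
    using dependent[of "{..<n}" e] by auto
  then obtain i where i: "i < n" "c i \<noteq> 0" by blast
  have E: "e i * e i - s * e i \<in> N" "e i \<notin> N" "\<And>j. j \<in> {..<n} - {i} \<Longrightarrow> e j * e i \<in> N" "s \<in> regulars"
    using assms i unfolding idempotent_system_def by auto
  have "e i * (\<Sum>i<n. \<kappa> (c i) * e i) \<in> N"
    using c(3) by (rule idl_mult[OF idl_N])
  also have "e i * (\<Sum>i<n. \<kappa> (c i) * e i)
      = \<kappa> (c i) * (e i * e i) + (\<Sum>j\<in>{..<n} - {i}. \<kappa> (c j) * (e j * e i))"
    using i(1) by (simp add: sum.remove[of "{..<n}" i] distrib_left sum_distrib_left mult_ac)
  finally have 1: "\<kappa> (c i) * (e i * e i) + (\<Sum>j\<in>{..<n} - {i}. \<kappa> (c j) * (e j * e i)) \<in> N" .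
  have "(\<Sum>j\<in>{..<n} - {i}. \<kappa> (c j) * (e j * e i)) \<in> N"
    by (rule idl_sum[OF idl_N], rule idl_mult[OF idl_N], rule E(3))
  from idl_diff[OF idl_N 1 this] have "\<kappa> (c i) * (e i * e i) \<in> N" by simp
  then have "e i * e i \<in> N" using regulars_cancel regulars_I[OF c(2) i(2)] by blast
  then have "s * e i \<in> N" using E(1) idl_diff_cong[OF idl_N] by blast
  then show False using E(2,4) regulars_cancel by blast
qed

text \<open>A system of greatest size exists by the bound \<open>card Y\<close>. A nonzero
  idempotent strictly below a member would split that member in two and enlarge the system.\<close>

lemma ex_primitive_system:
  assumes "1 \<notin> N"
  shows "\<exists>n s e. idempotent_system n s e \<and> (\<forall>i<n. primitive_idempotent s (e i))"
proof -
  have "idempotent_system 1 1 (\<lambda>_. 1)"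
    using assms by (simp add: idempotent_system_def idl_zero[OF idl_N] regulars_one)
  then have "\<exists>s e. idempotent_system 1 s e" by blast
  then obtain n where n: "\<exists>s e. idempotent_system n s e"
      and max: "\<And>m. \<exists>s e. idempotent_system m s e \<Longrightarrow> m \<le> n"
    using ex_has_greatest_nat[of "\<lambda>n. \<exists>s e. idempotent_system n s e" 1 "\<lambda>n. n" "Suc (card Y)"]
      idempotent_system_bound by (metis le_imp_less_Suc less_imp_le)
  then obtain s e where E: "idempotent_system n s e" by blast
  note idl = idl_N
  have s: "s \<in> regulars" and orth: "\<And>i j. i < n \<Longrightarrow> j < n \<Longrightarrow> i \<noteq> j \<Longrightarrow> e i * e j \<in> N"
    and one: "s - (\<Sum>i<n. e i) \<in> N" and idem: "\<And>i. i < n \<Longrightarrow> e i \<notin> N" "\<And>i. i < n \<Longrightarrow> e i * e i - s * e i \<in> N"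
    using E unfolding idempotent_system_def by blast+
  have "primitive_idempotent s (e k)" if k: "k < n" for k
    unfolding primitive_idempotent_def
  proof (intro conjI allI impI)
    fix d t assume t: "t \<in> regulars" and dd: "d * d - t * d \<in> N" and de: "d * e k - s * d \<in> N"
    show "d \<in> N \<or> s * d - t * e k \<in> N"
    proof (rule ccontr)
      assume "\<not> ?thesis"
      then have nN: "d \<notin> N" "s * d - t * e k \<notin> N" by blast+
      \<comment> \<open>\<open>x\<close> and \<open>y\<close> are the numerators of
        \<open>d / t\<close> and of \<open>e k / s - d / t\<close> over the common denominator
        \<open>s * t\<close>; the other members are rescaled by \<open>t\<close> to the same
        denominator.\<close>
      define x where "x = s * d"
      define y where "y = t * e k - s * d"
      define e' where "e' i = (if i = k then x else if i = n then y else t * e i)" for i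
      have xN: "x \<notin> N" using nN(1) regulars_cancel[OF s] by (auto simp: x_def)
      have yN: "y \<notin> N" using nN(2) idl_diff_sym[OF idl] by (auto simp: y_def)
      have xx: "x * x - (s * t) * x \<in> N"
      proof -
        have "x * x - (s * t) * x = s * s * (d * d - t * d)" by (simp add: x_def algebra_simps)
        then show ?thesis using idl_mult[OF idl dd] by simp
      qed
      have yy: "y * y - (s * t) * y \<in> N"
      proof -
        have "y * y - (s * t) * y = t * t * (e k * e k - s * e k) - (2 * s * t) * (d * e k - s * d)
            + s * s * (d * d - t * d)"
          by (simp add: y_def algebra_simps)
        then show ?thesis
          using idl_add[OF idl idl_diff[OF idl idl_mult[OF idl idem(2)[OF k]] idl_mult[OF idl de]] idl_mult[OF idl dd]]
          by simp
      qed
      have xy: "x * y \<in> N"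
      proof -
        have "x * y = s * t * (d * e k - s * d) - s * s * (d * d - t * d)"
          by (simp add: x_def y_def algebra_simps)
        then show ?thesis using idl_diff[OF idl idl_mult[OF idl de] idl_mult[OF idl dd]] by simp
      qed
      have below: "t * e i * x \<in> N" "t * e i * y \<in> N" if i: "i < n" "i \<noteq> k" for i
      proof -
        have fe: "e i * e k \<in> N" using orth i k by blast
        have "e i * x = d * (e i * e k) - e i * (d * e k - s * d)" by (simp add: x_def algebra_simps)
        then have fx: "e i * x \<in> N"
          using idl_diff[OF idl idl_mult[OF idl fe] idl_mult[OF idl de]] by simp
        then show "t * e i * x \<in> N" using idl_mult[OF idl, of "e i * x" t] by (simp add: mult.assoc)
        have "t * e i * y = t * (t * (e i * e k) - e i * x)" by (simp add: x_def y_def algebra_simps)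
        then show "t * e i * y \<in> N" using idl_mult[OF idl idl_diff[OF idl idl_mult[OF idl fe] fx]] by simp
      qed
      have "idempotent_system (Suc n) (s * t) e'"
        unfolding idempotent_system_def
      proof (intro conjI allI impI)
        show "s * t \<in> regulars" using s t by (rule regulars_mult)
      next
        fix i assume i: "i < Suc n"
        have "t * e i \<notin> N" if "i < n" using idem(1)[OF that] regulars_cancel[OF t] by blast
        then show "e' i \<notin> N" using i xN yN by (auto simp: e'_def less_Suc_eq)
        have "t * e i * (t * e i) - s * t * (t * e i) \<in> N" if "i < n"
        proof -
          have "t * e i * (t * e i) - s * t * (t * e i) = t * t * (e i * e i - s * e i)"
            by (simp add: algebra_simps)
          then show ?thesis using idl_mult[OF idl idem(2)[OF that]] by simp
        qed
        then show "e' i * e' i - s * t * e' i \<in> N" using i xx yy by (auto simp: e'_def less_Suc_eq)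
      next
        fix i j assume ij: "i < Suc n" "j < Suc n" "i \<noteq> j"
        have "t * e i * (t * e j) \<in> N" if "i < n" "j < n"
          using idl_mult[OF idl orth[OF that ij(3)], of "t * t"] by (simp add: mult_ac)
        then show "e' i * e' j \<in> N" using ij xy below[of i] below[of j] k
          by (auto simp: e'_def less_Suc_eq mult.commute)
      next
        have "(\<Sum>i<Suc n. e' i) = x + (\<Sum>i\<in>{..<n} - {k}. t * e i) + y"
          using k by (simp add: sum.remove[of "{..<n}" k] e'_def)
        also have "\<dots> = (\<Sum>i<n. t * e i)"
          using k by (simp add: sum.remove[of "{..<n}" k] x_def y_def)
        finally have "s * t - (\<Sum>i<Suc n. e' i) = t * (s - (\<Sum>i<n. e i))"
          by (simp add: right_diff_distrib sum_distrib_left mult.commute)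
        then show "s * t - (\<Sum>i<Suc n. e' i) \<in> N" using idl_mult[OF idl one] by (simp only:)
      qed
      then show False using max[of "Suc n"] by auto
    qed
  qed (use s idem k in auto)
  then show ?thesis using E by blast
qed

section \<open>The component cut out by a primitive idempotent\<close>

definition component :: "'r \<Rightarrow> 'r set" where
  "component e = {f. e * f \<in> N}"

lemma idl_component: "idl (component e)"
  unfolding idl_def component_def mem_Collect_eq
proof (intro conjI ballI allI)
  show "e * (r * x) \<in> N" if "x \<in> {f. e * f \<in> N}" for r x
    using that idl_mult[OF idl_N, of "e * x" r] by (simp add: mult.left_commute)
qed (auto simp: distrib_left idl_zero[OF idl_N] idl_add[OF idl_N])

lemma subset_component: "N \<subseteq> component e"
  using idl_mult[OF idl_N] by (auto simp: component_def)

lemma component_cancel: "s \<in> regulars \<Longrightarrow> s * x \<in> component e \<Longrightarrow> x \<in> component e"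
  unfolding component_def mem_Collect_eq using regulars_cancel[of s "e * x"] by (simp add: mult.left_commute)

context
  fixes s e assumes e: "primitive_idempotent s e"
begin

lemma regular_notin_component: "t \<in> regulars \<Longrightarrow> t \<notin> radical_of (component e)"
  using e regulars_cancel[OF regulars_power, of t _ e]
  by (auto simp: component_def primitive_idempotent_def radical_of_def mult.commute)

text \<open>Fitting's lemma attaches to \<open>b\<close> an idempotent below \<open>e\<close>, with
  numerator \<open>d\<close> and denominator \<open>s * t\<close>. By primitivity it is zero, and
  then \<open>b\<close> is nilpotent on the component, or it is \<open>e\<close>, and then
  \<open>b\<close> is invertible there up to a regular scalar.\<close>

lemma component_local:
  "b \<in> radical_of (component e) \<or> (\<exists>c. \<exists>t\<in>regulars. b * c - t \<in> component e)"
proof -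
  note idl = idl_N
  obtain n c t where n: "n > 0" and t: "t \<in> regulars" and c: "b ^ n * c ^ n * b ^ n - t * b ^ n \<in> N"
    using fitting by blast
  define d where "d = e * (b ^ n * c ^ n)"
  have s: "s \<in> regulars" and ee: "e * e - s * e \<in> N" using e by (auto simp: primitive_idempotent_def)
  have "d * e - s * d = b ^ n * c ^ n * (e * e - s * e)" by (simp add: d_def algebra_simps)
  then have de: "d * e - s * d \<in> N" using idl_mult[OF idl ee] by simp
  have "d * d - (s * t) * d = (d * e - s * d) * (b ^ n * c ^ n) + s * e * c ^ n * (b ^ n * c ^ n * b ^ n - t * b ^ n)"
    by (simp add: d_def algebra_simps)
  then have "d * d - (s * t) * d \<in> N"
    using idl_add[OF idl idl_mult_right[OF idl de] idl_mult[OF idl c]] by simp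
  then consider "d \<in> N" | "s * d - s * t * e \<in> N"
    using e de regulars_mult[OF s t] unfolding primitive_idempotent_def by blast
  then show ?thesis
  proof cases
    case 1
    have "d * b ^ n - t * (e * b ^ n) = e * (b ^ n * c ^ n * b ^ n - t * b ^ n)"
      by (simp add: d_def algebra_simps)
    then have "d * b ^ n - t * (e * b ^ n) \<in> N" using idl_mult[OF idl c] by simp
    then have "t * (e * b ^ n) \<in> N"
      using idl_mult_right[OF idl 1] idl_diff_cong[OF idl] by blast
    then have "e * b ^ n \<in> N" using regulars_cancel[OF t] by blast
    then show ?thesis by (auto simp: component_def radical_of_def)
  next
    case 2
    then have "s * (d - t * e) \<in> N" by (simp add: algebra_simps)
    then have dt: "d - t * e \<in> N" using regulars_cancel[OF s] by blast
    obtain m where "n = Suc m" using n gr0_implies_Suc by blast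
    then have "e * (b * (b ^ m * c ^ n) - t) = d - t * e" by (simp add: d_def algebra_simps)
    then have "b * (b ^ m * c ^ n) - t \<in> component e" using dt by (simp add: component_def)
    then show ?thesis using t by blast
  qed
qed

lemma primary_component: "primary_idl (component e)"
  unfolding primary_idl_def
proof (intro conjI allI impI)
  show "1 \<notin> component e" using e by (simp add: component_def primitive_idempotent_def)
  fix a b assume ab: "a * b \<in> component e"
  show "a \<in> component e \<or> b \<in> radical_of (component e)"
  proof (rule disjCI)
    assume "b \<notin> radical_of (component e)"
    then obtain c t where t: "t \<in> regulars" and c: "b * c - t \<in> component e" using component_local by blast
    have "a * b * c - t * a = a * (b * c - t)" by (simp add: algebra_simps)
    then have "a * b * c - t * a \<in> component e" using idl_mult[OF idl_component c] by simp
    then have "t * a \<in> component e"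
      using idl_diff_cong[OF idl_component] idl_mult_right[OF idl_component ab] by blast
    then show "a \<in> component e" by (rule component_cancel[OF t])
  qed
qed (fact idl_component)

text \<open>If \<open>a\<^sub>1, \<dots>, a\<^sub>n\<close> lie in the maximal ideal and \<open>a\<^sub>1 \<cdots> a\<^sub>n f\<close> is nonzero modulo the component,
  then the partial products are linearly independent, so such products have bounded length.\<close>

lemma ex_socle_multiple:
  assumes f: "f \<notin> component e"
  shows "\<exists>a. a * f \<notin> component e \<and> (\<forall>m\<in>radical_of (component e). m * (a * f) \<in> component e)"
proof (rule ccontr)
  let ?M = "radical_of (component e)"
  note idl = idl_component[of e] and idlM = idl_radical_of[OF idl_component[of e]]
  assume "\<not> ?thesis"
  then have ex: "\<exists>m\<in>?M. m * (a * f) \<notin> component e" if "a * f \<notin> component e" for a using that by blast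
  have "\<exists>r. \<forall>n. (r n * f \<notin> component e) \<and> (\<exists>m\<in>?M. r (Suc n) = m * r n)"
  proof (intro dependent_nat_choice)
    show "\<exists>x. x * f \<notin> component e" using f by (intro exI[of _ 1]) simp
    fix x assume "x * f \<notin> component e"
    then obtain m where "m \<in> ?M" "m * (x * f) \<notin> component e" using ex by blast
    then show "\<exists>y. y * f \<notin> component e \<and> (\<exists>m\<in>?M. y = m * x)"
      by (intro exI[of _ "m * x"]) (auto simp: mult.assoc)
  qed
  then obtain r where r: "\<And>n. r n * f \<notin> component e" "\<And>n. \<exists>m\<in>?M. r (Suc n) = m * r n" by blast
  have r_less: "\<exists>m\<in>?M. r j = m * r i" if "i < j" for i j
    using that
  proof (induction j)
    case (Suc j)
    obtain m where m: "m \<in> ?M" "r (Suc j) = m * r j" using r(2) by blast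
    show ?case
    proof (cases "i = j")
      case False
      then obtain m' where m': "m' \<in> ?M" "r j = m' * r i" using Suc by auto
      show ?thesis
        by (intro bexI[of _ "m * m'"]) (use m m' idl_mult[OF idlM m'(1)] in \<open>simp_all add: mult.assoc\<close>)
    qed (use m in auto)
  qed simp
  obtain i t p where t: "t \<in> regulars" and id: "t * (e * (r i * f)) + (\<Sum>j\<in>{i<..card Y}. p j * (e * (r j * f))) \<in> N"
    using dependent_least[of "\<lambda>i. e * (r i * f)"] by blast
  have "\<forall>j\<in>{i<..card Y}. \<exists>m\<in>?M. r j = m * r i" using r_less by simp
  from bchoice[OF this[unfolded Bex_def]]
  obtain m where m: "\<And>j. j \<in> {i<..card Y} \<Longrightarrow> m j \<in> ?M" "\<And>j. j \<in> {i<..card Y} \<Longrightarrow> r j = m j * r i"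
    by blast
  define q where "q = (\<Sum>j\<in>{i<..card Y}. p j * m j)"
  have q: "q \<in> ?M" unfolding q_def by (rule idl_sum[OF idlM], rule idl_mult[OF idlM], rule m(1))
  have "(\<Sum>j\<in>{i<..card Y}. p j * (e * (r j * f))) = e * (r i * f) * q"
    unfolding q_def sum_distrib_left by (intro sum.cong refl) (simp add: m(2) mult_ac)
  then have rq: "r i * f * (t + q) \<in> component e" using id by (simp add: component_def algebra_simps)
  \<comment> \<open>A regular scalar plus an element of the maximal ideal avoids the radical, so
    primariness cancels it from \<open>rq\<close>.\<close>
  have "t + q \<notin> ?M"
    using idl_diff[OF idlM, of "t + q" q] q regular_notin_component[OF t] by auto
  then show False using rq r(1)[of i] primary_component unfolding primary_idl_def by blast
qed

text \<open>It suffices that the socle multiples \<open>x\<close> of \<open>f\<close> and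
  \<open>y\<close> of \<open>g\<close> have a common nonzero multiple. For
  \<open>x * u + y * v\<close> to vanish only the values \<open>C (e * z * (x * u + y * v))\<close>
  matter, with \<open>z\<close> in a basis \<open>Z\<close> of the residue field, because the
  maximal ideal kills \<open>x\<close> and \<open>y\<close>. With \<open>u\<close> and
  \<open>v\<close> expanded in \<open>Z\<close> there are twice as many unknowns as
  equations.\<close>

lemma irreducible_component: "irreducible_idl (component e)"
  unfolding irreducible_idl_def
proof (intro conjI allI impI)
  let ?J = "component e" and ?M = "radical_of (component e)"
  note idl = idl_component[of e] and idlM = idl_radical_of[OF idl_component[of e]]
  show "idl ?J" by (fact idl)
  fix f g assume f: "f \<notin> ?J" and g: "g \<notin> ?J"
  obtain a where a: "a * f \<notin> ?J" "\<And>m. m \<in> ?M \<Longrightarrow> m * (a * f) \<in> ?J"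
    using ex_socle_multiple[OF f] by blast
  obtain b where b: "b * g \<notin> ?J" "\<And>m. m \<in> ?M \<Longrightarrow> m * (b * g) \<in> ?J"
    using ex_socle_multiple[OF g] by blast
  define x where "x = a * f"
  define y where "y = b * g"
  \<comment> \<open>A spanning set of least size modulo the maximal ideal serves as a basis of the
    residue field; its independence follows in \<open>indep\<close>.\<close>
  let ?spans = "\<lambda>Z. finite Z \<and>
    (\<forall>r. \<exists>d c. d \<in> F \<and> d \<noteq> 0 \<and> (\<forall>z. c z \<in> F) \<and> \<kappa> d * r - (\<Sum>z\<in>Z. \<kappa> (c z) * z) \<in> ?M)"
  have "N \<subseteq> ?M" using subset_component subset_radical_of by blast
  then have "?spans Y" using finite_Y span_Y by (meson subsetD)
  then obtain Z where Z: "?spans Z" and min: "\<And>Z'. ?spans Z' \<Longrightarrow> card Z \<le> card Z'"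
    using ex_has_least_nat[of ?spans Y card] by blast
  have finZ: "finite Z" using Z by blast
  have indep: "c z0 = 0" if cF: "\<And>z. c z \<in> F" and c: "(\<Sum>z\<in>Z. \<kappa> (c z) * z) \<in> ?M" and z0: "z0 \<in> Z" for c z0
  proof (rule ccontr)
    assume cz: "c z0 \<noteq> 0"
    have "\<exists>d' c'. d' \<in> F \<and> d' \<noteq> 0 \<and> (\<forall>z. c' z \<in> F) \<and> \<kappa> d' * r - (\<Sum>z\<in>Z - {z0}. \<kappa> (c' z) * z) \<in> ?M" for r
    proof -
      obtain d h where d: "d \<in> F" "d \<noteq> 0" and hF: "\<And>z. h z \<in> F"
          and h: "\<kappa> d * r - (\<Sum>z\<in>Z. \<kappa> (h z) * z) \<in> ?M" using Z by blast
      \<comment> \<open>Cross-multiplication with the relation \<open>c\<close> cancels the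
        coefficient at \<open>z0\<close>, so \<open>Z - {z0}\<close> would already span.\<close>
      define g where "g z = c z0 * h z - h z0 * c z" for z
      have gF: "g z \<in> F" for z unfolding g_def using cF hF by (intro F_diff F_mult)
      have \<kappa>g: "\<kappa> (g z) = \<kappa> (c z0) * \<kappa> (h z) - \<kappa> (h z0) * \<kappa> (c z)" for z
        unfolding g_def by (simp add: cF hF F_mult \<kappa>_diff \<kappa>_mult)
      have "\<kappa> (c z0) * (\<kappa> d * r - (\<Sum>z\<in>Z. \<kappa> (h z) * z)) + \<kappa> (h z0) * (\<Sum>z\<in>Z. \<kappa> (c z) * z) \<in> ?M"
        by (rule idl_add[OF idlM idl_mult[OF idlM h] idl_mult[OF idlM c]])
      also have "\<kappa> (c z0) * (\<kappa> d * r - (\<Sum>z\<in>Z. \<kappa> (h z) * z)) + \<kappa> (h z0) * (\<Sum>z\<in>Z. \<kappa> (c z) * z)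
          = \<kappa> (c z0 * d) * r - (\<Sum>z\<in>Z. \<kappa> (g z) * z)"
        by (simp add: \<kappa>g \<kappa>_mult cF d right_diff_distrib left_diff_distrib sum_subtractf sum_distrib_left mult_ac)
      also have "(\<Sum>z\<in>Z. \<kappa> (g z) * z) = (\<Sum>z\<in>Z - {z0}. \<kappa> (g z) * z)"
        using finZ z0 by (subst sum.remove[of _ z0]) (auto simp: g_def \<kappa>_zero mult.commute)
      finally show ?thesis using F_mult[OF cF d(1)] d(2) cz gF
        by (intro exI[of _ "c z0 * d"] exI[of _ g]) simp
    qed
    then have "card Z \<le> card (Z - {z0})" using min finZ by blast
    then show False using finZ z0 by (metis card_Diff1_less not_le)
  qed
  have "Z \<noteq> {}"
  proof
    assume "Z = {}"
    then obtain d where "d \<in> F" "d \<noteq> 0" "\<kappa> d * 1 \<in> ?M" using Z by (metis diff_zero sum.empty)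
    then show False using regular_notin_component[OF regulars_I] by simp
  qed
  \<comment> \<open>The two copies of \<open>Z\<close> index the coefficients of \<open>u\<close>
    and of \<open>v\<close>, a single copy indexes the equations. Strictness needs \<open>Z\<close>
    nonempty.\<close>
  then have "card Z < card (Z <+> Z)" using finZ by (simp add: card_Plus card_gt_0_iff)
  then obtain c where c: "\<exists>j\<in>Z <+> Z. c j \<noteq> 0" "\<And>j. c j \<in> F"
      "\<And>z. z \<in> Z \<Longrightarrow> (\<Sum>j\<in>Z <+> Z. C (e * z * (case j of Inl z' \<Rightarrow> x * z' | Inr z' \<Rightarrow> y * z')) * c j) = 0"
    using scaled_system_solvable[of Z "Z <+> Z"
        "\<lambda>z j. e * z * (case j of Inl z' \<Rightarrow> x * z' | Inr z' \<Rightarrow> y * z')"] finZ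
    by (metis finite_Plus)
  define u where "u = (\<Sum>z\<in>Z. \<kappa> (c (Inl z)) * z)"
  define v where "v = (\<Sum>z\<in>Z. \<kappa> (c (Inr z)) * z)"
  have sys: "C (e * z * (x * u + y * v)) = 0" if "z \<in> Z" for z
  proof -
    have "C (e * z * (p * (\<Sum>z\<in>Z. \<kappa> (h z) * z))) = (\<Sum>z'\<in>Z. C (e * z * (p * z')) * h z')"
      if "\<And>z. h z \<in> F" for p h
      unfolding sum_distrib_left C_sum
    proof (intro sum.cong refl)
      fix z'
      have eq: "e * z * (p * (\<kappa> (h z') * z')) = \<kappa> (h z') * (e * z * (p * z'))" by (simp add: mult_ac)
      show "C (e * z * (p * (\<kappa> (h z') * z'))) = C (e * z * (p * z')) * h z'"
        unfolding eq using that by (simp add: C_scale mult.commute)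
    qed
    then show ?thesis using c(3)[OF \<open>z \<in> Z\<close>] c(2) finZ unfolding u_def v_def distrib_left C_add
      by (simp add: sum.Plus)
  qed
  have xy: "x * u + y * v \<in> ?J"
  proof -
    have "C (e * (x * u + y * v) * r) = 0" for r
    proof -
      obtain d h where d: "d \<in> F" "d \<noteq> 0" and hF: "\<And>z. h z \<in> F"
          and h: "\<kappa> d * r - (\<Sum>z\<in>Z. \<kappa> (h z) * z) \<in> ?M" using Z by blast
      \<comment> \<open>The part \<open>m\<close> of \<open>\<kappa> d * r\<close> kills
        \<open>x\<close> and \<open>y\<close>; the remaining part is a combination of
        \<open>Z\<close>, to which the solved equations apply.\<close>
      define m where "m = \<kappa> d * r - (\<Sum>z\<in>Z. \<kappa> (h z) * z)"
      have mM: "m \<in> ?M" using h by (simp add: m_def)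
      have "m * (x * u + y * v) = m * x * u + m * y * v" by (simp add: algebra_simps)
      then have "m * (x * u + y * v) \<in> ?J"
        using idl_add[OF idl idl_mult_right[OF idl a(2)[OF mM]] idl_mult_right[OF idl b(2)[OF mM]]]
        unfolding x_def y_def by simp
      then have 1: "C (e * (m * (x * u + y * v))) = 0" by (auto simp: component_def intro: C_N)
      have eq: "e * (x * u + y * v) * (\<kappa> (h z) * z) = \<kappa> (h z) * (e * z * (x * u + y * v))" for z
        by (simp only: mult_ac)
      have 2: "C (e * (x * u + y * v) * (\<Sum>z\<in>Z. \<kappa> (h z) * z)) = 0"
        unfolding sum_distrib_left C_sum eq using sys by (simp add: C_scale hF)
      have "\<kappa> d * (e * (x * u + y * v) * r)
          = e * (m * (x * u + y * v)) + e * (x * u + y * v) * (\<Sum>z\<in>Z. \<kappa> (h z) * z)"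
        by (simp add: m_def algebra_simps)
      then have "C (\<kappa> d * (e * (x * u + y * v) * r)) = 0" using 1 2 by (simp add: C_add)
      then show ?thesis using d by (simp add: C_scale)
    qed
    then show ?thesis by (simp add: component_def N_I)
  qed
  have uv: "u \<notin> ?M \<or> v \<notin> ?M"
    using c(1,2) indep[of "\<lambda>z. c (Inl z)"] indep[of "\<lambda>z. c (Inr z)"] unfolding u_def v_def
    by (auto elim!: PlusE)
  have prim: "q \<in> ?M" if "p * q \<in> ?J" "p \<notin> ?J" for p q
    using primary_component that unfolding primary_idl_def by blast
  \<comment> \<open>If \<open>x * u\<close> vanished, so would \<open>y * v\<close>. As
    \<open>x\<close> and \<open>y\<close> do not vanish, \<open>u\<close> and \<open>v\<close> would
    both lie in the maximal ideal, against the independence of \<open>Z\<close>.\<close>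
  have "x * u \<notin> ?J"
  proof
    assume xu: "x * u \<in> ?J"
    then have "u \<in> ?M" using prim a(1) x_def by blast
    moreover have "y * v \<in> ?J" using idl_diff[OF idl xy xu] by simp
    then have "v \<in> ?M" using prim b(1) y_def by blast
    ultimately show False using uv by blast
  qed
  moreover have "x * u - (- y * v) \<in> ?J" using xy by simp
  ultimately show "\<exists>a b. a * f \<notin> ?J \<and> a * f - b * g \<in> ?J"
    by (intro exI[of _ "u * a"] exI[of _ "- v * b"]) (simp add: x_def y_def mult_ac)
qed

end

text \<open>The components meet in \<open>N\<close> since the \<open>e i\<close> sum to the regular
  scalar \<open>s\<close>. Their radicals are incomparable: orthogonality puts \<open>e j\<close>
  into the component of \<open>e i\<close>, whereas \<open>e j * e j ^ m\<close> agrees with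
  \<open>s ^ m * e j\<close>, which is not in \<open>N\<close>.\<close>

theorem irreducible_decomposition:
  assumes proper: "1 \<notin> N"
  shows "\<exists>D. finite D \<and> (\<forall>A\<in>D. primary_idl A \<and> irreducible_idl A) \<and>
           (\<forall>A\<in>D. \<forall>B\<in>D. radical_of A \<subseteq> radical_of B \<longrightarrow> A = B) \<and> \<Inter>D = N"
proof -
  obtain n s e where E: "idempotent_system n s e" "\<And>i. i < n \<Longrightarrow> primitive_idempotent s (e i)"
    using ex_primitive_system[OF proper] by blast
  have s: "s \<in> regulars" and one: "s - (\<Sum>i<n. e i) \<in> N"
    using E(1) by (auto simp: idempotent_system_def)
  let ?D = "(\<lambda>i. component (e i)) ` {..<n}"
  have incomp: "i = j"
    if ij: "i < n" "j < n" "radical_of (component (e i)) \<subseteq> radical_of (component (e j))" for i j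
  proof (rule ccontr)
    assume "i \<noteq> j"
    then have orth: "e i * e j \<in> N" "e j * e j - s * e j \<in> N" "e j \<notin> N"
      using E(1) ij(1,2) unfolding idempotent_system_def by blast+
    have "e j \<in> radical_of (component (e j))"
      using orth(1) ij(3) subset_radical_of[of "component (e i)"] by (auto simp: component_def)
    then obtain m where m: "e j * e j ^ m \<in> N" by (auto simp: radical_of_def component_def)
    have "e j * e j ^ m - s ^ m * e j \<in> N"
    proof (induction m)
      case (Suc m)
      have "e j * e j ^ Suc m - s * (e j * e j ^ m) = e j ^ m * (e j * e j - s * e j)"
        by (simp add: algebra_simps)
      then have "e j * e j ^ Suc m - s * (e j * e j ^ m) \<in> N" using idl_mult[OF idl_N orth(2)] by simp
      moreover have "s * (e j * e j ^ m) - s ^ Suc m * e j = s * (e j * e j ^ m - s ^ m * e j)"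
        by (simp add: algebra_simps)
      then have "s * (e j * e j ^ m) - s ^ Suc m * e j \<in> N" using idl_mult[OF idl_N Suc] by simp
      ultimately show ?case using idl_diff_trans[OF idl_N] by blast
    qed (simp add: idl_zero[OF idl_N])
    then have "s ^ m * e j \<in> N" using m idl_diff_cong[OF idl_N] by blast
    then show False using orth(3) regulars_cancel[OF regulars_power[OF s]] by blast
  qed
  have "\<Inter>?D = N"
  proof (intro equalityI subsetI)
    fix f assume "f \<in> \<Inter>?D"
    then have "(\<Sum>i<n. e i * f) \<in> N" by (intro idl_sum[OF idl_N]) (auto simp: component_def)
    moreover have "s * f - (\<Sum>i<n. e i * f) = f * (s - (\<Sum>i<n. e i))"
      by (simp add: sum_distrib_left algebra_simps)
    then have "s * f - (\<Sum>i<n. e i * f) \<in> N" using idl_mult[OF idl_N one] by simp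
    ultimately have "s * f \<in> N" using idl_diff_cong[OF idl_N] by blast
    then show "f \<in> N" by (rule regulars_cancel[OF s])
  qed (use subset_component in blast)
  moreover have "\<forall>A\<in>?D. \<forall>B\<in>?D. radical_of A \<subseteq> radical_of B \<longrightarrow> A = B" using incomp by auto
  moreover have "\<forall>A\<in>?D. primary_idl A \<and> irreducible_idl A"
    using primary_component[OF E(2)] irreducible_component[OF E(2)] by blast
  ultimately show ?thesis by blast
qed

end

section \<open>Finitely supported functions\<close>

abbreviation monomial :: "'a \<Rightarrow> ('a \<Rightarrow>\<^sub>0 'k::field)" where
  "monomial a \<equiv> Poly_Mapping.single a 1"

text \<open>The additive extension of \<open>Poly_Mapping.single a c \<mapsto> \<phi> a c\<close>.
  Passing the coefficient to \<open>\<phi>\<close> covers targets as different as the field, an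
  algebra over it, and the monoid itself.\<close>

definition linext :: "('a \<Rightarrow> 'k \<Rightarrow> 'b) \<Rightarrow> ('a \<Rightarrow>\<^sub>0 'k::zero) \<Rightarrow> 'b::comm_monoid_add" where
  "linext \<phi> f = (\<Sum>a\<in>Poly_Mapping.keys f. \<phi> a (Poly_Mapping.lookup f a))"

lemma linext_superset:
  assumes "finite A" "Poly_Mapping.keys f \<subseteq> A" "\<And>a. \<phi> a 0 = 0"
  shows "linext \<phi> f = (\<Sum>a\<in>A. \<phi> a (Poly_Mapping.lookup f a))"
  unfolding linext_def using assms by (intro sum.mono_neutral_left) (auto simp: in_keys_iff)

lemma linext_zero [simp]: "linext \<phi> 0 = 0"
  by (simp add: linext_def)

lemma linext_single: "\<phi> a 0 = 0 \<Longrightarrow> linext \<phi> (Poly_Mapping.single a c) = \<phi> a c"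
  by (cases "c = 0") (simp_all add: linext_def)

lemma linext_add:
  assumes "\<And>a x y. \<phi> a (x + y) = \<phi> a x + \<phi> a y" "\<And>a. \<phi> a 0 = 0"
  shows "linext \<phi> (f + g) = linext \<phi> f + linext \<phi> g"
proof -
  let ?A = "Poly_Mapping.keys f \<union> Poly_Mapping.keys g"
  have "Poly_Mapping.keys (f + g) \<subseteq> ?A" by (rule keys_add)
  then show ?thesis
    by (simp add: linext_superset[of ?A] assms lookup_add sum.distrib)
qed

lemma poly_mapping_induct_keys [consumes 1, case_names zero single add]:
  fixes f :: "'a \<Rightarrow>\<^sub>0 'b::comm_monoid_add"
  assumes "Poly_Mapping.keys f \<subseteq> A" "Q 0" "\<And>a c. a \<in> A \<Longrightarrow> Q (Poly_Mapping.single a c)"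
    "\<And>f g. Poly_Mapping.keys f \<subseteq> A \<Longrightarrow> Poly_Mapping.keys g \<subseteq> A \<Longrightarrow> Q f \<Longrightarrow> Q g \<Longrightarrow> Q (f + g)"
  shows "Q f"
proof -
  have "Poly_Mapping.keys (\<Sum>x\<in>B. Poly_Mapping.single x (Poly_Mapping.lookup f x)) \<subseteq> A \<and>
      Q (\<Sum>x\<in>B. Poly_Mapping.single x (Poly_Mapping.lookup f x))"
    if "finite B" "B \<subseteq> A" for B
    using that
  proof (induction B)
    case (insert x B)
    let ?g = "\<Sum>x\<in>B. Poly_Mapping.single x (Poly_Mapping.lookup f x)"
    have 1: "Poly_Mapping.keys (Poly_Mapping.single x (Poly_Mapping.lookup f x)) \<subseteq> A"
      using insert.prems by auto
    moreover have "Poly_Mapping.keys (Poly_Mapping.single x (Poly_Mapping.lookup f x) + ?g) \<subseteq> A"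
      using keys_add[of "Poly_Mapping.single x (Poly_Mapping.lookup f x)" ?g] 1 insert by blast
    ultimately show ?case using insert assms(3,4) by simp
  qed (use assms(2) in simp)
  from this[OF finite_keys assms(1)] show ?thesis using poly_mapping_eq_sum_single[of f] by simp
qed

lemma poly_mapping_induct [case_names zero single add]:
  fixes f :: "'a \<Rightarrow>\<^sub>0 'b::comm_monoid_add"
  assumes "Q 0" "\<And>a c. Q (Poly_Mapping.single a c)" "\<And>f g. Q f \<Longrightarrow> Q g \<Longrightarrow> Q (f + g)"
  shows "Q f"
  using poly_mapping_induct_keys[of f UNIV Q] assms by auto

primrec nmult :: "nat \<Rightarrow> 'a::comm_monoid_add \<Rightarrow> 'a" where
  "nmult 0 a = 0"
| "nmult (Suc n) a = a + nmult n a"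

lemma nmult_add: "nmult (m + n) a = nmult m a + nmult n a"
  by (induction m) (simp_all add: add.assoc)

lemma nmult_distrib: "nmult n (a + b) = nmult n a + nmult n b"
  by (induction n) (simp_all add: ac_simps)

section \<open>Mesoprimary binomial ideals\<close>

text \<open>\<open>binomials_I\<close> states generation by binomials as an induction principle:
  containment of \<open>I\<close> in an ideal is tested on the binomials of
  \<open>I\<close>.\<close>

locale primary_binomial =
  fixes I :: "('q::comm_monoid_add \<Rightarrow>\<^sub>0 'k::field) set" and P :: "'q set"
  assumes idl_I: "idl I"
    and binomials_I: "\<And>K. idl K \<Longrightarrow> I \<inter> binomials \<subseteq> K \<Longrightarrow> I \<subseteq> K"
    and P_add: "\<And>p a. p \<in> P \<Longrightarrow> p + a \<in> P" and zero_notin_P: "0 \<notin> P"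
    and P_prime: "\<And>a b. a + b \<in> P \<Longrightarrow> a \<in> P \<or> b \<in> P"
    and cancellative: "\<And>a b h. h \<notin> P \<Longrightarrow> (a + h, b + h) \<in> induced_congruence I \<Longrightarrow> (a, b) \<in> induced_congruence I"
begin

text \<open>The induced congruence together with its scalar. When both monomials lie in
  \<open>I\<close>, every nonzero \<open>c\<close> qualifies; elsewhere it is unique.\<close>

definition proportional :: "'q \<Rightarrow> 'k \<Rightarrow> 'q \<Rightarrow> bool" where
  "proportional a c b \<longleftrightarrow> c \<noteq> 0 \<and> monomial a - Poly_Mapping.single b c \<in> I"

lemma induced_congruence_iff: "(a, b) \<in> induced_congruence I \<longleftrightarrow> (\<exists>c. proportional a c b)"
  by (auto simp: induced_congruence_def proportional_def)

lemma notin_P_add: "a \<notin> P \<Longrightarrow> b \<notin> P \<Longrightarrow> a + b \<notin> P"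
  using P_prime by blast

lemma notin_P_sum: "(\<And>x. x \<in> A \<Longrightarrow> f x \<notin> P) \<Longrightarrow> sum f A \<notin> P"
  by (induction A rule: infinite_finite_induct) (auto simp: zero_notin_P notin_P_add)

lemma notin_P_nmult: "a \<notin> P \<Longrightarrow> nmult n a \<notin> P"
  by (induction n) (auto simp: zero_notin_P notin_P_add)

lemma mono_I_add: "monomial a \<in> I \<Longrightarrow> monomial (a + b) \<in> I"
  using idl_mult_right[OF idl_I, of "monomial a" "monomial b"] by (simp add: mult_single)

lemma single_I_iff: "c \<noteq> 0 \<Longrightarrow> Poly_Mapping.single a c \<in> I \<longleftrightarrow> monomial a \<in> I"
  using idl_mult[OF idl_I, of "monomial a" "Poly_Mapping.single 0 c"]
    idl_mult[OF idl_I, of "Poly_Mapping.single a c" "Poly_Mapping.single 0 (inverse c)"]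
  by (auto simp: mult_single)

lemma proportional_refl: "proportional a 1 a"
  by (simp add: proportional_def idl_zero[OF idl_I])

lemma proportional_sym:
  assumes "proportional a c b"
  shows "proportional b (inverse c) a"
proof -
  have "Poly_Mapping.single 0 (- inverse c) * (monomial a - Poly_Mapping.single b c) \<in> I"
    using assms idl_mult[OF idl_I] by (auto simp: proportional_def)
  then show ?thesis using assms
    by (simp add: proportional_def right_diff_distrib mult_single single_uminus)
qed

lemma proportional_trans:
  assumes "proportional a c b" "proportional b d e"
  shows "proportional a (c * d) e"
proof -
  have "(monomial a - Poly_Mapping.single b c)
      + Poly_Mapping.single 0 c * (monomial b - Poly_Mapping.single e d) \<in> I"
    using assms by (auto simp: proportional_def intro: idl_add[OF idl_I] idl_mult[OF idl_I])
  then show ?thesis using assms by (simp add: proportional_def right_diff_distrib mult_single)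
qed

lemma proportional_add: "proportional a c b \<Longrightarrow> proportional (a + h) c (b + h)"
  using idl_mult_right[OF idl_I, of "monomial a - Poly_Mapping.single b c" "monomial h"]
  by (simp add: proportional_def left_diff_distrib mult_single)

lemma proportional_add_left: "proportional a c b \<Longrightarrow> proportional (h + a) c (h + b)"
  using proportional_add[of a c b h] by (simp add: add.commute)

lemma proportional_mono_I: "proportional a c b \<Longrightarrow> monomial a \<in> I \<longleftrightarrow> monomial b \<in> I"
  unfolding proportional_def using idl_diff_cong[OF idl_I] single_I_iff by blast

lemma proportional_unique:
  assumes "proportional a c b" "proportional a d b" "monomial b \<notin> I"
  shows "c = d"
proof (rule ccontr)
  assume "c \<noteq> d"
  have "(monomial a - Poly_Mapping.single b d) - (monomial a - Poly_Mapping.single b c) \<in> I"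
    by (rule idl_diff[OF idl_I]) (use assms in \<open>simp_all add: proportional_def\<close>)
  then have "Poly_Mapping.single b (c - d) \<in> I" by (simp add: single_diff)
  then show False using \<open>c \<noteq> d\<close> assms(3) single_I_iff[of "c - d" b] by simp
qed

text \<open>Any two monomials of \<open>I\<close> are congruent, in particular those of
  \<open>b + h\<close> and \<open>(b + h) + h\<close>. Cancelling \<open>h\<close> makes
  \<open>b\<close> congruent to \<open>b + h\<close>, so its monomial lies in \<open>I\<close>
  too.\<close>

lemma mono_I_cancel:
  assumes "h \<notin> P" "monomial (b + h) \<in> I"
  shows "monomial b \<in> I"
proof -
  have "monomial (b + h) - monomial ((b + h) + h) \<in> I"
    using idl_diff[OF idl_I] assms(2) mono_I_add by blast
  then have "(b + h, (b + h) + h) \<in> induced_congruence I"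
    by (auto simp: induced_congruence_def intro!: exI[of _ 1])
  then obtain c where "proportional b c (b + h)"
    using cancellative[OF assms(1)] induced_congruence_iff by blast
  then show ?thesis using proportional_mono_I assms(2) by blast
qed

text \<open>Cancellation in the congruence provides some scalar; comparison after adding
  \<open>h\<close> back shows that it is \<open>c\<close>.\<close>

lemma proportional_cancel:
  assumes "h \<notin> P" "proportional (a + h) c (b + h)" "monomial b \<notin> I"
  shows "proportional a c b"
proof -
  obtain d where d: "proportional a d b"
    using cancellative[OF assms(1)] assms(2) induced_congruence_iff by blast
  have "monomial (b + h) \<notin> I" using assms(1,3) mono_I_cancel by blast
  then have "c = d" using proportional_unique[OF assms(2) proportional_add[OF d]] by blast
  then show ?thesis using d by simp
qed

subsection \<open>The coefficient of a monomial relative to another one\<close>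

text \<open>Meaningful only for \<open>t\<^sup>v \<notin> I\<close>: otherwise the scalar is not unique.\<close>

definition coef :: "'q \<Rightarrow> 'q \<Rightarrow> 'k" where
  "coef a v = (if \<exists>c. proportional a c v then SOME c. proportional a c v else 0)"

lemma coef_eq:
  assumes "monomial v \<notin> I" "proportional a c v"
  shows "coef a v = c"
proof -
  have "proportional a (SOME c. proportional a c v) v" using assms(2) by (rule someI)
  then show ?thesis using assms proportional_unique unfolding coef_def by auto
qed

lemma proportional_coef: "coef a v \<noteq> 0 \<Longrightarrow> proportional a (coef a v) v"
  unfolding coef_def by (auto intro: someI split: if_splits)

lemma coef_self: "monomial v \<notin> I \<Longrightarrow> coef v v = 1"
  using coef_eq proportional_refl by blast

lemma coef_add:
  assumes "h \<notin> P" "monomial v \<notin> I"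
  shows "coef (a + h) (v + h) = coef a v"
proof (cases "coef a v = 0")
  case False
  then show ?thesis
    using coef_eq[OF _ proportional_add[OF proportional_coef]] assms mono_I_cancel by blast
next
  case True
  have "coef (a + h) (v + h) = 0"
  proof (rule ccontr)
    assume "coef (a + h) (v + h) \<noteq> 0"
    then have "proportional a (coef (a + h) (v + h)) v"
      using proportional_cancel[OF assms(1) proportional_coef assms(2)] by blast
    then show False using coef_eq[OF assms(2)] True by (auto simp: proportional_def)
  qed
  then show ?thesis using True by simp
qed

lemma coef_change:
  assumes "monomial v \<notin> I" "proportional v c v'"
  shows "coef a v' = coef a v * c"
proof (cases "coef a v = 0")
  case False
  have "monomial v' \<notin> I" using assms proportional_mono_I by blast
  then show ?thesis using coef_eq proportional_trans[OF proportional_coef[OF False] assms(2)] by blast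
next
  case True
  have "coef a v' = 0"
  proof (rule ccontr)
    assume "coef a v' \<noteq> 0"
    then have p: "proportional a (coef a v' * inverse c) v"
      using proportional_trans[OF proportional_coef proportional_sym[OF assms(2)]] by blast
    then show False using coef_eq[OF assms(1) p] True by (simp add: proportional_def)
  qed
  then show ?thesis using True by simp
qed

lemma coef_proportional:
  assumes "monomial v \<notin> I" "proportional a c b"
  shows "coef a v = c * coef b v"
proof (cases "coef b v = 0")
  case False
  then show ?thesis using coef_eq[OF assms(1)] proportional_trans[OF assms(2) proportional_coef[OF False]] by blast
next
  case True
  have "coef a v = 0"
  proof (rule ccontr)
    assume "coef a v \<noteq> 0"
    then have p: "proportional b (inverse c * coef a v) v"
      using proportional_trans[OF proportional_sym[OF assms(2)] proportional_coef] by blast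
    then show False using coef_eq[OF assms(1) p] True by (simp add: proportional_def)
  qed
  then show ?thesis using True by simp
qed

lemma coef_I: "monomial v \<notin> I \<Longrightarrow> monomial a \<in> I \<Longrightarrow> coef a v = 0"
  using proportional_coef proportional_mono_I by blast

end

text \<open>\<open>meso\<close> is mesoprimarity at the cogenerator only: translation by
  \<open>w\<close> is injective on the classes of elements outside \<open>P\<close>. It allows
  exponents of units to be read off from classes \<open>w + h\<close>.\<close>

locale mesoprimary_binomial = primary_binomial I P
  for I :: "('q::comm_monoid_add \<Rightarrow>\<^sub>0 'k::field) set" and P +
  fixes w :: 'q
  assumes meso: "\<And>a b. a \<notin> P \<Longrightarrow> b \<notin> P \<Longrightarrow> (w + a, w + b) \<in> induced_congruence I \<Longrightarrow> (a, b) \<in> induced_congruence I"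
    and w_notin: "monomial w \<notin> I" and w_socle: "\<And>p. p \<in> P \<Longrightarrow> monomial (w + p) \<in> I"
    and nilpotent: "\<And>p. p \<in> P \<Longrightarrow> \<exists>n. monomial (nmult n p) \<in> I"
begin

lemma w_add_notin: "h \<notin> P \<Longrightarrow> monomial (w + h) \<notin> I"
  using mono_I_cancel w_notin by blast

definition closure_ideal :: "('q \<Rightarrow>\<^sub>0 'k) set" where
  "closure_ideal = {f. \<forall>b h. h \<notin> P \<longrightarrow> linext (\<lambda>a x. x * coef (a + b) (w + h)) f = 0}"

subsection \<open>Independent units\<close>

definition exponents :: "nat \<Rightarrow> (nat \<Rightarrow>\<^sub>0 int) set" where
  "exponents r = {\<alpha>. Poly_Mapping.keys \<alpha> \<subseteq> {..<r} \<and> (\<forall>j. 0 \<le> Poly_Mapping.lookup \<alpha> j)}"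

text \<open>Meaningful only on \<open>exponents\<close>, as negative entries are truncated. Integer exponents serve to make
  room for Laurent polynomials.\<close>

definition ev :: "(nat \<Rightarrow> 'q) \<Rightarrow> (nat \<Rightarrow>\<^sub>0 int) \<Rightarrow> 'q" where
  "ev g \<alpha> = linext (\<lambda>j n. nmult (nat n) (g j)) \<alpha>"

definition independent :: "nat \<Rightarrow> (nat \<Rightarrow> 'q) \<Rightarrow> bool" where
  "independent r g \<longleftrightarrow> (\<forall>j<r. g j \<notin> P) \<and>
     (\<forall>\<alpha>\<in>exponents r. \<forall>\<beta>\<in>exponents r. (ev g \<alpha>, ev g \<beta>) \<in> induced_congruence I \<longrightarrow> \<alpha> = \<beta>)"

lemma zero_exponents [simp]: "0 \<in> exponents r"
  by (simp add: exponents_def)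

lemma add_exponents [simp]: "\<alpha> \<in> exponents r \<Longrightarrow> \<beta> \<in> exponents r \<Longrightarrow> \<alpha> + \<beta> \<in> exponents r"
  using keys_add[of \<alpha> \<beta>] by (auto simp: exponents_def lookup_add)

lemma ev_zero [simp]: "ev g 0 = 0"
  by (simp add: ev_def)

lemma ev_eq: "\<alpha> \<in> exponents r \<Longrightarrow> ev g \<alpha> = (\<Sum>j<r. nmult (nat (Poly_Mapping.lookup \<alpha> j)) (g j))"
  unfolding ev_def exponents_def by (intro linext_superset) auto

lemma ev_add: "\<alpha> \<in> exponents r \<Longrightarrow> \<beta> \<in> exponents r \<Longrightarrow> ev g (\<alpha> + \<beta>) = ev g \<alpha> + ev g \<beta>"
  unfolding ev_eq[OF add_exponents] ev_eq[of _ r]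
  by (simp add: lookup_add exponents_def nat_add_distrib nmult_add sum.distrib)

lemma ev_notin_P: "independent r g \<Longrightarrow> \<alpha> \<in> exponents r \<Longrightarrow> ev g \<alpha> \<notin> P"
  by (subst ev_eq, assumption, intro notin_P_sum notin_P_nmult) (auto simp: independent_def)

lemma single_exponents: "j < r \<Longrightarrow> Poly_Mapping.single j (int n) \<in> exponents r"
  by (auto simp: exponents_def lookup_single when_def)

lemma ev_single: "ev g (Poly_Mapping.single j (int n)) = nmult n (g j)"
  by (simp add: ev_def linext_single)

text \<open>Independent units are pairwise distinct, so drawing them from a finite generating set
  bounds their number.\<close>

lemma independent_bound:
  assumes "independent r g" "finite S" "\<And>j. j < r \<Longrightarrow> g j \<in> S"
  shows "r \<le> card S"
proof -
  have "inj_on g {..<r}"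
  proof (rule inj_onI)
    fix i j assume ij: "i \<in> {..<r}" "j \<in> {..<r}" "g i = g j"
    let ?s = "\<lambda>i. Poly_Mapping.single i (int 1)"
    have "ev g (?s i) = ev g (?s j)" using ij(3) by (simp only: ev_single)
    then have "(ev g (?s i), ev g (?s j)) \<in> induced_congruence I"
      using induced_congruence_iff proportional_refl by metis
    then have "?s i = ?s j" using assms(1) ij(1,2) single_exponents unfolding independent_def by blast
    then have "Poly_Mapping.keys (?s i) = Poly_Mapping.keys (?s j)" by (rule arg_cong)
    then show "i = j" by simp
  qed
  then have "card (g ` {..<r}) = r" by (simp add: card_image)
  moreover have "card (g ` {..<r}) \<le> card S" using assms(2,3) by (intro card_mono) auto
  ultimately show ?thesis by simp
qed

text \<open>In the group generated by the units, a positive multiple of \<open>h\<close> is a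
  combination of the \<open>g j\<close>; the negative part \<open>\<alpha>\<close> of the
  combination is moved to the left-hand side to stay in \<open>Q\<close>.\<close>

definition torsion_over :: "nat \<Rightarrow> (nat \<Rightarrow> 'q) \<Rightarrow> 'q \<Rightarrow> bool" where
  "torsion_over r g h \<longleftrightarrow> (\<exists>n c. \<exists>\<alpha>\<in>exponents r. \<exists>\<beta>\<in>exponents r. n > 0 \<and>
     proportional (nmult n h + ev g \<alpha>) c (ev g \<beta>))"

text \<open>Both relations are multiplied up to the common multiple \<open>m * n\<close> and then
  added.\<close>

lemma torsion_over_add:
  assumes "torsion_over r g a" "torsion_over r g b"
  shows "torsion_over r g (a + b)"
proof -
  obtain m c \<alpha> \<beta> where 1: "m > 0" "\<alpha> \<in> exponents r" "\<beta> \<in> exponents r"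
      "proportional (nmult m a + ev g \<alpha>) c (ev g \<beta>)"
    using assms(1) by (auto simp: torsion_over_def)
  obtain n d \<alpha>' \<beta>' where 2: "n > 0" "\<alpha>' \<in> exponents r" "\<beta>' \<in> exponents r"
      "proportional (nmult n b + ev g \<alpha>') d (ev g \<beta>')"
    using assms(2) by (auto simp: torsion_over_def)
  have scale: "\<exists>c \<gamma> \<delta>. \<gamma> \<in> exponents r \<and> \<delta> \<in> exponents r \<and> proportional (nmult (k * n) a + ev g \<gamma>) c (ev g \<delta>)"
    if "\<alpha> \<in> exponents r" "\<beta> \<in> exponents r" "proportional (nmult n a + ev g \<alpha>) c (ev g \<beta>)" for k n a c \<alpha> \<beta>
  proof (induction k)
    case 0
    show ?case using proportional_refl[of 0] by (intro exI[of _ 1] exI[of _ 0]) simp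
  next
    case (Suc k)
    then obtain c' \<gamma> \<delta> where s: "\<gamma> \<in> exponents r" "\<delta> \<in> exponents r"
        "proportional (nmult (k * n) a + ev g \<gamma>) c' (ev g \<delta>)" by blast
    have "proportional ((nmult n a + ev g \<alpha>) + (nmult (k * n) a + ev g \<gamma>)) (c * c') (ev g \<beta> + ev g \<delta>)"
      by (rule proportional_trans[OF proportional_add[OF that(3)] proportional_add_left[OF s(3)]])
    then have "proportional (nmult (Suc k * n) a + ev g (\<alpha> + \<gamma>)) (c * c') (ev g (\<beta> + \<delta>))"
      using that(1,2) s(1,2) by (simp add: ev_add nmult_add ac_simps)
    then show ?case using that(1,2) s(1,2) add_exponents by blast
  qed
  obtain c1 \<gamma> \<delta> where s: "\<gamma> \<in> exponents r" "\<delta> \<in> exponents r"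
      "proportional (nmult (n * m) a + ev g \<gamma>) c1 (ev g \<delta>)" using scale[OF 1(2-4)] by blast
  obtain c2 \<gamma>' \<delta>' where t: "\<gamma>' \<in> exponents r" "\<delta>' \<in> exponents r"
      "proportional (nmult (m * n) b + ev g \<gamma>') c2 (ev g \<delta>')" using scale[OF 2(2-4)] by blast
  have "proportional ((nmult (n * m) a + ev g \<gamma>) + (nmult (m * n) b + ev g \<gamma>')) (c1 * c2) (ev g \<delta> + ev g \<delta>')"
    by (rule proportional_trans[OF proportional_add[OF s(3)] proportional_add_left[OF t(3)]])
  then have "proportional (nmult (m * n) (a + b) + ev g (\<gamma> + \<gamma>')) (c1 * c2) (ev g (\<delta> + \<delta>'))"
    using s(1,2) t(1,2) by (simp add: ev_add nmult_distrib ac_simps)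
  moreover have "m * n > 0" using 1(1) 2(1) by simp
  ultimately show ?thesis unfolding torsion_over_def using s(1,2) t(1,2) add_exponents by blast
qed

text \<open>In a nontrivial relation, if \<open>h\<close> occurs with different multiplicities on
  the two sides, cancelling the smaller one leaves a torsion relation. If they are equal, cancelling
  \<open>h\<close> leaves a relation among the \<open>g j\<close>, which is trivial.\<close>

lemma torsion_over_dependent:
  assumes g: "independent r g" and h: "h \<notin> P" and dep: "\<not> independent (Suc r) (g(r := h))"
  shows "torsion_over r g h"
proof -
  let ?g = "g(r := h)"
  have "\<forall>j<Suc r. ?g j \<notin> P" using g h by (auto simp: independent_def less_Suc_eq)
  then obtain \<alpha> \<beta> c where ab: "\<alpha> \<in> exponents (Suc r)" "\<beta> \<in> exponents (Suc r)" "\<alpha> \<noteq> \<beta>"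
      "proportional (ev ?g \<alpha>) c (ev ?g \<beta>)"
    using dep unfolding independent_def induced_congruence_iff by blast
  define cut where "cut \<alpha> = \<alpha> - Poly_Mapping.single r (Poly_Mapping.lookup \<alpha> r)" for \<alpha> :: "nat \<Rightarrow>\<^sub>0 int"
  have lookup_cut: "Poly_Mapping.lookup (cut \<alpha>) j = (if j = r then 0 else Poly_Mapping.lookup \<alpha> j)" for \<alpha> j
    by (auto simp: cut_def lookup_minus lookup_single when_def)
  have cut: "cut \<alpha> \<in> exponents r" if "\<alpha> \<in> exponents (Suc r)" for \<alpha>
    using that by (fastforce simp: exponents_def lookup_cut in_keys_iff less_Suc_eq subset_iff)
  have ev_cut: "ev ?g \<alpha> = nmult (nat (Poly_Mapping.lookup \<alpha> r)) h + ev g (cut \<alpha>)"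
    if "\<alpha> \<in> exponents (Suc r)" for \<alpha>
    unfolding ev_eq[OF that] ev_eq[OF cut[OF that]] by (simp add: lookup_cut add.commute)
  have main: "torsion_over r g h"
    if "\<alpha> \<in> exponents (Suc r)" "\<beta> \<in> exponents (Suc r)" "proportional (ev ?g \<alpha>) c (ev ?g \<beta>)"
      "Poly_Mapping.lookup \<beta> r < Poly_Mapping.lookup \<alpha> r" for \<alpha> \<beta> c
  proof -
    define n where "n = nat (Poly_Mapping.lookup \<beta> r)"
    define m where "m = nat (Poly_Mapping.lookup \<alpha> r) - n"
    have m: "nat (Poly_Mapping.lookup \<alpha> r) = m + n" "m > 0"
    proof -
      have "0 \<le> Poly_Mapping.lookup \<beta> r" using that(2) by (simp add: exponents_def)
      then show "nat (Poly_Mapping.lookup \<alpha> r) = m + n" "m > 0"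
        using that(4) by (simp_all add: m_def n_def)
    qed
    have "(nmult (m + n) h + ev g (cut \<alpha>), nmult n h + ev g (cut \<beta>)) \<in> induced_congruence I"
      using that(3) unfolding ev_cut[OF that(1)] ev_cut[OF that(2)] m(1) n_def[symmetric]
      by (auto simp: induced_congruence_iff)
    then have "((nmult m h + ev g (cut \<alpha>)) + nmult n h, ev g (cut \<beta>) + nmult n h) \<in> induced_congruence I"
      by (simp add: nmult_add ac_simps)
    from cancellative[OF notin_P_nmult[OF h] this] show ?thesis
      unfolding torsion_over_def induced_congruence_iff using cut that(1,2) m(2) by blast
  qed
  consider "Poly_Mapping.lookup \<beta> r < Poly_Mapping.lookup \<alpha> r" | "Poly_Mapping.lookup \<alpha> r < Poly_Mapping.lookup \<beta> r"
    | "Poly_Mapping.lookup \<alpha> r = Poly_Mapping.lookup \<beta> r" by linarith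
  then show ?thesis
  proof cases
    case 3
    let ?n = "nat (Poly_Mapping.lookup \<beta> r)"
    have "(ev g (cut \<alpha>) + nmult ?n h, ev g (cut \<beta>) + nmult ?n h) \<in> induced_congruence I"
      using ab(4) unfolding ev_cut[OF ab(1)] ev_cut[OF ab(2)] 3
      by (auto simp: induced_congruence_iff add.commute)
    from cancellative[OF notin_P_nmult[OF h] this] have "cut \<alpha> = cut \<beta>"
      using g cut ab(1,2) by (auto simp: independent_def)
    then have "\<alpha> = \<beta>" using 3 by (simp add: cut_def)
    then show ?thesis using ab(3) by simp
  qed (use main ab proportional_sym in blast)+
qed

text \<open>Maximality is imposed among generators only. It extends to all units because the
  elements that lie in \<open>P\<close> or are torsion form a submonoid containing the
  generators.\<close>

lemma ex_maximal_independent: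
  fixes S :: "'q set"
  assumes "finite S" and gen: "\<And>T. 0 \<in> T \<Longrightarrow> (\<And>a b. a \<in> T \<Longrightarrow> b \<in> T \<Longrightarrow> a + b \<in> T) \<Longrightarrow> S \<subseteq> T \<Longrightarrow> T = UNIV"
  shows "\<exists>r g. independent r g \<and> (\<forall>h. h \<notin> P \<longrightarrow> torsion_over r g h)"
proof -
  let ?p = "\<lambda>r. \<exists>g. independent r g \<and> (\<forall>j<r. g j \<in> S)"
  have "?p 0" by (auto simp: independent_def exponents_def)
  moreover have "r < Suc (card S)" if "?p r" for r
    using that independent_bound[OF _ assms(1)] by (meson less_Suc_eq_le)
  ultimately obtain r where "?p r" and max: "\<And>r'. ?p r' \<Longrightarrow> r' \<le> r"
    using ex_has_greatest_nat[of ?p 0 "\<lambda>n. n" "Suc (card S)"] by (metis less_imp_le)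
  then obtain g where g: "independent r g" "\<And>j. j < r \<Longrightarrow> g j \<in> S" by blast
  have S: "torsion_over r g h" if "h \<in> S" "h \<notin> P" for h
  proof (rule torsion_over_dependent[OF g(1) that(2)], rule notI)
    assume "independent (Suc r) (g(r := h))"
    moreover have "\<forall>j<Suc r. (g(r := h)) j \<in> S" using g(2) that(1) by (simp add: less_Suc_eq)
    ultimately have "Suc r \<le> r" using max by blast
    then show False by simp
  qed
  have "{h. h \<in> P \<or> torsion_over r g h} = UNIV"
  proof (rule gen)
    have "proportional (nmult 1 0 + ev g 0) 1 (ev g 0)" using proportional_refl by simp
    then show "0 \<in> {h. h \<in> P \<or> torsion_over r g h}"
      unfolding torsion_over_def using zero_exponents by blast
    show "a + b \<in> {h. h \<in> P \<or> torsion_over r g h}"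
      if "a \<in> {h. h \<in> P \<or> torsion_over r g h}" "b \<in> {h. h \<in> P \<or> torsion_over r g h}" for a b
      using that torsion_over_add P_add[of a b] P_add[of b a] by (auto simp: add.commute)
    show "S \<subseteq> {h. h \<in> P \<or> torsion_over r g h}" using S by blast
  qed
  then show ?thesis using g(1) by blast
qed

section \<open>The Laurent-valued functional of a maximal independent system\<close>

context
  fixes r :: nat and g :: "nat \<Rightarrow> 'q"
  assumes indep: "independent r g" and tors: "\<And>h. h \<notin> P \<Longrightarrow> torsion_over r g h"
begin

text \<open>The polynomial subring of the Laurent polynomials in \<open>r\<close> variables. On it
  \<open>\<kappa>\<close> is multiplicative; with negative exponents it would not be, since
  \<open>ev\<close> truncates them.\<close>

definition scalars :: "((nat \<Rightarrow>\<^sub>0 int) \<Rightarrow>\<^sub>0 'k) set" where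
  "scalars = {p. Poly_Mapping.keys p \<subseteq> exponents r}"

text \<open>Writing the independent units as Laurent variables, \<open>t\<^sup>a\<close> is \<open>\<chi> a\<close> times \<open>t\<^sup>w\<close> modulo \<open>I\<close>, or has no component
  in these degrees.\<close>

definition \<chi> :: "'q \<Rightarrow> (nat \<Rightarrow>\<^sub>0 int) \<Rightarrow>\<^sub>0 'k" where
  "\<chi> a = (if \<exists>c \<alpha> \<beta>. \<alpha> \<in> exponents r \<and> \<beta> \<in> exponents r \<and> proportional (a + ev g \<beta>) c (w + ev g \<alpha>)
     then (SOME p. \<exists>c \<alpha> \<beta>. p = Poly_Mapping.single (\<alpha> - \<beta>) c \<and> \<alpha> \<in> exponents r \<and> \<beta> \<in> exponents r \<and>
       proportional (a + ev g \<beta>) c (w + ev g \<alpha>)) else 0)"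

definition \<kappa> :: "((nat \<Rightarrow>\<^sub>0 int) \<Rightarrow>\<^sub>0 'k) \<Rightarrow> ('q \<Rightarrow>\<^sub>0 'k)" where
  "\<kappa> = linext (\<lambda>\<alpha>. Poly_Mapping.single (ev g \<alpha>))"

definition C :: "('q \<Rightarrow>\<^sub>0 'k) \<Rightarrow> (nat \<Rightarrow>\<^sub>0 int) \<Rightarrow>\<^sub>0 'k" where
  "C = linext (\<lambda>a x. Poly_Mapping.single 0 x * \<chi> a)"

lemma ev_notin: "\<alpha> \<in> exponents r \<Longrightarrow> ev g \<alpha> \<notin> P"
  using ev_notin_P[OF indep] .

lemma w_ev_notin: "\<alpha> \<in> exponents r \<Longrightarrow> monomial (w + ev g \<alpha>) \<notin> I"
  using w_add_notin ev_notin by blast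

lemma scalars_iff: "p \<in> scalars \<longleftrightarrow> Poly_Mapping.keys p \<subseteq> exponents r"
  by (simp add: scalars_def)

lemma scalars_one: "1 \<in> scalars"
  by (simp add: scalars_iff)

text \<open>The choice in \<open>\<chi>\<close> does not matter. Adding \<open>ev g \<beta>'\<close>
  to one relation and \<open>ev g \<beta>\<close> to the other gives them the same left side;
  \<open>meso\<close> removes \<open>w\<close>, independence then yields
  \<open>\<alpha> + \<beta>' = \<alpha>' + \<beta>\<close>, and the scalars agree because these
  monomials are not in \<open>I\<close>.\<close>

lemma \<chi>_eq:
  assumes "\<alpha> \<in> exponents r" "\<beta> \<in> exponents r" "proportional (a + ev g \<beta>) c (w + ev g \<alpha>)"
  shows "\<chi> a = Poly_Mapping.single (\<alpha> - \<beta>) c"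
proof -
  let ?Q = "\<lambda>p. \<exists>c \<alpha> \<beta>. p = Poly_Mapping.single (\<alpha> - \<beta>) c \<and> \<alpha> \<in> exponents r \<and> \<beta> \<in> exponents r \<and>
       proportional (a + ev g \<beta>) c (w + ev g \<alpha>)"
  have "\<chi> a = (SOME p. ?Q p)" unfolding \<chi>_def using assms by auto
  moreover have "?Q (Poly_Mapping.single (\<alpha> - \<beta>) c)" using assms by blast
  then have "?Q (SOME p. ?Q p)" by (rule someI)
  ultimately obtain c' \<alpha>' \<beta>' where *: "\<chi> a = Poly_Mapping.single (\<alpha>' - \<beta>') c'"
      "\<alpha>' \<in> exponents r" "\<beta>' \<in> exponents r" "proportional (a + ev g \<beta>') c' (w + ev g \<alpha>')" by auto
  have 1: "proportional (a + ev g \<beta> + ev g \<beta>') c (w + ev g (\<alpha> + \<beta>'))"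
    using proportional_add[OF assms(3), of "ev g \<beta>'"] by (simp add: ev_add[OF assms(1) *(3)] ac_simps)
  have 2: "proportional (a + ev g \<beta> + ev g \<beta>') c' (w + ev g (\<alpha>' + \<beta>))"
    using proportional_add[OF *(4), of "ev g \<beta>"] by (simp add: ev_add[OF *(2) assms(2)] ac_simps)
  have "(w + ev g (\<alpha> + \<beta>'), w + ev g (\<alpha>' + \<beta>)) \<in> induced_congruence I"
    using proportional_trans[OF proportional_sym[OF 1] 2] by (auto simp: induced_congruence_iff)
  then have "(ev g (\<alpha> + \<beta>'), ev g (\<alpha>' + \<beta>)) \<in> induced_congruence I"
    using meso ev_notin assms(1,2) *(2,3) by simp
  then have eq: "\<alpha> + \<beta>' = \<alpha>' + \<beta>"
    using indep assms(1,2) *(2,3) unfolding independent_def by simp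
  then have "c = c'" using proportional_unique[OF 1 2[folded eq] w_ev_notin[OF add_exponents[OF assms(1) *(3)]]] by blast
  moreover have "\<alpha> - \<beta> = \<alpha>' - \<beta>'" using eq by (simp only: diff_eq_eq diff_add_eq eq_diff_eq)
  ultimately show ?thesis using *(1) by simp
qed

lemma \<chi>_cases:
  obtains "\<chi> a = 0" "\<And>c \<alpha> \<beta>. \<alpha> \<in> exponents r \<Longrightarrow> \<beta> \<in> exponents r \<Longrightarrow> \<not> proportional (a + ev g \<beta>) c (w + ev g \<alpha>)"
  | c \<alpha> \<beta> where "\<chi> a = Poly_Mapping.single (\<alpha> - \<beta>) c" "\<alpha> \<in> exponents r" "\<beta> \<in> exponents r"
      "proportional (a + ev g \<beta>) c (w + ev g \<alpha>)"
proof (cases "\<exists>c \<alpha> \<beta>. \<alpha> \<in> exponents r \<and> \<beta> \<in> exponents r \<and> proportional (a + ev g \<beta>) c (w + ev g \<alpha>)")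
  case True
  then show ?thesis using \<chi>_eq that(2) by blast
next
  case False
  then have "\<chi> a = 0" unfolding \<chi>_def by (rule if_not_P)
  then show ?thesis using that(1) False by blast
qed

text \<open>Translation by the chosen units becomes multiplication by a Laurent monomial, the source
  of the linearity of \<open>C\<close> over \<open>scalars\<close>.\<close>

lemma \<chi>_ev:
  assumes "\<gamma> \<in> exponents r"
  shows "\<chi> (ev g \<gamma> + a) = Poly_Mapping.single \<gamma> 1 * \<chi> a"
proof (cases rule: \<chi>_cases[of a])
  case 1
  have "\<chi> (ev g \<gamma> + a) = 0"
  proof (cases rule: \<chi>_cases[of "ev g \<gamma> + a"])
    case (2 c \<alpha> \<beta>)
    have "proportional (a + ev g (\<beta> + \<gamma>)) c (w + ev g \<alpha>)"
      using 2(4) by (simp add: ev_add[OF 2(3) assms] ac_simps)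
    then show ?thesis using 1(2)[OF 2(2) add_exponents[OF 2(3) assms]] by blast
  qed simp
  then show ?thesis using 1(1) by simp
next
  case (2 c \<alpha> \<beta>)
  have "proportional (ev g \<gamma> + a + ev g \<beta>) c (w + ev g (\<alpha> + \<gamma>))"
    using proportional_add[OF 2(4), of "ev g \<gamma>"] by (simp add: ev_add[OF 2(2) assms] ac_simps)
  from \<chi>_eq[OF add_exponents[OF 2(2) assms] 2(3) this] show ?thesis
    by (simp add: 2(1) mult_single add_diff_eq add.commute)
qed

lemma \<chi>_proportional:
  assumes "proportional a c b"
  shows "\<chi> a = Poly_Mapping.single 0 c * \<chi> b"
proof (cases rule: \<chi>_cases[of b])
  case 1
  have "\<chi> a = 0"
  proof (cases rule: \<chi>_cases[of a])
    case (2 d \<alpha> \<beta>)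
    have "proportional (b + ev g \<beta>) (inverse c * d) (w + ev g \<alpha>)"
      by (rule proportional_trans[OF proportional_add[OF proportional_sym[OF assms]] 2(4)])
    then show ?thesis using 1(2)[OF 2(2,3)] by blast
  qed simp
  then show ?thesis using 1(1) by simp
next
  case (2 d \<alpha> \<beta>)
  have "proportional (a + ev g \<beta>) (c * d) (w + ev g \<alpha>)"
    by (rule proportional_trans[OF proportional_add[OF assms] 2(4)])
  from \<chi>_eq[OF 2(2,3) this] show ?thesis by (simp add: 2(1) mult_single)
qed

lemma \<chi>_I: "monomial a \<in> I \<Longrightarrow> \<chi> a = 0"
proof (cases rule: \<chi>_cases[of a])
  case (2 c \<alpha> \<beta>)
  assume "monomial a \<in> I"
  then have "monomial (a + ev g \<beta>) \<in> I" by (rule mono_I_add)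
  then show ?thesis using proportional_mono_I[OF 2(4)] w_ev_notin[OF 2(2)] by blast
qed

text \<open>Ties the Laurent coefficients to those in \<open>closure_ideal\<close>. Cancelling units
  shows that only the difference of \<open>\<alpha>\<close> and \<open>\<beta>\<close>
  matters.\<close>

lemma lookup_\<chi>:
  assumes "\<alpha> \<in> exponents r" "\<beta> \<in> exponents r"
  shows "Poly_Mapping.lookup (\<chi> a) (\<alpha> - \<beta>) = coef (a + ev g \<beta>) (w + ev g \<alpha>)"
proof (cases "coef (a + ev g \<beta>) (w + ev g \<alpha>) = 0")
  case False
  then show ?thesis using \<chi>_eq[OF assms proportional_coef[OF False]] by simp
next
  case True
  have "Poly_Mapping.lookup (\<chi> a) (\<alpha> - \<beta>) = 0"
  proof (cases rule: \<chi>_cases[of a])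
    case (2 c \<alpha>' \<beta>')
    show ?thesis
    proof (rule ccontr)
      assume "\<not> ?thesis"
      then have "\<alpha> - \<beta> = \<alpha>' - \<beta>'" by (auto simp: 2(1) lookup_single when_def split: if_splits)
      then have eq: "\<alpha>' + \<beta> = \<alpha> + \<beta>'" by (metis add.commute diff_add_cancel diff_add_eq)
      have "proportional (a + ev g \<beta>' + ev g \<beta>) c (w + ev g (\<alpha>' + \<beta>))"
        using proportional_add[OF 2(4), of "ev g \<beta>"] by (simp add: ev_add[OF 2(2) assms(2)] ac_simps)
      then have "proportional (a + ev g \<beta> + ev g \<beta>') c (w + ev g \<alpha> + ev g \<beta>')"
        unfolding eq by (simp add: ev_add[OF assms(1) 2(3)] ac_simps)
      then have p: "proportional (a + ev g \<beta>) c (w + ev g \<alpha>)"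
        using proportional_cancel[OF ev_notin[OF 2(3)]] w_ev_notin[OF assms(1)] by blast
      then show False using coef_eq[OF w_ev_notin[OF assms(1)] p] True by (simp add: proportional_def)
    qed
  qed simp
  then show ?thesis using True by simp
qed

lemma C_add: "C (x + y) = C x + C y"
  unfolding C_def by (rule linext_add) (simp_all add: single_add distrib_right)

lemma C_zero: "C 0 = 0"
  by (simp add: C_def)

lemma C_single: "C (Poly_Mapping.single a x) = Poly_Mapping.single 0 x * \<chi> a"
  unfolding C_def by (rule linext_single) simp

lemma \<kappa>_add: "\<kappa> (p + q) = \<kappa> p + \<kappa> q"
  unfolding \<kappa>_def by (rule linext_add) (simp_all add: single_add)

lemma \<kappa>_zero: "\<kappa> 0 = 0"
  by (simp add: \<kappa>_def)

lemma \<kappa>_single: "\<kappa> (Poly_Mapping.single \<alpha> c) = Poly_Mapping.single (ev g \<alpha>) c"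
  unfolding \<kappa>_def by (rule linext_single) simp

lemma \<kappa>_mult:
  assumes "p \<in> scalars" "q \<in> scalars"
  shows "\<kappa> (p * q) = \<kappa> p * \<kappa> q"
  using assms(1)[unfolded scalars_iff]
proof (induction p rule: poly_mapping_induct_keys)
  case (single \<alpha> c)
  from assms(2)[unfolded scalars_iff] show ?case
  proof (induction q rule: poly_mapping_induct_keys)
    case (single \<beta> d)
    then show ?case using \<open>\<alpha> \<in> exponents r\<close> by (simp add: mult_single \<kappa>_single ev_add)
  qed (simp_all add: \<kappa>_zero \<kappa>_add distrib_left)
qed (simp_all add: \<kappa>_zero \<kappa>_add distrib_right)

lemma C_scale:
  assumes "p \<in> scalars"
  shows "C (\<kappa> p * f) = p * C f"
  using assms[unfolded scalars_iff]
proof (induction p rule: poly_mapping_induct_keys)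
  case (single \<alpha> c)
  show ?case
  proof (induction f rule: poly_mapping_induct)
    case (single a d)
    have "Poly_Mapping.single \<alpha> c = Poly_Mapping.single 0 c * Poly_Mapping.single \<alpha> 1"
      by (simp add: mult_single)
    then show ?case
      using \<chi>_ev[OF \<open>\<alpha> \<in> exponents r\<close>, of a]
      by (simp add: \<kappa>_single C_single mult_single flip: mult.assoc)
  qed (simp_all add: C_zero C_add distrib_left)
qed (simp_all add: \<kappa>_zero \<kappa>_add distrib_right C_zero C_add)

lemma scalars_mult: "p \<in> scalars \<Longrightarrow> q \<in> scalars \<Longrightarrow> p * q \<in> scalars"
  unfolding scalars_iff using keys_mult[of p q] by fastforce

lemma scalars_single: "\<alpha> \<in> exponents r \<Longrightarrow> Poly_Mapping.single \<alpha> c \<in> scalars"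
  by (simp add: scalars_iff)

lemma scalars_add: "p \<in> scalars \<Longrightarrow> q \<in> scalars \<Longrightarrow> p + q \<in> scalars"
  unfolding scalars_iff using keys_add[of p q] by auto

lemma scalars_diff: "p \<in> scalars \<Longrightarrow> q \<in> scalars \<Longrightarrow> p - q \<in> scalars"
  unfolding scalars_iff using keys_diff[of p q] by auto

lemma scalars_zero: "0 \<in> scalars"
  by (simp add: scalars_iff)

lemma monomial_nonzero: "monomial a \<noteq> 0"
  using keys_single[of a 1] by (metis keys_zero empty_not_insert zero_neq_one)

text \<open>A nonzero \<open>\<chi> a\<close> is a multiple of a Laurent monomial of exponent
  \<open>\<alpha> - \<beta>\<close>, and the monomial of \<open>\<beta>\<close> clears it; for sums
  the denominators are multiplied.\<close>

lemma C_denom: "\<exists>d. d \<in> scalars \<and> d \<noteq> 0 \<and> d * C x \<in> scalars"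
proof (induction x rule: poly_mapping_induct)
  case zero
  then show ?case by (intro exI[of _ 1]) (simp add: C_zero scalars_iff)
next
  case (single a c)
  show ?case
  proof (cases rule: \<chi>_cases[of a])
    case 1
    then show ?thesis by (intro exI[of _ 1]) (simp add: C_single scalars_iff)
  next
    case (2 d \<alpha> \<beta>)
    then show ?thesis
      by (intro exI[of _ "Poly_Mapping.single \<beta> 1"]) (auto simp: C_single mult_single monomial_nonzero scalars_iff)
  qed
next
  case (add x y)
  then obtain d d' where d: "d \<in> scalars" "d \<noteq> 0" "d * C x \<in> scalars"
      "d' \<in> scalars" "d' \<noteq> 0" "d' * C y \<in> scalars" by blast
  have "d * d' * C (x + y) = d' * (d * C x) + d * (d' * C y)"
    by (simp add: C_add algebra_simps)
  also have "\<dots> \<in> scalars" by (intro scalars_mult scalars_add d)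
  finally have "d * d' * C (x + y) \<in> scalars" .
  then show ?case
    using scalars_mult[OF d(1,4)] no_zero_divisors[OF d(2,5)] by (intro exI[of _ "d * d'"] conjI)
qed

section \<open>The largest ideal in the kernel of the functional\<close>

definition N :: "('q \<Rightarrow>\<^sub>0 'k) set" where
  "N = {f. \<forall>g. C (f * g) = 0}"

lemma idl_N: "idl N"
  unfolding idl_def N_def by (auto simp: C_zero C_add distrib_right mult.assoc) (metis mult.left_commute)

lemma N_iff: "f \<in> N \<longleftrightarrow> (\<forall>b. C (f * monomial b) = 0)"
proof
  assume f: "\<forall>b. C (f * monomial b) = 0"
  have "C (f * h) = 0" for h
  proof (induction h rule: poly_mapping_induct)
    case (single b c)
    have "f * Poly_Mapping.single b c = \<kappa> (Poly_Mapping.single 0 c) * (f * monomial b)"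
      by (simp add: \<kappa>_single mult_single mult.left_commute)
    then show ?case using f C_scale[OF scalars_single[OF zero_exponents]] by simp
  qed (simp_all add: C_zero C_add distrib_left)
  then show "f \<in> N" by (simp add: N_def)
qed (simp add: N_def)

text \<open>By \<open>binomials_I\<close> only binomials are tested: a monomial in \<open>I\<close>
  has \<open>\<chi>\<close> zero, and proportional elements have proportional values of
  \<open>\<chi>\<close>.\<close>

lemma I_subset_N: "I \<subseteq> N"
proof (rule binomials_I[OF idl_N], rule subsetI)
  fix f assume "f \<in> I \<inter> binomials"
  then obtain a b c where f: "f = monomial a - Poly_Mapping.single b c" "f \<in> I" by (auto simp: binomials_def)
  have "C (f * monomial d) = 0" for d
  proof (cases "c = 0")
    case True
    then have "monomial (a + d) \<in> I" using f mono_I_add by simp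
    then show ?thesis using \<chi>_I f(1) True by (simp add: mult_single C_single)
  next
    case False
    then have "proportional (a + d) c (b + d)" using f by (intro proportional_add) (simp add: proportional_def)
    from \<chi>_proportional[OF this] have "C (monomial (a + d)) = C (Poly_Mapping.single (b + d) c)"
      by (simp add: C_single)
    moreover have "monomial (a + d) = f * monomial d + Poly_Mapping.single (b + d) c"
      using f(1) by (simp add: left_diff_distrib mult_single)
    ultimately show ?thesis using C_add by (metis add_cancel_left_left)
  qed
  then show "f \<in> N" using N_iff by blast
qed

lemma one_notin_N: "1 \<notin> N"
proof
  assume "1 \<in> N"
  then have "C (monomial w) = 0" by (auto simp: N_iff dest: spec[of _ w])
  then have "\<chi> w = 0" by (simp add: C_single)
  moreover have "\<chi> w = Poly_Mapping.single (0 - 0) 1"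
    by (rule \<chi>_eq) (simp_all add: proportional_refl)
  ultimately show False by simp
qed

lemma lookup_C_mult_monomial:
  "Poly_Mapping.lookup (C (f * monomial b)) \<delta> = linext (\<lambda>a x. x * Poly_Mapping.lookup (\<chi> (a + b)) \<delta>) f"
proof (induction f rule: poly_mapping_induct)
  case (single a c)
  have "Poly_Mapping.lookup (Poly_Mapping.single 0 c * p) \<delta> = c * Poly_Mapping.lookup p \<delta>"
    for p :: "(nat \<Rightarrow>\<^sub>0 int) \<Rightarrow>\<^sub>0 'k"
    by (induction p rule: poly_mapping_induct)
      (simp_all add: mult_single lookup_single when_def distrib_left lookup_add)
  then show ?case by (simp add: mult_single C_single linext_single)
next
  case (add f h)
  then show ?case
    by (simp add: distrib_right C_add lookup_add) (rule linext_add[symmetric], simp_all add: distrib_right)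
qed (simp add: C_zero)

text \<open>The functional only sees the classes \<open>w + ev g \<alpha>\<close> and their shifts,
  while \<open>closure_ideal\<close> tests \<open>w + h\<close> for every unit \<open>h\<close>.
  Since \<open>h\<close> is torsion, a suitable translation carries the class of
  \<open>w + h\<close> to one of the former kind and changes all coefficients by the same nonzero
  factor.\<close>

lemma N_eq_closure_ideal: "N = closure_ideal"
proof (intro equalityI subsetI)
  fix f assume f: "f \<in> closure_ideal"
  have "Poly_Mapping.lookup (C (f * monomial b)) \<delta> = 0" for b \<delta>
  proof (cases "\<exists>\<alpha>\<in>exponents r. \<exists>\<beta>\<in>exponents r. \<delta> = \<alpha> - \<beta>")
    case True
    then obtain \<alpha> \<beta> where ab: "\<alpha> \<in> exponents r" "\<beta> \<in> exponents r" "\<delta> = \<alpha> - \<beta>" by blast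
    have "Poly_Mapping.lookup (C (f * monomial b)) \<delta> = linext (\<lambda>a x. x * coef (a + (b + ev g \<beta>)) (w + ev g \<alpha>)) f"
      unfolding lookup_C_mult_monomial ab(3) lookup_\<chi>[OF ab(1,2)] by (simp add: add.assoc)
    then show ?thesis using f ev_notin[OF ab(1)] by (simp add: closure_ideal_def)
  next
    case False
    have "Poly_Mapping.lookup (\<chi> (a + b)) \<delta> = 0" for a
      by (cases rule: \<chi>_cases[of "a + b"]) (use False in \<open>auto simp: lookup_single when_def\<close>)
    then show ?thesis by (simp add: lookup_C_mult_monomial linext_def)
  qed
  then have "C (f * monomial b) = 0" for b by (intro poly_mapping_eqI) simp
  then show "f \<in> N" using N_iff by blast
next
  fix f assume f: "f \<in> N"
  have "linext (\<lambda>a x. x * coef (a + b) (w + h)) f = 0" if h: "h \<notin> P" for b h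
  proof -
    obtain n c \<alpha> \<beta> where n: "n > 0" "\<alpha> \<in> exponents r" "\<beta> \<in> exponents r"
        "proportional (nmult n h + ev g \<alpha>) c (ev g \<beta>)"
      using tors[OF h] by (auto simp: torsion_over_def)
    obtain m where m: "n = Suc m" using n(1) gr0_implies_Suc by blast
    \<comment> \<open>With \<open>n = m + 1\<close>, the sum \<open>h + d\<close> is
      \<open>nmult n h + ev g \<alpha>\<close>, which is proportional to
      \<open>ev g \<beta>\<close>.\<close>
    define d where "d = nmult m h + ev g \<alpha>"
    have d: "d \<notin> P" unfolding d_def using h notin_P_nmult notin_P_add ev_notin[OF n(2)] by blast
    have p: "proportional (w + h + d) c (w + ev g \<beta>)"
      using proportional_add_left[OF n(4), of w] by (simp add: m d_def ac_simps)
    have wh: "monomial (w + h) \<notin> I" "monomial (w + h + d) \<notin> I"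
      using w_add_notin[OF h] w_add_notin[OF notin_P_add[OF h d]] by (simp_all add: add.assoc)
    have "coef (a + b) (w + h) * c = Poly_Mapping.lookup (\<chi> (a + (b + d))) (\<beta> - 0)" for a
    proof -
      have "coef (a + (b + d)) (w + ev g \<beta>) = coef (a + b + d) (w + h + d) * c"
        using coef_change[OF wh(2) p] by (simp add: add.assoc)
      then show ?thesis using coef_add[OF d wh(1)] lookup_\<chi>[OF n(3) zero_exponents] by simp
    qed
    then have "linext (\<lambda>a x. x * coef (a + b) (w + h)) f * c = Poly_Mapping.lookup (C (f * monomial (b + d))) (\<beta> - 0)"
      unfolding lookup_C_mult_monomial by (simp add: linext_def sum_distrib_right mult.assoc)
    also have "\<dots> = 0" using f by (simp add: N_iff)
    finally show ?thesis using n(4) by (simp add: proportional_def)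
  qed
  then show "f \<in> closure_ideal" by (simp add: closure_ideal_def)
qed

lemma \<kappa>_one: "\<kappa> 1 = 1"
  using \<kappa>_single[of 0 1] by simp

lemma generator_power:
  "\<exists>n d l. n > 0 \<and> d \<in> scalars \<and> d \<noteq> 0 \<and> l \<in> scalars \<and> \<kappa> d * monomial (nmult n s) - \<kappa> l \<in> N"
proof (cases "s \<in> P")
  case True
  then obtain n where "monomial (nmult n s) \<in> I" using nilpotent by blast
  \<comment> \<open>Passing to \<open>Suc n\<close> secures a positive exponent even for
    \<open>n = 0\<close>.\<close>
  then have "monomial (nmult (Suc n) s) \<in> I"
    using mono_I_add[of "nmult n s" s] by (simp add: add.commute)
  then have "\<kappa> 1 * monomial (nmult (Suc n) s) - \<kappa> 0 \<in> N"
    using I_subset_N by (auto simp: \<kappa>_one \<kappa>_zero)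
  then show ?thesis
    by (intro exI[of _ "Suc n"] exI[of _ 1] exI[of _ 0] conjI scalars_one scalars_zero) simp_all
next
  case False
  then obtain n c \<alpha> \<beta> where n: "n > 0" "\<alpha> \<in> exponents r" "\<beta> \<in> exponents r"
      "proportional (nmult n s + ev g \<alpha>) c (ev g \<beta>)"
    using tors[OF False] by (auto simp: torsion_over_def)
  have "\<kappa> (monomial \<alpha>) * monomial (nmult n s) - \<kappa> (Poly_Mapping.single \<beta> c)
      = monomial (nmult n s + ev g \<alpha>) - Poly_Mapping.single (ev g \<beta>) c"
    by (simp add: \<kappa>_single mult_single add.commute)
  also have "\<dots> \<in> N" using n(4) I_subset_N unfolding proportional_def by blast
  finally have "\<kappa> (monomial \<alpha>) * monomial (nmult n s) - \<kappa> (Poly_Mapping.single \<beta> c) \<in> N" .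
  then show ?thesis
    by (intro exI[of _ n] exI[of _ "monomial \<alpha>"] exI[of _ "Poly_Mapping.single \<beta> c"] conjI
        n(1) scalars_single[OF n(2)] scalars_single[OF n(3)] monomial_nonzero)
qed

text \<open>\<open>Y\<close> consists of the monomials with multiplicities below \<open>n s\<close>,
  the exponent from \<open>generator_power\<close>. It suffices that the set \<open>Z\<close> of
  elements whose monomial is, up to denominators, a scalar multiple of a member of \<open>Y\<close>
  is stable under adding generators.\<close>

lemma finite_span:
  fixes S :: "'q set"
  assumes S: "finite S"
    and gen: "\<And>T. 0 \<in> T \<Longrightarrow> (\<And>a b. a \<in> T \<Longrightarrow> b \<in> T \<Longrightarrow> a + b \<in> T) \<Longrightarrow> S \<subseteq> T \<Longrightarrow> T = UNIV"
  shows "\<exists>Y. finite Y \<and> (\<forall>f. \<exists>d c. d \<in> scalars \<and> d \<noteq> 0 \<and> (\<forall>y. c y \<in> scalars) \<and>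
           \<kappa> d * f - (\<Sum>y\<in>Y. \<kappa> (c y) * y) \<in> N)"
proof -
  have "\<forall>s. \<exists>n d l. n > 0 \<and> d \<in> scalars \<and> d \<noteq> 0 \<and> l \<in> scalars \<and> \<kappa> d * monomial (nmult n s) - \<kappa> l \<in> N"
    using generator_power by blast
  then obtain n d l where n: "\<And>s. n s > 0" and d: "\<And>s. d s \<in> scalars" "\<And>s. d s \<noteq> 0"
      and l: "\<And>s. l s \<in> scalars" and pow: "\<And>s. \<kappa> (d s) * monomial (nmult (n s) s) - \<kappa> (l s) \<in> N"
    by metis
  define el where "el m = (\<Sum>s\<in>S. nmult (m s) s)" for m :: "'q \<Rightarrow> nat"
  define Y where "Y = (\<lambda>m. monomial (el m) :: 'q \<Rightarrow>\<^sub>0 'k) ` (PiE S (\<lambda>s. {..<n s}))"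
  have finY: "finite Y" unfolding Y_def using S by (intro finite_imageI finite_PiE) auto
  define Z where "Z = {a. \<exists>e k y. e \<in> scalars \<and> e \<noteq> 0 \<and> k \<in> scalars \<and> y \<in> Y \<and> \<kappa> e * monomial a - \<kappa> k * y \<in> N}"
  have step: "s + a \<in> Z" if a: "a \<in> Z" and s: "s \<in> S" for a s
  proof -
    obtain e k m where e: "e \<in> scalars" "e \<noteq> 0" "k \<in> scalars" and m: "m \<in> PiE S (\<lambda>s. {..<n s})"
        and N1: "\<kappa> e * monomial a - \<kappa> k * monomial (el m) \<in> N"
      using a by (auto simp: Z_def Y_def)
    have "monomial s * (\<kappa> e * monomial a - \<kappa> k * monomial (el m))
        = \<kappa> e * monomial (s + a) - \<kappa> k * monomial (s + el m)"
      by (simp add: right_diff_distrib mult.left_commute[of "monomial s"] mult_single)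
    then have N2: "\<kappa> e * monomial (s + a) - \<kappa> k * monomial (s + el m) \<in> N"
      using idl_mult[OF idl_N N1, of "monomial s"] by simp
    have ms: "m s < n s" using m s by auto
    have el_upd: "el (m(s := j)) = nmult j s + (\<Sum>t\<in>S - {s}. nmult (m t) t)" for j
      unfolding el_def using S s by (subst sum.remove[of _ s]) (auto intro!: sum.cong)
    have el_m: "el m = nmult (m s) s + (\<Sum>t\<in>S - {s}. nmult (m t) t)" using el_upd[of "m s"] by simp
    have upd: "m(s := j) \<in> PiE S (\<lambda>s. {..<n s})" if "j < n s" for j using m s that by (auto simp: PiE_def extensional_def)
    show ?thesis
    proof (cases "Suc (m s) < n s")
      case True
      have "s + el m = el (m(s := Suc (m s)))" unfolding el_upd el_m by (simp add: add.assoc)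
      moreover have "monomial (el (m(s := Suc (m s)))) \<in> Y"
        unfolding Y_def by (rule imageI, rule upd[OF True])
      ultimately show ?thesis using N2 e unfolding Z_def mem_Collect_eq
        by (intro exI[of _ e] exI[of _ k] exI[of _ "monomial (el (m(s := Suc (m s))))"] conjI) simp_all
    next
      case False
      \<comment> \<open>The multiplicity of \<open>s\<close> overflows: the power
        \<open>nmult (n s) s\<close> is replaced by the scalar \<open>l s / d s\<close>, and the
        multiplicity restarts at zero.\<close>
      then have "Suc (m s) = n s" using ms by simp
      then have "nmult (n s) s = s + nmult (m s) s" by (metis nmult.simps(2))
      then have "s + el m = nmult (n s) s + el (m(s := 0))"
        unfolding el_upd el_m by (simp add: add.assoc)
      then have eq: "monomial (s + el m) = monomial (nmult (n s) s) * monomial (el (m(s := 0)))"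
        by (simp add: mult_single)
      have "\<kappa> (d s) * (\<kappa> e * monomial (s + a) - \<kappa> k * monomial (s + el m)) +
          \<kappa> k * monomial (el (m(s := 0))) * (\<kappa> (d s) * monomial (nmult (n s) s) - \<kappa> (l s)) \<in> N"
        by (rule idl_add[OF idl_N idl_mult[OF idl_N N2] idl_mult[OF idl_N pow]])
      also have "\<kappa> (d s) * (\<kappa> e * monomial (s + a) - \<kappa> k * monomial (s + el m)) +
          \<kappa> k * monomial (el (m(s := 0))) * (\<kappa> (d s) * monomial (nmult (n s) s) - \<kappa> (l s))
        = \<kappa> (d s * e) * monomial (s + a) - \<kappa> (k * l s) * monomial (el (m(s := 0)))"
        unfolding \<kappa>_mult[OF d(1) e(1)] \<kappa>_mult[OF e(3) l] eq by (simp only: algebra_simps)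
      finally have "\<kappa> (d s * e) * monomial (s + a) - \<kappa> (k * l s) * monomial (el (m(s := 0))) \<in> N" .
      moreover have "monomial (el (m(s := 0))) \<in> Y" unfolding Y_def by (rule imageI, rule upd, rule n)
      ultimately show ?thesis unfolding Z_def mem_Collect_eq
        by (intro exI[of _ "d s * e"] exI[of _ "k * l s"] exI[of _ "monomial (el (m(s := 0)))"] conjI
            scalars_mult[OF d(1) e(1)] no_zero_divisors[OF d(2) e(2)] scalars_mult[OF e(3) l])
    qed
  qed
  \<comment> \<open>The elements whose translation preserves \<open>Z\<close> form a submonoid
    containing the generators; applied to \<open>0\<close> in \<open>Z\<close>, every element lies
    in \<open>Z\<close>.\<close>
  have "{a. \<forall>z\<in>Z. a + z \<in> Z} = UNIV"
    by (rule gen) (use step in \<open>auto simp: add.assoc\<close>)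
  moreover have "0 \<in> Z"
  proof -
    let ?m = "\<lambda>s. if s \<in> S then 0 else undefined"
    have "el ?m = 0" unfolding el_def by (intro sum.neutral) simp
    moreover have "?m \<in> PiE S (\<lambda>s. {..<n s})" using n by auto
    ultimately have "monomial 0 \<in> Y" unfolding Y_def by (metis image_eqI)
    moreover have "\<kappa> 1 * monomial 0 - \<kappa> 1 * monomial 0 \<in> N" using idl_zero[OF idl_N] by simp
    moreover note scalars_one
    ultimately show ?thesis unfolding Z_def mem_Collect_eq
      by (intro exI[of _ 1] exI[of _ "monomial 0"] conjI zero_neq_one[symmetric])
  qed
  moreover have "a \<in> {a. \<forall>z\<in>Z. a + z \<in> Z}" for a using calculation(1) by (simp only: UNIV_I)
  ultimately have Z: "a \<in> Z" for a by (metis (mono_tags, lifting) add.right_neutral mem_Collect_eq)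
  have "\<exists>d c. d \<in> scalars \<and> d \<noteq> 0 \<and> (\<forall>y. c y \<in> scalars) \<and> \<kappa> d * f - (\<Sum>y\<in>Y. \<kappa> (c y) * y) \<in> N" for f
  proof (induction f rule: poly_mapping_induct)
    case zero
    show ?case using idl_zero[OF idl_N] by (intro exI[of _ 1] exI[of _ "\<lambda>_. 0"]) (simp add: \<kappa>_zero scalars_one scalars_zero)
  next
    case (single a x)
    obtain e k y where e: "e \<in> scalars" "e \<noteq> 0" "k \<in> scalars" "y \<in> Y" and N1: "\<kappa> e * monomial a - \<kappa> k * y \<in> N"
      using Z[of a] by (auto simp: Z_def)
    have x: "Poly_Mapping.single 0 x \<in> scalars" by (rule scalars_single) simp
    define c where "c z = (if z = y then Poly_Mapping.single 0 x * k else 0)" for z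
    have c: "c z \<in> scalars" for z using scalars_mult[OF x e(3)] by (simp add: c_def scalars_zero)
    have "(\<Sum>z\<in>Y. \<kappa> (c z) * z) = (\<Sum>z\<in>{y}. \<kappa> (c z) * z)"
      using finY e(4) by (intro sum.mono_neutral_right) (auto simp: c_def \<kappa>_zero)
    also have "\<dots> = Poly_Mapping.single 0 x * (\<kappa> k * y)"
      using \<kappa>_mult[OF x e(3)] by (simp add: c_def \<kappa>_single mult.assoc)
    finally have "\<kappa> e * Poly_Mapping.single a x - (\<Sum>z\<in>Y. \<kappa> (c z) * z)
        = Poly_Mapping.single 0 x * (\<kappa> e * monomial a - \<kappa> k * y)"
      by (simp add: right_diff_distrib mult.left_commute[of _ "\<kappa> e"] mult_single)
    also have "\<dots> \<in> N" using N1 by (rule idl_mult[OF idl_N])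
    finally show ?case using e(1,2) c by (intro exI[of _ e] exI[of _ c] conjI allI)
  next
    case (add f h)
    obtain d c where dc: "d \<in> scalars" "d \<noteq> 0" "\<And>y. c y \<in> scalars"
        "\<kappa> d * f - (\<Sum>y\<in>Y. \<kappa> (c y) * y) \<in> N" using add(1) by blast
    obtain d' c' where dc': "d' \<in> scalars" "d' \<noteq> 0" "\<And>y. c' y \<in> scalars"
        "\<kappa> d' * h - (\<Sum>y\<in>Y. \<kappa> (c' y) * y) \<in> N" using add(2) by blast
    have "\<kappa> d' * (\<kappa> d * f - (\<Sum>y\<in>Y. \<kappa> (c y) * y)) + \<kappa> d * (\<kappa> d' * h - (\<Sum>y\<in>Y. \<kappa> (c' y) * y)) \<in> N"
      using dc(4) dc'(4) by (intro idl_add[OF idl_N] idl_mult[OF idl_N])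
    also have "\<kappa> d' * (\<kappa> d * f - (\<Sum>y\<in>Y. \<kappa> (c y) * y)) + \<kappa> d * (\<kappa> d' * h - (\<Sum>y\<in>Y. \<kappa> (c' y) * y))
        = \<kappa> (d * d') * (f + h) - (\<Sum>y\<in>Y. \<kappa> (d' * c y + d * c' y) * y)"
      unfolding \<kappa>_mult[OF dc(1) dc'(1)] \<kappa>_add \<kappa>_mult[OF dc'(1) dc(3)] \<kappa>_mult[OF dc(1) dc'(3)]
      by (simp add: algebra_simps sum.distrib sum_distrib_left)
    finally have "\<kappa> (d * d') * (f + h) - (\<Sum>y\<in>Y. \<kappa> (d' * c y + d * c' y) * y) \<in> N" .
    moreover have "d' * c y + d * c' y \<in> scalars" for y by (intro scalars_add scalars_mult dc dc')
    ultimately show ?case using scalars_mult[OF dc(1) dc'(1)] no_zero_divisors[OF dc(2) dc'(2)]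
      by (intro exI[of _ "d * d'"] exI[of _ "\<lambda>y. d' * c y + d * c' y"] conjI allI)
  qed
  then show ?thesis using finY by (intro exI[of _ Y] conjI allI)
qed

lemma frobenius_quotient_closure:
  fixes S :: "'q set"
  assumes "finite S"
    and "\<And>T. 0 \<in> T \<Longrightarrow> (\<And>a b. a \<in> T \<Longrightarrow> b \<in> T \<Longrightarrow> a + b \<in> T) \<Longrightarrow> S \<subseteq> T \<Longrightarrow> T = UNIV"
  shows "\<exists>Y. frobenius_quotient scalars \<kappa> C N Y"
proof -
  obtain Y where Y: "finite Y" "\<And>f. \<exists>d c. d \<in> scalars \<and> d \<noteq> 0 \<and> (\<forall>y. c y \<in> scalars) \<and>
           \<kappa> d * f - (\<Sum>y\<in>Y. \<kappa> (c y) * y) \<in> N"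
    using finite_span[OF assms] by blast
  have "frobenius_quotient scalars \<kappa> C N Y"
  proof (rule frobenius_quotient.intro)
    show "p - q \<in> scalars" if "p \<in> scalars" "q \<in> scalars" for p q
      using that by (rule scalars_diff)
    show "1 \<in> scalars" by (rule scalars_one)
    show "p * q \<in> scalars" "\<kappa> (p + q) = \<kappa> p + \<kappa> q" "\<kappa> (p * q) = \<kappa> p * \<kappa> q"
      if "p \<in> scalars" "q \<in> scalars" for p q
      by (rule scalars_mult[OF that], rule \<kappa>_add, rule \<kappa>_mult[OF that])
    show "C (\<kappa> p * f) = p * C f" if "p \<in> scalars" for p f using that by (rule C_scale)
    show "\<exists>d. d \<in> scalars \<and> d \<noteq> 0 \<and> d * C x \<in> scalars" for x by (rule C_denom)
    show "\<exists>d c. d \<in> scalars \<and> d \<noteq> 0 \<and> (\<forall>y. c y \<in> scalars) \<and>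
           \<kappa> d * f - (\<Sum>y\<in>Y. \<kappa> (c y) * y) \<in> N" for f by (rule Y(2))
  qed (rule \<kappa>_one C_add N_def Y(1))+
  then show ?thesis by blast
qed

end

lemma closure_ideal_decomposition:
  fixes S :: "'q set"
  assumes "finite S"
    and "\<And>T. 0 \<in> T \<Longrightarrow> (\<And>a b. a \<in> T \<Longrightarrow> b \<in> T \<Longrightarrow> a + b \<in> T) \<Longrightarrow> S \<subseteq> T \<Longrightarrow> T = UNIV"
  shows "\<exists>D. finite D \<and> (\<forall>A\<in>D. primary_idl A \<and> irreducible_idl A) \<and>
           (\<forall>A\<in>D. \<forall>B\<in>D. radical_of A \<subseteq> radical_of B \<longrightarrow> A = B) \<and> \<Inter>D = closure_ideal"
proof -
  obtain r g where rg: "independent r g" "\<And>h. h \<notin> P \<Longrightarrow> torsion_over r g h"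
    using ex_maximal_independent[OF assms] by blast
  obtain Y where "frobenius_quotient (scalars r) (\<kappa> g) (C r g) (N r g) Y"
    using frobenius_quotient_closure[OF rg assms] by blast
  note * = frobenius_quotient.irreducible_decomposition[OF this]
  have "N r g = closure_ideal" by (rule N_eq_closure_ideal) (use rg in blast)+
  moreover have "1 \<notin> N r g" by (rule one_notin_N) (use rg in blast)+
  ultimately show ?thesis using * by simp
qed

end

section \<open>The localization\<close>

context primary_binomial
begin

abbreviation L :: "('q \<times> 'q) set monoid" where
  "L \<equiv> localization type_monoid P"

abbreviation fr :: "'q \<Rightarrow> 'q \<Rightarrow> ('q \<times> 'q) set" where
  "fr \<equiv> frac type_monoid P"

abbreviation A :: "(('q \<times> 'q) set \<Rightarrow>\<^sub>0 'k) ring" where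
  "A \<equiv> loc_alg P"

abbreviation IP :: "(('q \<times> 'q) set \<Rightarrow>\<^sub>0 'k) set" where
  "IP \<equiv> loc_ideal P I"

lemma submonoid_complement: "submonoid (carrier type_monoid - P) type_monoid"
  by (rule submonoid.intro) (auto simp: type_monoid_def zero_notin_P notin_P_add)

lemma comm_monoid_L: "comm_monoid L"
  by (rule comm_monoid_localization(1)[OF comm_monoid_type_monoid submonoid_complement])

lemma fr_mult: "s \<notin> P \<Longrightarrow> t \<notin> P \<Longrightarrow> fr a s \<otimes>\<^bsub>L\<^esub> fr b t = fr (a + b) (s + t)"
  using comm_monoid_localization(2)[OF comm_monoid_type_monoid submonoid_complement, of a b s t]
  by (simp add: type_monoid_def)

lemma fr_eq_iff:
  assumes "s \<notin> P" "t \<notin> P"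
  shows "fr a s = fr b t \<longleftrightarrow> (\<exists>u. u \<notin> P \<and> a + t + u = b + s + u)"
proof -
  have "fr a s = fr b t \<longleftrightarrow> ((a, s), (b, t)) \<in> loc_rel type_monoid P"
    unfolding frac_def
    by (rule eq_equiv_class_iff[OF comm_monoid_localization(3)[OF comm_monoid_type_monoid submonoid_complement]])
      (use assms in \<open>auto simp: type_monoid_def\<close>)
  then show ?thesis using assms by (auto simp: loc_rel_def type_monoid_def)
qed

lemma carrier_L: "q \<in> carrier L \<longleftrightarrow> (\<exists>a s. s \<notin> P \<and> q = fr a s)"
  by (auto simp: localization_def quotient_def frac_def type_monoid_def)

lemma fr_in_L: "s \<notin> P \<Longrightarrow> fr a s \<in> carrier L"
  using carrier_L by blast

lemma one_L: "\<one>\<^bsub>L\<^esub> = fr 0 0"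
  by (simp add: localization_def type_monoid_def)

lemma loc_map_eq: "loc_map type_monoid P a = fr a 0"
  by (simp add: loc_map_def type_monoid_def)

lemma fr_cancel: "s \<notin> P \<Longrightarrow> h \<notin> P \<Longrightarrow> fr (a + h) (s + h) = fr a s"
  by (subst fr_eq_iff) (auto simp: notin_P_add zero_notin_P intro!: exI[of _ 0] simp: ac_simps)

text \<open>If \<open>a - s\<close> has an inverse, then adding something to \<open>a\<close> leaves
  \<open>P\<close>, so \<open>a\<close> is not in the ideal \<open>P\<close>; conversely
  \<open>s - r\<close> inverts \<open>r - s\<close>.\<close>

lemma Units_L: "u \<in> Units L \<longleftrightarrow> (\<exists>r s. r \<notin> P \<and> s \<notin> P \<and> u = fr r s)"
proof
  assume u: "u \<in> Units L"
  then obtain a s where a: "s \<notin> P" "u = fr a s" using carrier_L by (auto simp: Units_def)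
  from u obtain y where y: "y \<in> carrier L" "u \<otimes>\<^bsub>L\<^esub> y = \<one>\<^bsub>L\<^esub>" by (auto simp: Units_def)
  then obtain b t where b: "t \<notin> P" "y = fr b t" using carrier_L by blast
  have "fr (a + b) (s + t) = fr 0 0" using y(2) a b by (simp add: fr_mult one_L)
  then obtain v where "v \<notin> P" "a + b + v = s + t + v"
    using fr_eq_iff[of "s + t" 0] a(1) b(1) zero_notin_P notin_P_add by auto
  then have "a + (b + v) \<notin> P" using a(1) b(1) notin_P_add by (metis add.assoc)
  then have "a \<notin> P" using P_add by blast
  then show "\<exists>r s. r \<notin> P \<and> s \<notin> P \<and> u = fr r s" using a by blast
next
  assume "\<exists>r s. r \<notin> P \<and> s \<notin> P \<and> u = fr r s"
  then obtain r s where u: "r \<notin> P" "s \<notin> P" "u = fr r s" by blast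
  have "fr (r + s) (r + s) = fr 0 0" using fr_cancel[of 0 "r + s" 0] u zero_notin_P notin_P_add by simp
  then have "fr r s \<otimes>\<^bsub>L\<^esub> fr s r = \<one>\<^bsub>L\<^esub>" "fr s r \<otimes>\<^bsub>L\<^esub> fr r s = \<one>\<^bsub>L\<^esub>"
    using u by (simp_all add: fr_mult one_L add.commute)
  then show "u \<in> Units L" using u fr_in_L unfolding Units_def by blast
qed

lemma cring_A: "cring A"
  unfolding loc_alg_def by (rule cring_monoid_alg[OF comm_monoid_L])

lemma carrier_A: "x \<in> carrier A \<longleftrightarrow> Poly_Mapping.keys x \<subseteq> carrier L"
  by (simp add: loc_alg_def monoid_alg_def)

lemma add_A: "x \<oplus>\<^bsub>A\<^esub> y = x + y" and zero_A: "\<zero>\<^bsub>A\<^esub> = 0"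
  and one_A: "\<one>\<^bsub>A\<^esub> = monomial (fr 0 0)"
  by (simp_all add: loc_alg_def monoid_alg_def one_L)

lemma single_in_A: "q \<in> carrier L \<Longrightarrow> Poly_Mapping.single q c \<in> carrier A"
  by (simp add: carrier_A)

lemma add_in_A: "x \<in> carrier A \<Longrightarrow> y \<in> carrier A \<Longrightarrow> x + y \<in> carrier A"
  using keys_add[of x y] by (auto simp: carrier_A)

lemma diff_in_A: "x \<in> carrier A \<Longrightarrow> y \<in> carrier A \<Longrightarrow> x - y \<in> carrier A"
  using keys_diff[of x y] by (auto simp: carrier_A)

lemma uminus_A: "x \<in> carrier A \<Longrightarrow> \<ominus>\<^bsub>A\<^esub> x = - x"
proof -
  interpret A: cring A by (rule cring_A)
  assume "x \<in> carrier A"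
  moreover from this have "- x \<in> carrier A" by (simp add: carrier_A)
  ultimately show ?thesis by (intro A.minus_equality) (simp_all add: add_A zero_A)
qed

lemma mult_single_A: "Poly_Mapping.single p c \<otimes>\<^bsub>A\<^esub> Poly_Mapping.single q d = Poly_Mapping.single (p \<otimes>\<^bsub>L\<^esub> q) (c * d)"
  unfolding loc_alg_def
  by (subst monoid_alg_mult[of "{p}" "{q}"]) auto

lemma mult_zero_A: "0 \<otimes>\<^bsub>A\<^esub> x = 0" "x \<otimes>\<^bsub>A\<^esub> 0 = 0"
  by (simp_all add: loc_alg_def monoid_alg_def)

lemma distrib_A:
  assumes "x \<in> carrier A" "y \<in> carrier A" "z \<in> carrier A"
  shows "(x + y) \<otimes>\<^bsub>A\<^esub> z = x \<otimes>\<^bsub>A\<^esub> z + y \<otimes>\<^bsub>A\<^esub> z" "z \<otimes>\<^bsub>A\<^esub> (x + y) = z \<otimes>\<^bsub>A\<^esub> x + z \<otimes>\<^bsub>A\<^esub> y"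
    "(x - y) \<otimes>\<^bsub>A\<^esub> z = x \<otimes>\<^bsub>A\<^esub> z - y \<otimes>\<^bsub>A\<^esub> z"
proof -
  interpret A: cring A by (rule cring_A)
  show "(x + y) \<otimes>\<^bsub>A\<^esub> z = x \<otimes>\<^bsub>A\<^esub> z + y \<otimes>\<^bsub>A\<^esub> z" "z \<otimes>\<^bsub>A\<^esub> (x + y) = z \<otimes>\<^bsub>A\<^esub> x + z \<otimes>\<^bsub>A\<^esub> y"
    using A.l_distr[OF assms] A.r_distr[OF assms] by (simp_all add: add_A)
  have "(x - y + y) \<otimes>\<^bsub>A\<^esub> z = (x - y) \<otimes>\<^bsub>A\<^esub> z + y \<otimes>\<^bsub>A\<^esub> z"
    using A.l_distr[OF diff_in_A[OF assms(1,2)] assms(2,3)] by (simp add: add_A)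
  then show "(x - y) \<otimes>\<^bsub>A\<^esub> z = x \<otimes>\<^bsub>A\<^esub> z - y \<otimes>\<^bsub>A\<^esub> z" by simp
qed

lemma loc_alg_map_eq: "loc_alg_map P = linext (\<lambda>a. Poly_Mapping.single (fr a 0))"
  by (rule ext) (simp add: loc_alg_map_def linext_def loc_map_eq)

lemma loc_alg_map_single: "loc_alg_map P (Poly_Mapping.single a c) = Poly_Mapping.single (fr a 0) c"
  unfolding loc_alg_map_eq by (rule linext_single) simp

lemma loc_alg_map_add: "loc_alg_map P (f + g) = loc_alg_map P f + loc_alg_map P g"
  unfolding loc_alg_map_eq by (rule linext_add) (simp_all add: single_add)

lemma loc_alg_map_diff: "loc_alg_map P (f - g) = loc_alg_map P f - loc_alg_map P g"
  using loc_alg_map_add[of "f - g" g] by simp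

lemma loc_alg_map_zero: "loc_alg_map P 0 = 0"
  by (simp add: loc_alg_map_eq)

lemma loc_alg_map_in_A: "loc_alg_map P f \<in> carrier A"
proof (induction f rule: poly_mapping_induct)
  case zero
  then show ?case by (simp add: loc_alg_map_zero carrier_A)
qed (simp_all add: loc_alg_map_single loc_alg_map_add add_in_A single_in_A fr_in_L zero_notin_P)

lemma ideal_IP: "ideal IP A"
proof -
  interpret A: cring A by (rule cring_A)
  show ?thesis unfolding loc_ideal_def using loc_alg_map_in_A by (intro A.genideal_ideal) blast
qed

lemma IP_add: "x \<in> IP \<Longrightarrow> y \<in> IP \<Longrightarrow> x + y \<in> IP"
  using additive_subgroup.a_closed[OF ideal.axioms(1)[OF ideal_IP]] by (simp add: add_A)

lemma IP_zero: "0 \<in> IP"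
  using additive_subgroup.zero_closed[OF ideal.axioms(1)[OF ideal_IP]] by (simp add: zero_A)

lemma IP_in_A: "x \<in> IP \<Longrightarrow> x \<in> carrier A"
  using additive_subgroup.a_Hcarr[OF ideal.axioms(1)[OF ideal_IP]] .

lemma IP_mult: "x \<in> IP \<Longrightarrow> y \<in> carrier A \<Longrightarrow> x \<otimes>\<^bsub>A\<^esub> y \<in> IP"
  by (rule ideal.I_r_closed[OF ideal_IP])

lemma IP_diff: "x \<in> IP \<Longrightarrow> y \<in> IP \<Longrightarrow> x - y \<in> IP"
  using additive_subgroup.a_inv_closed[OF ideal.axioms(1)[OF ideal_IP], of y]
    IP_add[of x "- y"] by (simp add: uminus_A IP_in_A)

lemma IP_sum: "(\<And>i. i \<in> B \<Longrightarrow> f i \<in> IP) \<Longrightarrow> sum f B \<in> IP"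
  by (induction B rule: infinite_finite_induct) (auto simp: IP_zero IP_add)

lemma loc_alg_map_IP: "f \<in> I \<Longrightarrow> loc_alg_map P f \<in> IP"
proof -
  interpret A: cring A by (rule cring_A)
  assume "f \<in> I"
  then show ?thesis unfolding loc_ideal_def
    using A.genideal_self[of "loc_alg_map P ` I"] loc_alg_map_in_A by blast
qed

lemma proportional_fr_IP:
  assumes "proportional a c b" "s \<notin> P"
  shows "Poly_Mapping.single (fr a s) x - Poly_Mapping.single (fr b s) (x * c) \<in> IP"
proof -
  have "loc_alg_map P (monomial a - Poly_Mapping.single b c) \<otimes>\<^bsub>A\<^esub> Poly_Mapping.single (fr 0 s) x \<in> IP"
    using assms by (intro IP_mult loc_alg_map_IP single_in_A fr_in_L) (auto simp: proportional_def)
  then show ?thesis using assms(2)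
    by (simp add: loc_alg_map_diff loc_alg_map_single distrib_A(3) single_in_A fr_in_L zero_notin_P
        mult_single_A fr_mult mult.commute)
qed

subsection \<open>Coefficient functionals on the localization\<close>

text \<open>The coefficient of \<open>t^b t^q\<close> relative to \<open>t^v\<close>. For
  \<open>q = a - s\<close> both degrees are translated by \<open>s\<close>, which reduces it to
  \<open>coef\<close> inside \<open>Q\<close>.\<close>

definition cf :: "'q \<Rightarrow> 'q \<Rightarrow> ('q \<times> 'q) set \<Rightarrow> 'k" where
  "cf v b q = (case (SOME (a, s). s \<notin> P \<and> q = fr a s) of (a, s) \<Rightarrow> coef (a + b) (v + s))"

text \<open>Two representatives of a fraction agree after translation by elements outside
  \<open>P\<close>, and \<open>coef_add\<close> makes the coefficient invariant under such
  translations.\<close>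

lemma cf_fr:
  assumes "s \<notin> P" "monomial v \<notin> I"
  shows "cf v b (fr a s) = coef (a + b) (v + s)"
proof -
  obtain a' s' where eq: "(SOME (a', s'). s' \<notin> P \<and> fr a s = fr a' s') = (a', s')" by fastforce
  have "case (SOME (a', s'). s' \<notin> P \<and> fr a s = fr a' s') of (a', s') \<Rightarrow> s' \<notin> P \<and> fr a s = fr a' s'"
    by (rule someI[of _ "(a, s)"]) (use assms in simp)
  then have s': "s' \<notin> P" "fr a s = fr a' s'" unfolding eq by auto
  then obtain u where u: "u \<notin> P" "a + s' + u = a' + s + u" using fr_eq_iff assms by blast
  have nI: "monomial (v + h) \<notin> I" if "h \<notin> P" for h using mono_I_cancel[OF that] assms(2) by blast
  have "coef (a + b) (v + s) = coef (a + b + (s' + u)) (v + s + (s' + u))"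
    using coef_add[OF notin_P_add[OF s'(1) u(1)] nI[OF assms(1)]] by simp
  also have "a + b + (s' + u) = a' + b + (s + u)" using u(2) by (metis add.assoc add.commute)
  also have "v + s + (s' + u) = v + s' + (s + u)" by (simp add: ac_simps)
  also have "coef (a' + b + (s + u)) (v + s' + (s + u)) = coef (a' + b) (v + s')"
    by (rule coef_add[OF notin_P_add[OF assms(1) u(1)] nI[OF s'(1)]])
  finally show ?thesis unfolding cf_def eq by simp
qed

definition \<Lambda> :: "'q \<Rightarrow> 'q \<Rightarrow> (('q \<times> 'q) set \<Rightarrow>\<^sub>0 'k) \<Rightarrow> 'k" where
  "\<Lambda> v b = linext (\<lambda>q c. c * cf v b q)"

lemma \<Lambda>_add: "\<Lambda> v b (x + y) = \<Lambda> v b x + \<Lambda> v b y"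
  unfolding \<Lambda>_def by (rule linext_add) (simp_all add: distrib_right)

lemma \<Lambda>_zero: "\<Lambda> v b 0 = 0"
  by (simp add: \<Lambda>_def)

lemma \<Lambda>_diff: "\<Lambda> v b (x - y) = \<Lambda> v b x - \<Lambda> v b y"
  using \<Lambda>_add[of v b "x - y" y] by simp

lemma \<Lambda>_single: "\<Lambda> v b (Poly_Mapping.single q c) = c * cf v b q"
  unfolding \<Lambda>_def by (rule linext_single) simp

text \<open>Multiplying by the fraction \<open>d - t\<close> adds the numerator to the shift
  \<open>b\<close>, while the denominator moves the target class to \<open>v + t\<close>.\<close>

lemma \<Lambda>_mult_single:
  assumes "x \<in> carrier A" "t \<notin> P" "monomial v \<notin> I"
  shows "\<Lambda> v b (x \<otimes>\<^bsub>A\<^esub> Poly_Mapping.single (fr d t) c) = c * \<Lambda> (v + t) (b + d) x"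
  using assms(1)[unfolded carrier_A]
proof (induction x rule: poly_mapping_induct_keys)
  case (single q e)
  then obtain a s where q: "s \<notin> P" "q = fr a s" using carrier_L by blast
  have "monomial (v + t) \<notin> I" using mono_I_cancel assms(2,3) by blast
  then show ?case
    using assms q by (simp add: \<Lambda>_single mult_single_A fr_mult cf_fr notin_P_add ac_simps)
next
  case (add f g)
  then show ?case using assms(2)
    by (simp add: distrib_A carrier_A[symmetric] single_in_A fr_in_L \<Lambda>_add distrib_left)
qed (simp add: \<Lambda>_zero mult_zero_A)

lemma \<Lambda>_loc_alg_map:
  assumes "monomial v \<notin> I"
  shows "\<Lambda> v b (loc_alg_map P f) = linext (\<lambda>a c. c * coef (a + b) v) f"
proof (induction f rule: poly_mapping_induct)
  case (single a c)
  then show ?case using assms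
    by (simp add: loc_alg_map_single \<Lambda>_single cf_fr zero_notin_P linext_single)
next
  case (add f g)
  then show ?case
    by (simp add: loc_alg_map_add \<Lambda>_add) (rule linext_add[symmetric], simp_all add: distrib_right)
qed (simp add: loc_alg_map_zero \<Lambda>_zero)

text \<open>Multiplication by a monomial only changes \<open>b\<close>, so the common kernel over
  all \<open>b\<close> is an ideal, and binomials suffice.\<close>

lemma coef_functional_I:
  assumes v: "monomial v \<notin> I" and f: "f \<in> I"
  shows "linext (\<lambda>a c. c * coef (a + b) v) f = 0"
proof -
  define \<phi> where "\<phi> b = linext (\<lambda>a c. c * coef (a + b) v)" for b
  have add: "\<phi> b (x + y) = \<phi> b x + \<phi> b y" for b x y
    unfolding \<phi>_def by (rule linext_add) (simp_all add: distrib_right)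
  have single: "\<phi> b (Poly_Mapping.single a c) = c * coef (a + b) v" for a b c
    unfolding \<phi>_def by (rule linext_single) simp
  have zero: "\<phi> b 0 = 0" for b by (simp add: \<phi>_def)
  let ?K = "{x. \<forall>b. \<phi> b x = 0}"
  have shift: "\<phi> b (Poly_Mapping.single d c * x) = c * \<phi> (b + d) x" for b d c x
    by (induction x rule: poly_mapping_induct)
      (simp_all add: zero single add mult_single distrib_left add.assoc add.commute add.left_commute mult.assoc)
  have "idl ?K"
    unfolding idl_def mem_Collect_eq
  proof (intro conjI ballI allI)
    fix x r b assume "x \<in> {x. \<forall>b. \<phi> b x = 0}"
    then show "\<phi> b (r * x) = 0"
      by (induction r rule: poly_mapping_induct) (simp_all add: zero add distrib_right shift)
  qed (simp_all add: zero add)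
  moreover have "I \<inter> binomials \<subseteq> ?K"
  proof (rule subsetI)
    fix f assume "f \<in> I \<inter> binomials"
    then obtain a b c where f: "f = monomial a - Poly_Mapping.single b c" "f \<in> I" by (auto simp: binomials_def)
    have "\<phi> d f = coef (a + d) v - c * coef (b + d) v" for d
      using add[of d f "Poly_Mapping.single b c"] f(1) by (simp add: single)
    moreover have "coef (a + d) v = c * coef (b + d) v" for d
    proof (cases "c = 0")
      case True
      then show ?thesis using f coef_I[OF v] mono_I_add by simp
    next
      case False
      then have "proportional (a + d) c (b + d)"
        using f by (intro proportional_add) (simp add: proportional_def)
      then show ?thesis by (rule coef_proportional[OF v])
    qed
    ultimately show "f \<in> ?K" by simp
  qed
  ultimately have "I \<subseteq> ?K" by (rule binomials_I)
  then show ?thesis using f unfolding \<phi>_def by blast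
qed

text \<open>Over the localization a multiplication also moves \<open>v\<close> by a denominator, so
  the common kernel has to be taken over all \<open>v\<close> outside \<open>I\<close> and all
  \<open>b\<close> to be an ideal.\<close>

lemma \<Lambda>_IP:
  assumes "monomial v \<notin> I" "x \<in> IP"
  shows "\<Lambda> v b x = 0"
proof -
  interpret A: cring A by (rule cring_A)
  let ?K = "{x \<in> carrier A. \<forall>v b. monomial v \<notin> I \<longrightarrow> \<Lambda> v b x = 0}"
  have closed: "x \<otimes>\<^bsub>A\<^esub> y \<in> ?K" if x: "x \<in> ?K" and y: "y \<in> carrier A" for x y
  proof -
    have "\<Lambda> v b (x \<otimes>\<^bsub>A\<^esub> y) = 0" if v: "monomial v \<notin> I" for v b
      using y[unfolded carrier_A]
    proof (induction y rule: poly_mapping_induct_keys)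
      case (single q c)
      then obtain d t where q: "t \<notin> P" "q = fr d t" using carrier_L by blast
      have "monomial (v + t) \<notin> I" using mono_I_cancel q(1) v by blast
      then show ?case using x q v by (simp add: \<Lambda>_mult_single)
    next
      case (add f g)
      then show ?case using x by (simp add: distrib_A carrier_A[symmetric] \<Lambda>_add)
    qed (simp add: mult_zero_A \<Lambda>_zero)
    then show ?thesis using x y by simp
  qed
  have "ideal ?K A"
  proof (rule idealI)
    show "ring A" by (rule A.ring_axioms)
    show "subgroup ?K (add_monoid A)"
    proof (rule A.add.subgroupI)
      show "?K \<noteq> {}" using A.zero_closed by (auto simp: zero_A \<Lambda>_zero)
      fix x assume "x \<in> ?K"
      then show "\<ominus>\<^bsub>A\<^esub> x \<in> ?K"
        using \<Lambda>_diff[of _ _ 0 x] by (auto simp: uminus_A \<Lambda>_zero carrier_A)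
    qed (auto simp: add_A \<Lambda>_add add_in_A)
  qed (use closed A.m_comm in auto)
  moreover have "loc_alg_map P ` I \<subseteq> ?K"
    using loc_alg_map_in_A coef_functional_I by (auto simp: \<Lambda>_loc_alg_map)
  ultimately have "IP \<subseteq> ?K" unfolding loc_ideal_def by (rule A.genideal_minimal)
  then show ?thesis using assms by blast
qed

text \<open>The functional at \<open>a\<close> takes the value \<open>1\<close> on the monomial of
  \<open>a\<close> but vanishes on \<open>IP\<close>. This turns the cogenerator condition, stated
  over the localization, into one about \<open>I\<close>.\<close>

lemma monomial_IP_iff: "loc_alg_map P (monomial a) \<in> IP \<longleftrightarrow> monomial a \<in> I"
proof
  assume *: "loc_alg_map P (monomial a) \<in> IP"
  show "monomial a \<in> I"
  proof (rule ccontr)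
    assume a: "monomial a \<notin> I"
    then have "\<Lambda> a 0 (loc_alg_map P (monomial a)) = 0" using \<Lambda>_IP * by blast
    then show False using a by (simp add: \<Lambda>_loc_alg_map linext_single coef_self)
  qed
qed (rule loc_alg_map_IP)

subsection \<open>The quotient ring\<close>

abbreviation R :: "(('q \<times> 'q) set \<Rightarrow>\<^sub>0 'k) set ring" where
  "R \<equiv> RP P I"

abbreviation proj :: "(('q \<times> 'q) set \<Rightarrow>\<^sub>0 'k) \<Rightarrow> (('q \<times> 'q) set \<Rightarrow>\<^sub>0 'k) set" where
  "proj \<equiv> RP_proj P I"

lemma cring_R: "cring R"
  unfolding RP_def by (rule ideal.quotient_is_cring[OF ideal_IP cring_A])

lemma carrier_R: "v \<in> carrier R \<longleftrightarrow> (\<exists>x\<in>carrier A. v = proj x)"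
  by (auto simp: RP_def FactRing_def A_RCOSETS_def' RP_proj_def)

lemma proj_in_R: "x \<in> carrier A \<Longrightarrow> proj x \<in> carrier R"
  using carrier_R by blast

lemma proj_hom: "proj \<in> ring_hom A R"
  unfolding RP_def RP_proj_def by (rule ideal.rcos_ring_hom[OF ideal_IP])

lemma proj_add: "x \<in> carrier A \<Longrightarrow> y \<in> carrier A \<Longrightarrow> proj (x + y) = proj x \<oplus>\<^bsub>R\<^esub> proj y"
  using ring_hom_add[OF proj_hom] by (simp add: add_A)

lemma proj_mult: "x \<in> carrier A \<Longrightarrow> y \<in> carrier A \<Longrightarrow> proj (x \<otimes>\<^bsub>A\<^esub> y) = proj x \<otimes>\<^bsub>R\<^esub> proj y"
  using ring_hom_mult[OF proj_hom] .

lemma zero_in_A: "0 \<in> carrier A"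
  by (simp add: carrier_A)

lemma proj_zero_iff:
  assumes "x \<in> carrier A"
  shows "proj x = \<zero>\<^bsub>R\<^esub> \<longleftrightarrow> x \<in> IP"
proof -
  have "proj x = \<zero>\<^bsub>R\<^esub> \<longleftrightarrow> IP +>\<^bsub>A\<^esub> x = IP" by (simp add: RP_proj_def RP_def FactRing_def)
  also have "\<dots> \<longleftrightarrow> x \<in> IP"
    using ideal.rcos_const_imp_mem[OF ideal_IP assms]
      abelian_subgroup.a_rcos_const[OF ideal.axioms(2)[OF ideal_IP, THEN ring.is_abelian_group,
        THEN abelian_subgroupI3[OF ideal.axioms(1)[OF ideal_IP]]]] by blast
  finally show ?thesis .
qed

lemma zero_R: "\<zero>\<^bsub>R\<^esub> = proj 0"
  using proj_zero_iff[OF zero_in_A] IP_zero by simp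

lemma proj_eq_iff:
  assumes "x \<in> carrier A" "y \<in> carrier A"
  shows "proj x = proj y \<longleftrightarrow> x - y \<in> IP"
proof -
  interpret R: cring R by (rule cring_R)
  have "proj x = proj (x - y) \<oplus>\<^bsub>R\<^esub> proj y" using proj_add[OF diff_in_A[OF assms] assms(2)] by simp
  then have "proj x = proj y \<longleftrightarrow> proj (x - y) = \<zero>\<^bsub>R\<^esub>"
    using R.add.l_cancel_one[OF proj_in_R[OF assms(2)] proj_in_R[OF diff_in_A[OF assms]]]
      R.a_comm[OF proj_in_R[OF assms(2)] proj_in_R[OF diff_in_A[OF assms]]] by auto
  then show ?thesis using proj_zero_iff[OF diff_in_A[OF assms]] by simp
qed

lemma finsum_proj:
  assumes "finite D" "\<And>d. d \<in> D \<Longrightarrow> x d \<in> carrier A"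
  shows "finsum R (\<lambda>d. proj (x d)) D = proj (\<Sum>d\<in>D. x d) \<and> (\<Sum>d\<in>D. x d) \<in> carrier A"
  using assms
proof (induction D rule: finite_induct)
  case empty
  interpret R: cring R by (rule cring_R)
  show ?case by (simp add: zero_R zero_in_A)
next
  case (insert d D)
  interpret R: cring R by (rule cring_R)
  have "finsum R (\<lambda>d. proj (x d)) (insert d D) = proj (x d) \<oplus>\<^bsub>R\<^esub> finsum R (\<lambda>d. proj (x d)) D"
    using insert by (intro R.finsum_insert) (auto intro: proj_in_R)
  then show ?case using insert by (simp add: proj_add add_in_A)
qed

text \<open>Proportionality modulo \<open>IP\<close> is itself a congruence containing the
  generating pairs, hence it contains the congruence they generate.\<close>

lemma loc_congruence_proportional:
  assumes "(q, q') \<in> loc_congruence type_monoid P (induced_congruence I)"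
  shows "\<exists>c. c \<noteq> 0 \<and> monomial q - Poly_Mapping.single q' c \<in> IP"
proof -
  let ?r = "{(q, q'). q \<in> carrier L \<and> q' \<in> carrier L \<and> (\<exists>c. c \<noteq> 0 \<and> monomial q - Poly_Mapping.single q' c \<in> IP)}"
  have scale: "Poly_Mapping.single p (e * x) - Poly_Mapping.single p' (e * x') \<in> IP"
    if "Poly_Mapping.single p x - Poly_Mapping.single p' x' \<in> IP" "p \<in> carrier L" "p' \<in> carrier L"
    for p p' e x x'
  proof -
    interpret L: comm_monoid L by (rule comm_monoid_L)
    have "(Poly_Mapping.single p x - Poly_Mapping.single p' x') \<otimes>\<^bsub>A\<^esub> Poly_Mapping.single \<one>\<^bsub>L\<^esub> e \<in> IP"
      using that(1) by (rule IP_mult) (simp add: single_in_A)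
    then show ?thesis using that(2,3) by (simp add: distrib_A single_in_A mult_single_A mult.commute)
  qed
  have "monoid_congruence L ?r"
    unfolding monoid_congruence_def
  proof (intro conjI)
    show "equiv (carrier L) ?r"
    proof (rule equivI)
      show "refl_on (carrier L) ?r"
        by (auto simp: refl_on_def intro!: exI[of _ 1] IP_zero)
      show "sym ?r"
      proof (rule symI)
        fix q q' assume "(q, q') \<in> ?r"
        then obtain c where c: "q \<in> carrier L" "q' \<in> carrier L" "c \<noteq> 0" "monomial q - Poly_Mapping.single q' c \<in> IP"
          by blast
        have "0 - (Poly_Mapping.single q (inverse c * 1) - Poly_Mapping.single q' (inverse c * c)) \<in> IP"
          by (rule IP_diff[OF IP_zero scale[OF c(4,1,2)]])
        then show "(q', q) \<in> ?r" using c by (auto intro!: exI[of _ "inverse c"])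
      qed
      show "trans ?r"
      proof (rule transI)
        fix q q' q'' assume "(q, q') \<in> ?r" "(q', q'') \<in> ?r"
        then obtain c d where c: "q \<in> carrier L" "q' \<in> carrier L" "q'' \<in> carrier L" "c \<noteq> 0" "d \<noteq> 0"
            "monomial q - Poly_Mapping.single q' c \<in> IP" "monomial q' - Poly_Mapping.single q'' d \<in> IP"
          by blast
        have "(monomial q - Poly_Mapping.single q' c) + (Poly_Mapping.single q' (c * 1) - Poly_Mapping.single q'' (c * d)) \<in> IP"
          by (rule IP_add[OF c(6) scale[OF c(7,2,3)]])
        then show "(q, q'') \<in> ?r" using c by (auto intro!: exI[of _ "c * d"])
      qed
    qed auto
    show "\<forall>(a, b)\<in>?r. \<forall>c\<in>carrier L. (a \<otimes>\<^bsub>L\<^esub> c, b \<otimes>\<^bsub>L\<^esub> c) \<in> ?r"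
    proof (intro ballI, clarify, intro conjI CollectI case_prodI)
      fix a b p c assume p: "a \<in> carrier L" "b \<in> carrier L" "p \<in> carrier L" "c \<noteq> 0"
        "monomial a - Poly_Mapping.single b c \<in> IP"
      interpret L: comm_monoid L by (rule comm_monoid_L)
      show "a \<otimes>\<^bsub>L\<^esub> p \<in> carrier L" "b \<otimes>\<^bsub>L\<^esub> p \<in> carrier L" using p by simp_all
      have "(monomial a - Poly_Mapping.single b c) \<otimes>\<^bsub>A\<^esub> monomial p \<in> IP"
        using p by (intro IP_mult single_in_A)
      then have "monomial (a \<otimes>\<^bsub>L\<^esub> p) - Poly_Mapping.single (b \<otimes>\<^bsub>L\<^esub> p) c \<in> IP"
        using p by (simp add: distrib_A single_in_A mult_single_A)
      then show "\<exists>c. c \<noteq> 0 \<and> monomial (a \<otimes>\<^bsub>L\<^esub> p) - Poly_Mapping.single (b \<otimes>\<^bsub>L\<^esub> p) c \<in> IP"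
        using p(4) by blast
    qed
  qed
  moreover have "{(loc_map type_monoid P a, loc_map type_monoid P b) | a b. (a, b) \<in> induced_congruence I} \<subseteq> ?r"
  proof (rule subsetI)
    fix x assume "x \<in> {(loc_map type_monoid P a, loc_map type_monoid P b) | a b. (a, b) \<in> induced_congruence I}"
    then obtain a b where x: "x = (fr a 0, fr b 0)" and "(a, b) \<in> induced_congruence I"
      by (auto simp: loc_map_eq)
    then obtain c where c: "proportional a c b" by (auto simp: induced_congruence_iff)
    have "monomial (fr a 0) - Poly_Mapping.single (fr b 0) c \<in> IP"
      using proportional_fr_IP[OF c zero_notin_P, of 1] by simp
    then show "x \<in> ?r" using c by (auto simp: x fr_in_L zero_notin_P proportional_def)
  qed
  ultimately have "loc_congruence type_monoid P (induced_congruence I) \<subseteq> ?r"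
    unfolding loc_congruence_def congruence_gen_def by blast
  then show ?thesis using assms by blast
qed

lemma equiv_loc_congruence: "equiv (carrier L) (loc_congruence type_monoid P (induced_congruence I))"
proof -
  let ?S = "{(loc_map type_monoid P a, loc_map type_monoid P b) | a b. (a, b) \<in> induced_congruence I}"
  let ?F = "{r. monoid_congruence L r \<and> ?S \<subseteq> r}"
  interpret L: comm_monoid L by (rule comm_monoid_L)
  \<comment> \<open>The total relation makes the intersected family nonempty and confines the
    intersection to the carrier.\<close>
  have "monoid_congruence L (carrier L \<times> carrier L)"
    unfolding monoid_congruence_def by (auto intro!: equivI refl_onI symI transI)
  moreover have "?S \<subseteq> carrier L \<times> carrier L" by (auto simp: loc_map_eq fr_in_L zero_notin_P)
  ultimately have top: "carrier L \<times> carrier L \<in> ?F" by blast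
  have eq: "equiv (carrier L) r" if "r \<in> ?F" for r using that by (auto simp: monoid_congruence_def)
  show ?thesis unfolding loc_congruence_def congruence_gen_def
  proof (rule equivI)
    show "\<Inter>?F \<subseteq> carrier L \<times> carrier L" using top by blast
    show "refl_on (carrier L) (\<Inter>?F)"
      by (rule refl_onI) (use eq in \<open>auto simp: equiv_def refl_on_def\<close>)
    show "sym (\<Inter>?F)"
      by (rule symI) (use eq in \<open>auto simp: equiv_def dest: symD\<close>)
    show "trans (\<Inter>?F)"
      by (rule transI) (use eq in \<open>auto simp: equiv_def dest: transD\<close>)
  qed
qed

end

context mesoprimary_binomial
begin

subsection \<open>The orthogonal complement of the cogenerator\<close>

text \<open>The preimage in the localized algebra of the orthogonal complement. The functional with
  indices \<open>w + r\<close> and \<open>s\<close> reads the coefficient at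
  \<open>w + (r - s)\<close>, and \<open>r - s\<close> runs through the unit group.\<close>

definition perp_rep :: "(('q \<times> 'q) set \<Rightarrow>\<^sub>0 'k) set" where
  "perp_rep = {x \<in> carrier A. \<forall>r s. r \<notin> P \<longrightarrow> s \<notin> P \<longrightarrow> \<Lambda> (w + r) s x = 0}"

text \<open>The elements of \<open>Q\<^sub>P\<close> congruent to an element of \<open>G\<^sub>P + w\<close>.\<close>

definition unit_degrees :: "('q \<times> 'q) set set" where
  "unit_degrees = {q \<in> carrier L. \<exists>r s. r \<notin> P \<and> s \<notin> P \<and> cf (w + r) s q \<noteq> 0}"

lemma perp_rep_in_A: "x \<in> perp_rep \<Longrightarrow> x \<in> carrier A"
  by (simp add: perp_rep_def)

lemma perp_rep_add: "x \<in> perp_rep \<Longrightarrow> y \<in> perp_rep \<Longrightarrow> x + y \<in> perp_rep"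
  by (simp add: perp_rep_def add_in_A \<Lambda>_add)

lemma perp_rep_diff: "x \<in> perp_rep \<Longrightarrow> y \<in> perp_rep \<Longrightarrow> x - y \<in> perp_rep"
  by (simp add: perp_rep_def diff_in_A \<Lambda>_diff)

lemma IP_perp_rep: "x \<in> IP \<Longrightarrow> x \<in> perp_rep"
  using \<Lambda>_IP w_add_notin IP_in_A by (simp add: perp_rep_def)

lemma perp_rep_outside:
  assumes "Poly_Mapping.keys x \<subseteq> carrier L - unit_degrees"
  shows "x \<in> perp_rep"
proof -
  have "\<Lambda> (w + r) s x = 0" if "r \<notin> P" "s \<notin> P" for r s
    unfolding \<Lambda>_def linext_def using assms that by (intro sum.neutral) (auto simp: unit_degrees_def)
  then show ?thesis using assms by (auto simp: perp_rep_def carrier_A)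
qed

lemma unit_degree_IP:
  assumes "q \<in> carrier L" "r \<notin> P" "s \<notin> P"  "cf (w + r) s q \<noteq> 0"
  shows "Poly_Mapping.single q x - Poly_Mapping.single (fr (w + r) s) (x * cf (w + r) s q) \<in> IP"
proof -
  obtain a t where q: "t \<notin> P" "q = fr a t" using assms(1) carrier_L by blast
  have cf: "cf (w + r) s q = coef (a + s) (w + r + t)"
    using cf_fr[OF q(1) w_add_notin[OF assms(2)]] q(2) by simp
  have "Poly_Mapping.single (fr (a + s) (t + s)) x - Poly_Mapping.single (fr (w + r + t) (t + s)) (x * cf (w + r) s q) \<in> IP"
    using proportional_coef assms(4) cf notin_P_add[OF q(1) assms(3)]
    by (intro proportional_fr_IP) simp_all
  moreover have "fr (a + s) (t + s) = q" using q assms(3) by (simp add: fr_cancel)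
  moreover have "fr (w + r + t) (t + s) = fr (w + r) s"
    using fr_cancel[OF assms(3) q(1), of "w + r"] by (simp add: add.commute)
  ultimately show ?thesis by simp
qed

text \<open>Modulo \<open>I\<^sub>P\<close> the monomials of one class are proportional to each other, so a combination
  whose coefficients all vanish is removed class by class.\<close>

lemma perp_rep_unit_degrees_IP:
  assumes "x \<in> perp_rep" "Poly_Mapping.keys x \<subseteq> unit_degrees"
  shows "x \<in> IP"
  using assms
proof (induction "card (Poly_Mapping.keys x)" arbitrary: x rule: less_induct)
  case less
  show ?case
  proof (cases "x = 0")
    case False
    then obtain q0 where q0: "q0 \<in> Poly_Mapping.keys x" by (metis all_not_in_conv keys_eq_empty)
    then obtain r s where rs: "r \<notin> P" "s \<notin> P" "cf (w + r) s q0 \<noteq> 0"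
      using less.prems(2) by (auto simp: unit_degrees_def)
    let ?c = "cf (w + r) s" and ?l = "Poly_Mapping.lookup x"
    let ?B = "{q \<in> Poly_Mapping.keys x. ?c q \<noteq> 0}" and ?B' = "{q \<in> Poly_Mapping.keys x. ?c q = 0}"
    define y where "y = (\<Sum>q\<in>?B. Poly_Mapping.single q (?l q))"
    define z where "z = (\<Sum>q\<in>?B'. Poly_Mapping.single q (?l q))"
    have "x = (\<Sum>q\<in>?B \<union> ?B'. Poly_Mapping.single q (?l q))"
      by (subst poly_mapping_eq_sum_single) (auto intro!: sum.cong)
    also have "\<dots> = y + z" unfolding y_def z_def by (rule sum.union_disjoint) auto
    finally have xyz: "x = y + z" .
    have "(\<Sum>q\<in>?B. Poly_Mapping.single q (?l q) - Poly_Mapping.single (fr (w + r) s) (?l q * ?c q)) \<in> IP"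
      using less.prems(2) rs by (intro IP_sum unit_degree_IP) (auto simp: unit_degrees_def)
    also have "(\<Sum>q\<in>?B. Poly_Mapping.single q (?l q) - Poly_Mapping.single (fr (w + r) s) (?l q * ?c q))
        = y - Poly_Mapping.single (fr (w + r) s) (\<Sum>q\<in>?B. ?l q * ?c q)"
    proof -
      have "(\<Sum>q\<in>B. Poly_Mapping.single (fr (w + r) s) (?l q * ?c q))
          = Poly_Mapping.single (fr (w + r) s) (\<Sum>q\<in>B. ?l q * ?c q)" for B
        by (induction B rule: infinite_finite_induct) (simp_all add: single_add)
      then show ?thesis by (simp add: sum_subtractf y_def)
    qed
    also have "(\<Sum>q\<in>?B. ?l q * ?c q) = \<Lambda> (w + r) s x"
      unfolding \<Lambda>_def linext_def by (rule sum.mono_neutral_left) auto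
    also have "\<dots> = 0" using less.prems(1) rs by (simp add: perp_rep_def)
    finally have y: "y \<in> IP" by simp
    have z: "z \<in> perp_rep" using perp_rep_diff[OF less.prems(1) IP_perp_rep[OF y]] xyz by simp
    have keys: "Poly_Mapping.keys z \<subseteq> ?B'"
      unfolding z_def by (rule order_trans[OF keys_sum]) auto
    have "card (Poly_Mapping.keys z) < card (Poly_Mapping.keys x)"
      by (rule psubset_card_mono) (use keys q0 rs(3) in auto)
    then have "z \<in> IP" using less.hyps[OF _ z] keys less.prems(2) by blast
    then show ?thesis using IP_add[OF y] xyz by simp
  qed (simp add: IP_zero)
qed

definition restrict_keys :: "('q \<times> 'q) set set \<Rightarrow> (('q \<times> 'q) set \<Rightarrow>\<^sub>0 'k) \<Rightarrow> (('q \<times> 'q) set \<Rightarrow>\<^sub>0 'k)" where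
  "restrict_keys B x = (\<Sum>q\<in>Poly_Mapping.keys x \<inter> B. Poly_Mapping.single q (Poly_Mapping.lookup x q))"

lemma lookup_restrict_keys: "Poly_Mapping.lookup (restrict_keys B x) q = (if q \<in> B then Poly_Mapping.lookup x q else 0)"
  unfolding restrict_keys_def by (simp add: lookup_sum lookup_single when_def in_keys_iff)

lemma keys_restrict_keys: "Poly_Mapping.keys (restrict_keys B x) = Poly_Mapping.keys x \<inter> B"
  by (auto simp: in_keys_iff lookup_restrict_keys split: if_splits)

lemma restrict_keys_split: "x = restrict_keys B x + restrict_keys (- B) x"
  by (rule poly_mapping_eqI) (simp add: lookup_add lookup_restrict_keys)

lemma perp_rep_split:
  assumes "x \<in> perp_rep"
  shows "restrict_keys unit_degrees x \<in> IP"
proof (rule perp_rep_unit_degrees_IP)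
  have "restrict_keys (- unit_degrees) x \<in> perp_rep"
    using assms by (intro perp_rep_outside) (auto simp: keys_restrict_keys perp_rep_def carrier_A)
  from perp_rep_diff[OF assms this] show "restrict_keys unit_degrees x \<in> perp_rep"
    using restrict_keys_split[of x unit_degrees] by (metis add_diff_cancel_right')
qed (simp add: keys_restrict_keys)

definition perp_image :: "(('q \<times> 'q) set \<Rightarrow>\<^sub>0 'k) set set" where
  "perp_image = proj ` perp_rep"

lemma proj_perp_image_iff: "x \<in> carrier A \<Longrightarrow> proj x \<in> perp_image \<longleftrightarrow> x \<in> perp_rep"
proof
  assume x: "x \<in> carrier A" and "proj x \<in> perp_image"
  then obtain y where y: "y \<in> perp_rep" "proj x = proj y" by (auto simp: perp_image_def)
  then have "x - y \<in> IP" using proj_eq_iff[OF x] perp_rep_in_A by blast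
  then have "(x - y) + y \<in> perp_rep" using perp_rep_add IP_perp_rep y(1) by blast
  then show "x \<in> perp_rep" by simp
qed (simp add: perp_image_def)

abbreviation wL :: "('q \<times> 'q) set \<Rightarrow>\<^sub>0 'k" where
  "wL \<equiv> monomial (fr w 0)"

lemma unit_span_eq: "unit_span P I w = {proj (g \<otimes>\<^bsub>A\<^esub> wL) | g. Poly_Mapping.keys g \<subseteq> Units L}"
proof -
  have "proj g \<otimes>\<^bsub>R\<^esub> proj wL = proj (g \<otimes>\<^bsub>A\<^esub> wL)" if "Poly_Mapping.keys g \<subseteq> Units L" for g
  proof -
    have "g \<in> carrier A" using that by (auto simp: carrier_A Units_def)
    moreover have "wL \<in> carrier A" by (simp add: single_in_A fr_in_L zero_notin_P)
    ultimately show ?thesis by (rule proj_mult[symmetric])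
  qed
  then show ?thesis unfolding unit_span_def loc_alg_map_single by auto
qed

lemma wL_in_A: "wL \<in> carrier A"
  by (simp add: single_in_A fr_in_L zero_notin_P)

lemma fr_unit_degrees:
  assumes "r \<notin> P" "s \<notin> P"
  shows "fr (w + r) s \<in> unit_degrees"
proof -
  have "cf (w + r) s (fr (w + r) s) = 1"
    using cf_fr[OF assms(2) w_add_notin[OF assms(1)]] coef_self[OF w_add_notin[OF notin_P_add[OF assms]]]
    by (simp add: add.assoc)
  then show ?thesis using assms fr_in_L unfolding unit_degrees_def
    by (intro CollectI conjI exI[of _ r] exI[of _ s]) simp_all
qed

lemma keys_unit_mult:
  assumes "Poly_Mapping.keys g \<subseteq> Units L"
  shows "Poly_Mapping.keys (g \<otimes>\<^bsub>A\<^esub> wL) \<subseteq> unit_degrees"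
  using assms
proof (induction g rule: poly_mapping_induct_keys)
  case (single u c)
  then obtain r s where u: "r \<notin> P" "s \<notin> P" "u = fr r s" using Units_L by blast
  then have "u \<otimes>\<^bsub>L\<^esub> fr w 0 = fr (w + r) s" using zero_notin_P by (simp add: fr_mult add.commute)
  then show ?case using fr_unit_degrees u by (simp add: mult_single_A)
next
  case (add f g)
  then have "f \<in> carrier A" "g \<in> carrier A" by (auto simp: carrier_A Units_def)
  then show ?case using add keys_add[of "f \<otimes>\<^bsub>A\<^esub> wL" "g \<otimes>\<^bsub>A\<^esub> wL"] by (auto simp: distrib_A wL_in_A)
qed (simp add: mult_zero_A)

lemma ex_unit_mult:
  assumes "Poly_Mapping.keys x \<subseteq> unit_degrees"
  shows "\<exists>g. Poly_Mapping.keys g \<subseteq> Units L \<and> x - g \<otimes>\<^bsub>A\<^esub> wL \<in> IP"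
  using assms
proof (induction x rule: poly_mapping_induct_keys)
  case zero
  then show ?case by (intro exI[of _ 0]) (simp add: mult_zero_A IP_zero)
next
  case (single q c)
  then obtain r s where rs: "q \<in> carrier L" "r \<notin> P" "s \<notin> P" "cf (w + r) s q \<noteq> 0" by (auto simp: unit_degrees_def)
  have "fr r s \<otimes>\<^bsub>L\<^esub> fr w 0 = fr (w + r) s" using rs zero_notin_P by (simp add: fr_mult add.commute)
  moreover have "fr r s \<in> Units L" using Units_L rs by blast
  ultimately show ?case using unit_degree_IP[OF rs]
    by (intro exI[of _ "Poly_Mapping.single (fr r s) (c * cf (w + r) s q)"]) (simp add: mult_single_A)
next
  case (add x y)
  then obtain g h where g: "Poly_Mapping.keys g \<subseteq> Units L" "x - g \<otimes>\<^bsub>A\<^esub> wL \<in> IP"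
    and h: "Poly_Mapping.keys h \<subseteq> Units L" "y - h \<otimes>\<^bsub>A\<^esub> wL \<in> IP" by blast
  have "g \<in> carrier A" "h \<in> carrier A" using g h by (auto simp: carrier_A Units_def)
  then have "(x + y) - (g + h) \<otimes>\<^bsub>A\<^esub> wL = (x - g \<otimes>\<^bsub>A\<^esub> wL) + (y - h \<otimes>\<^bsub>A\<^esub> wL)"
    by (simp add: distrib_A wL_in_A)
  then have "(x + y) - (g + h) \<otimes>\<^bsub>A\<^esub> wL \<in> IP" using IP_add[OF g(2) h(2)] by (simp only:)
  moreover have "Poly_Mapping.keys (g + h) \<subseteq> Units L" using g(1) h(1) keys_add[of g h] by blast
  ultimately show ?case by (intro exI[of _ "g + h"] conjI)
qed

lemma unit_span_proj:
  assumes "Poly_Mapping.keys x \<subseteq> unit_degrees"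
  shows "proj x \<in> unit_span P I w"
proof -
  obtain g where g: "Poly_Mapping.keys g \<subseteq> Units L" "x - g \<otimes>\<^bsub>A\<^esub> wL \<in> IP" using ex_unit_mult[OF assms] by blast
  have "x \<in> carrier A" using assms by (auto simp: carrier_A unit_degrees_def)
  moreover have "g \<otimes>\<^bsub>A\<^esub> wL \<in> carrier A" using keys_unit_mult[OF g(1)] by (auto simp: carrier_A unit_degrees_def)
  ultimately have "proj x = proj (g \<otimes>\<^bsub>A\<^esub> wL)" using g(2) proj_eq_iff by blast
  then show ?thesis using g(1) unfolding unit_span_eq by blast
qed

lemma unit_span_in_R: "unit_span P I w \<subseteq> carrier R"
  unfolding unit_span_eq using keys_unit_mult proj_in_R by (fastforce simp: carrier_A unit_degrees_def)

lemma perp_image_in_R: "perp_image \<subseteq> carrier R"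
  unfolding perp_image_def using perp_rep_in_A proj_in_R by blast

lemma unit_span_inter_perp: "unit_span P I w \<inter> perp_image = {\<zero>\<^bsub>R\<^esub>}"
proof (intro equalityI subsetI)
  fix v assume v: "v \<in> unit_span P I w \<inter> perp_image"
  then obtain g where g: "Poly_Mapping.keys g \<subseteq> Units L" "v = proj (g \<otimes>\<^bsub>A\<^esub> wL)" unfolding unit_span_eq by blast
  have gA: "g \<otimes>\<^bsub>A\<^esub> wL \<in> carrier A" using keys_unit_mult[OF g(1)] by (auto simp: carrier_A unit_degrees_def)
  then have "g \<otimes>\<^bsub>A\<^esub> wL \<in> perp_rep" using v g(2) proj_perp_image_iff by blast
  then have "g \<otimes>\<^bsub>A\<^esub> wL \<in> IP" using perp_rep_unit_degrees_IP keys_unit_mult[OF g(1)] by blast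
  then show "v \<in> {\<zero>\<^bsub>R\<^esub>}" using g(2) proj_zero_iff[OF gA] by simp
next
  fix v assume "v \<in> {\<zero>\<^bsub>R\<^esub>}"
  then have "v = proj 0" by (simp add: zero_R)
  moreover have "proj 0 \<in> unit_span P I w" by (rule unit_span_proj) simp
  ultimately show "v \<in> unit_span P I w \<inter> perp_image"
    using IP_perp_rep[OF IP_zero] by (simp add: perp_image_def)
qed

lemma unit_span_plus_perp: "unit_span P I w <+>\<^bsub>R\<^esub> perp_image = carrier R"
proof (intro equalityI subsetI)
  interpret R: cring R by (rule cring_R)
  fix v assume "v \<in> unit_span P I w <+>\<^bsub>R\<^esub> perp_image"
  then show "v \<in> carrier R" using unit_span_in_R perp_image_in_R by (auto simp: set_add_def')
next
  fix v assume "v \<in> carrier R"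
  then obtain x where x: "x \<in> carrier A" "v = proj x" using carrier_R by blast
  let ?y = "restrict_keys unit_degrees x" and ?z = "restrict_keys (- unit_degrees) x"
  have z: "?z \<in> perp_rep" using x(1) by (intro perp_rep_outside) (auto simp: keys_restrict_keys carrier_A)
  have y: "?y \<in> carrier A" using x(1) by (auto simp: keys_restrict_keys carrier_A)
  have "v = proj ?y \<oplus>\<^bsub>R\<^esub> proj ?z"
    using proj_add[OF y perp_rep_in_A[OF z]] x(2) restrict_keys_split[of x unit_degrees] by simp
  moreover have "proj ?y \<in> unit_span P I w" by (rule unit_span_proj) (simp add: keys_restrict_keys)
  moreover have "proj ?z \<in> perp_image" using z by (simp add: perp_image_def)
  ultimately show "v \<in> unit_span P I w <+>\<^bsub>R\<^esub> perp_image" by (auto simp: set_add_def')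
qed

lemma perp_rep_scale:
  assumes "x \<in> perp_rep"
  shows "Poly_Mapping.single \<one>\<^bsub>L\<^esub> c \<otimes>\<^bsub>A\<^esub> x \<in> perp_rep"
proof -
  interpret A: cring A by (rule cring_A)
  have x: "x \<in> carrier A" using assms by (rule perp_rep_in_A)
  have s: "Poly_Mapping.single (fr 0 0) c \<in> carrier A" by (simp add: single_in_A fr_in_L zero_notin_P)
  have "\<Lambda> (w + r) t (x \<otimes>\<^bsub>A\<^esub> Poly_Mapping.single (fr 0 0) c) = c * \<Lambda> (w + r + 0) (t + 0) x" if "r \<notin> P" for r t
    by (rule \<Lambda>_mult_single[OF x zero_notin_P w_add_notin[OF that]])
  then show ?thesis using assms A.m_comm[OF x s] A.m_closed[OF x s] by (simp add: perp_rep_def one_L)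
qed

lemma additive_subgroup_perp: "additive_subgroup perp_image R"
proof (rule additive_subgroup.intro)
  interpret R: cring R by (rule cring_R)
  show "subgroup perp_image (add_monoid R)"
  proof (rule R.add.subgroupI)
    show "perp_image \<subseteq> carrier R" by (rule perp_image_in_R)
    show "perp_image \<noteq> {}" using IP_perp_rep[OF IP_zero] by (auto simp: perp_image_def)
    fix v assume "v \<in> perp_image"
    then obtain x where x: "x \<in> perp_rep" "v = proj x" by (auto simp: perp_image_def)
    have y: "0 - x \<in> perp_rep" by (rule perp_rep_diff[OF IP_perp_rep[OF IP_zero] x(1)])
    have "proj (0 - x) \<oplus>\<^bsub>R\<^esub> v = \<zero>\<^bsub>R\<^esub>"
      using proj_add[OF perp_rep_in_A[OF y] perp_rep_in_A[OF x(1)]] x(2) by (simp add: zero_R)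
    then have "\<ominus>\<^bsub>R\<^esub> v = proj (0 - x)"
      using R.minus_equality proj_in_R perp_rep_in_A x y by blast
    then show "\<ominus>\<^bsub>R\<^esub> v \<in> perp_image" using y by (simp add: perp_image_def)
  next
    fix v v' assume "v \<in> perp_image" "v' \<in> perp_image"
    then obtain x y where "x \<in> perp_rep" "v = proj x" "y \<in> perp_rep" "v' = proj y" by (auto simp: perp_image_def)
    then show "v \<oplus>\<^bsub>R\<^esub> v' \<in> perp_image"
      using proj_add[OF perp_rep_in_A perp_rep_in_A] perp_rep_add by (metis perp_image_def imageI)
  qed
qed

lemma carrier_loc_quot:
  "carrier (loc_quot type_monoid P (induced_congruence I)) = carrier L // loc_congruence type_monoid P (induced_congruence I)"
  by (simp add: loc_quot_def quot_monoid_def)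

lemma graded_perp: "RP_graded_subspace P I perp_image"
  unfolding RP_graded_subspace_def RP_subspace_def
proof (intro conjI allI ballI)
  show "additive_subgroup perp_image R" by (rule additive_subgroup_perp)
next
  fix c v assume "v \<in> perp_image"
  then obtain x where x: "x \<in> perp_rep" "v = proj x" by (auto simp: perp_image_def)
  have "Poly_Mapping.single \<one>\<^bsub>L\<^esub> c \<in> carrier A" by (simp add: one_L single_in_A fr_in_L zero_notin_P)
  then show "proj (Poly_Mapping.single \<one>\<^bsub>L\<^esub> c) \<otimes>\<^bsub>R\<^esub> v \<in> perp_image"
    using perp_rep_scale[OF x(1), of c] perp_rep_in_A[OF x(1)] by (simp add: x(2) perp_image_def flip: proj_mult)
next
  fix v assume "v \<in> perp_image"
  then obtain x' where x': "x' \<in> perp_rep" "v = proj x'" by (auto simp: perp_image_def)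
  define x where "x = restrict_keys (- unit_degrees) x'"
  have keys: "Poly_Mapping.keys x \<subseteq> carrier L - unit_degrees"
    using perp_rep_in_A[OF x'(1)] by (auto simp: x_def keys_restrict_keys carrier_A)
  have x: "x \<in> perp_rep" using keys by (rule perp_rep_outside)
  have "x' - x = restrict_keys unit_degrees x'"
    using restrict_keys_split[of x' unit_degrees] by (metis add_diff_cancel_right' x_def)
  then have "x' - x \<in> IP" using perp_rep_split[OF x'(1)] by simp
  then have v: "v = proj x" using x'(2) proj_eq_iff[OF perp_rep_in_A[OF x'(1)] perp_rep_in_A[OF x]] by simp
  let ?C = "loc_congruence type_monoid P (induced_congruence I)"
  let ?D = "(\<lambda>q. ?C `` {q}) ` Poly_Mapping.keys x"
  have fin: "finite ?D" by simp
  have D: "?D \<subseteq> carrier L // ?C" using keys by (auto intro: quotientI)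
  have parts: "restrict_keys d x \<in> perp_rep" for d
    using keys by (intro perp_rep_outside) (auto simp: keys_restrict_keys)
  have "x = (\<Sum>d\<in>?D. restrict_keys d x)"
  proof (rule poly_mapping_eqI)
    fix q
    show "Poly_Mapping.lookup x q = Poly_Mapping.lookup (\<Sum>d\<in>?D. restrict_keys d x) q"
    proof (cases "q \<in> Poly_Mapping.keys x")
      case True
      have q: "q \<in> ?C `` {q}" using True keys by (intro equiv_class_self[OF equiv_loc_congruence]) blast
      have uniq: "d = ?C `` {q}" if dq: "d \<in> ?D" "q \<in> d" for d
      proof -
        obtain q' where q': "d = ?C `` {q'}" using dq(1) by blast
        then have "(q', q) \<in> ?C" using dq(2) by simp
        then show ?thesis using q' equiv_class_eq[OF equiv_loc_congruence] by simp
      qed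
      have "(\<Sum>d\<in>?D. if q \<in> d then Poly_Mapping.lookup x q else 0)
          = (\<Sum>d\<in>{?C `` {q}}. if q \<in> d then Poly_Mapping.lookup x q else 0)"
      proof (rule sum.mono_neutral_right)
        show "\<forall>d\<in>?D - {?C `` {q}}. (if q \<in> d then Poly_Mapping.lookup x q else 0) = 0"
        proof
          fix d assume "d \<in> ?D - {?C `` {q}}"
          then have "q \<notin> d" using uniq by blast
          then show "(if q \<in> d then Poly_Mapping.lookup x q else 0) = 0" by simp
        qed
        show "{?C `` {q}} \<subseteq> ?D" using True by blast
      qed simp
      then show ?thesis using q by (simp add: lookup_sum lookup_restrict_keys)
    next
      case False
      then have zero: "Poly_Mapping.lookup x q = 0" by (simp add: in_keys_iff)
      have "(\<Sum>d\<in>?D. Poly_Mapping.lookup (restrict_keys d x) q) = 0"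
        by (rule sum.neutral) (simp add: lookup_restrict_keys zero)
      then show ?thesis by (simp add: lookup_sum zero)
    qed
  qed
  moreover have "finsum R (\<lambda>d. proj (restrict_keys d x)) ?D = proj (\<Sum>d\<in>?D. restrict_keys d x)"
    using finsum_proj[OF fin, of "\<lambda>d. restrict_keys d x"] perp_rep_in_A parts by blast
  ultimately have "v = finsum R (\<lambda>d. proj (restrict_keys d x)) ?D" using v by simp
  moreover have "proj (restrict_keys d x) \<in> perp_image \<inter> RP_component P I d" for d
    using parts by (auto simp: perp_image_def RP_component_def keys_restrict_keys)
  ultimately show "\<exists>D u. finite D \<and> D \<subseteq> carrier (loc_quot type_monoid P (induced_congruence I)) \<and>
        (\<forall>d\<in>D. u d \<in> perp_image \<inter> RP_component P I d) \<and> v = finsum R u D"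
    using fin D unfolding carrier_loc_quot
    by (intro exI[of _ ?D] exI[of _ "\<lambda>d. proj (restrict_keys d x)"] conjI ballI)
qed

text \<open>Congruent degrees have proportional monomials modulo \<open>IP\<close>, and every
  functional at a class \<open>w + r\<close> vanishes on \<open>IP\<close>.\<close>

lemma unit_degrees_class:
  assumes "d \<in> carrier L // loc_congruence type_monoid P (induced_congruence I)" "q \<in> d" "q' \<in> d" "q \<in> unit_degrees"
  shows "q' \<in> unit_degrees"
proof -
  have qq: "(q, q') \<in> loc_congruence type_monoid P (induced_congruence I)"
    using assms(1-3) equiv_loc_congruence by (meson quotient_eq_iff equiv_class_eq_iff in_quotient_imp_closed)
  then have q': "q' \<in> carrier L" using equiv_loc_congruence by (auto simp: equiv_def)
  obtain c where c: "c \<noteq> 0" "monomial q - Poly_Mapping.single q' c \<in> IP"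
    using loc_congruence_proportional[OF qq] by blast
  obtain r s where rs: "r \<notin> P" "s \<notin> P" "cf (w + r) s q \<noteq> 0" using assms(4) by (auto simp: unit_degrees_def)
  have "\<Lambda> (w + r) s (monomial q - Poly_Mapping.single q' c) = 0" using \<Lambda>_IP[OF w_add_notin[OF rs(1)] c(2)] .
  then have "cf (w + r) s q = c * cf (w + r) s q'" by (simp add: \<Lambda>_diff \<Lambda>_single)
  then show ?thesis using rs q' by (auto simp: unit_degrees_def)
qed

text \<open>For uniqueness, take a homogeneous element of a competing complement \<open>V\<close>.
  Its class either avoids the unit degrees, and the element lies in \<open>perp_image\<close>, or
  consists of unit degrees, and the element lies in \<open>unit_span\<close> and in
  \<open>V\<close>, so it is zero.\<close>

lemma perp_eq: "perp P I w = perp_image"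
  unfolding perp_def
proof (rule the_equality)
  show "RP_graded_subspace P I perp_image \<and> unit_span P I w \<inter> perp_image = {\<zero>\<^bsub>R\<^esub>} \<and>
      unit_span P I w <+>\<^bsub>R\<^esub> perp_image = carrier R"
    using graded_perp unit_span_inter_perp unit_span_plus_perp by blast
next
  interpret R: cring R by (rule cring_R)
  interpret V0: additive_subgroup perp_image R by (rule additive_subgroup_perp)
  fix V assume V: "RP_graded_subspace P I V \<and> unit_span P I w \<inter> V = {\<zero>\<^bsub>R\<^esub>} \<and>
      unit_span P I w <+>\<^bsub>R\<^esub> V = carrier R"
  have sub: "V \<subseteq> perp_image"
  proof
    fix v assume "v \<in> V"
    have "RP_graded_subspace P I V" using V by (rule conjunct1)
    from this[unfolded RP_graded_subspace_def carrier_loc_quot, THEN conjunct2, rule_format, OF \<open>v \<in> V\<close>]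
    obtain D u where Du: "finite D \<and> D \<subseteq> carrier L // loc_congruence type_monoid P (induced_congruence I) \<and>
        (\<forall>d\<in>D. u d \<in> V \<inter> RP_component P I d) \<and> v = finsum R u D"
      by (elim exE)
    note D = Du[THEN conjunct1] Du[THEN conjunct2, THEN conjunct1]
      Du[THEN conjunct2, THEN conjunct2, THEN conjunct1, rule_format]
      Du[THEN conjunct2, THEN conjunct2, THEN conjunct2]
    have "u d \<in> perp_image" if d: "d \<in> D" for d
    proof -
      obtain f where f: "Poly_Mapping.keys f \<subseteq> d" "u d = proj f" using D(3)[OF d] by (auto simp: RP_component_def)
      have dL: "d \<subseteq> carrier L" using D(2) d equiv_loc_congruence by (meson in_quotient_imp_subset subsetD)
      show ?thesis
      proof (cases "d \<inter> unit_degrees = {}")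
        case True
        then have "f \<in> perp_rep" using f(1) dL by (intro perp_rep_outside) blast
        then show ?thesis using f(2) by (simp add: perp_image_def)
      next
        case False
        then have "d \<subseteq> unit_degrees" using unit_degrees_class D(2) d by blast
        then have "u d \<in> unit_span P I w" unfolding f(2) using f(1) by (intro unit_span_proj) blast
        then have "u d \<in> unit_span P I w \<inter> V" using D(3)[OF d] by blast
        then have "u d = \<zero>\<^bsub>R\<^esub>" using V by simp
        then show ?thesis by simp
      qed
    qed
    with D(1) have "finsum R u D \<in> perp_image"
    proof (induction D rule: finite_induct)
      case (insert d D)
      then have "finsum R u (insert d D) = u d \<oplus>\<^bsub>R\<^esub> finsum R u D"
        using perp_image_in_R by (intro R.finsum_insert) auto
      then show ?case using insert by simp
    qed simp
    then show "v \<in> perp_image" using D(4) by simp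
  qed
  \<comment> \<open>Of two complements of the same subspace, one contained in the other equals
    it.\<close>
  moreover have "perp_image \<subseteq> V"
  proof
    fix v assume v: "v \<in> perp_image"
    then have "v \<in> unit_span P I w <+>\<^bsub>R\<^esub> V" using V perp_image_in_R by blast
    then obtain a v' where a: "a \<in> unit_span P I w" "v' \<in> V" "v = a \<oplus>\<^bsub>R\<^esub> v'" by (auto simp: set_add_def')
    have v': "v' \<in> perp_image" using a(2) sub by blast
    have car: "a \<in> carrier R" "v' \<in> carrier R" using a(1) unit_span_in_R v' perp_image_in_R by blast+
    have "a = v \<oplus>\<^bsub>R\<^esub> (\<ominus>\<^bsub>R\<^esub> v')" using car by (simp add: a(3) R.a_assoc R.r_neg)
    then have "a \<in> perp_image" using v v' by simp
    then have "a = \<zero>\<^bsub>R\<^esub>" using a(1) unit_span_inter_perp by blast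
    then show "v \<in> V" using a(2,3) car by simp
  qed
  ultimately show "V = perp_image" by (rule equalityI)
qed

lemma ideal_perp_core: "ideal {v \<in> carrier R. \<forall>y\<in>carrier R. v \<otimes>\<^bsub>R\<^esub> y \<in> perp_image} R" (is "ideal ?W R")
proof (rule idealI)
  interpret R: cring R by (rule cring_R)
  interpret V0: additive_subgroup perp_image R by (rule additive_subgroup_perp)
  show "ring R" by (rule R.ring_axioms)
  have W: "v \<in> ?W \<longleftrightarrow> v \<in> carrier R \<and> (\<forall>y\<in>carrier R. v \<otimes>\<^bsub>R\<^esub> y \<in> perp_image)" for v by simp
  show "subgroup ?W (add_monoid R)"
  proof (rule R.add.subgroupI)
    have "\<zero>\<^bsub>R\<^esub> \<in> ?W" by (simp add: W)
    then show "?W \<noteq> {}" by blast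
  qed (simp_all add: R.l_distr R.l_minus)
  show "a \<otimes>\<^bsub>R\<^esub> x \<in> ?W" if "a \<in> ?W" "x \<in> carrier R" for a x
    using that by (simp add: R.m_assoc)
  then show "x \<otimes>\<^bsub>R\<^esub> a \<in> ?W" if "a \<in> ?W" "x \<in> carrier R" for a x
    using that R.m_comm[of x a] by simp
qed

text \<open>The elements all of whose multiples stay in an additive subgroup form the largest ideal
  inside it.\<close>

lemma perp_inf_eq: "perp_inf P I w = {v \<in> carrier R. \<forall>y\<in>carrier R. v \<otimes>\<^bsub>R\<^esub> y \<in> perp_image}"
  (is "_ = ?W")
  unfolding perp_inf_def perp_eq
proof (rule Greatest_equality)
  interpret R: cring R by (rule cring_R)
  have "?W \<subseteq> perp_image"
  proof
    fix v assume "v \<in> ?W"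
    then have "v \<in> carrier R" "v \<otimes>\<^bsub>R\<^esub> \<one>\<^bsub>R\<^esub> \<in> perp_image" using R.one_closed by blast+
    then show "v \<in> perp_image" by simp
  qed
  then show "ideal ?W R \<and> ?W \<subseteq> perp_image" using ideal_perp_core by blast
  fix J assume J: "ideal J R \<and> J \<subseteq> perp_image"
  then interpret J: ideal J R by blast
  show "J \<subseteq> ?W" using J J.I_r_closed J.a_subset by blast
qed

lemma ideal_perp_inf: "ideal (perp_inf P I w) R"
  unfolding perp_inf_eq by (rule ideal_perp_core)

text \<open>Multiplication by the monomial of \<open>s - r\<close> turns the coefficient at
  \<open>w\<close> into that of \<open>t^s x\<close> at \<open>w + r\<close>. Allowing all multiples
  therefore lifts the restriction of \<open>s\<close> to the complement of \<open>P\<close>.\<close>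

lemma perp_rep_mult_iff:
  assumes "x \<in> carrier A"
  shows "(\<forall>y\<in>carrier A. x \<otimes>\<^bsub>A\<^esub> y \<in> perp_rep) \<longleftrightarrow> (\<forall>r s. r \<notin> P \<longrightarrow> \<Lambda> (w + r) s x = 0)"
proof (intro iffI allI impI ballI)
  fix r s assume *: "\<forall>y\<in>carrier A. x \<otimes>\<^bsub>A\<^esub> y \<in> perp_rep" and r: "r \<notin> P"
  have "x \<otimes>\<^bsub>A\<^esub> monomial (fr s r) \<in> perp_rep" using * r by (simp add: single_in_A fr_in_L)
  then have "\<Lambda> (w + 0) 0 (x \<otimes>\<^bsub>A\<^esub> monomial (fr s r)) = 0" using zero_notin_P unfolding perp_rep_def by blast
  then show "\<Lambda> (w + r) s x = 0" using \<Lambda>_mult_single[OF assms r, of w 0 s 1] w_notin by simp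
next
  interpret A: cring A by (rule cring_A)
  fix y assume *: "\<forall>r s. r \<notin> P \<longrightarrow> \<Lambda> (w + r) s x = 0" and y: "y \<in> carrier A"
  have "\<Lambda> (w + r) s (x \<otimes>\<^bsub>A\<^esub> y) = 0" if r: "r \<notin> P" for r s
    using y[unfolded carrier_A]
  proof (induction y rule: poly_mapping_induct_keys)
    case (single q c)
    then obtain a t where q: "t \<notin> P" "q = fr a t" using carrier_L by blast
    then have "\<Lambda> (w + r) s (x \<otimes>\<^bsub>A\<^esub> Poly_Mapping.single q c) = c * \<Lambda> (w + (r + t)) (s + a) x"
      using \<Lambda>_mult_single[OF assms q(1) w_add_notin[OF r]] by (simp add: add.assoc)
    then show ?case using * notin_P_add[OF r q(1)] by simp
  next
    case (add f g)
    then show ?case using assms by (simp add: distrib_A carrier_A[symmetric] \<Lambda>_add)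
  qed (simp add: mult_zero_A \<Lambda>_zero)
  then show "x \<otimes>\<^bsub>A\<^esub> y \<in> perp_rep" using assms y by (simp add: perp_rep_def)
qed

theorem irr_closure_eq_closure_ideal: "irr_closure P I w = closure_ideal"
proof -
  have "f \<in> irr_closure P I w \<longleftrightarrow> f \<in> closure_ideal" for f
  proof -
    let ?f = "loc_alg_map P f"
    have fA: "?f \<in> carrier A" by (rule loc_alg_map_in_A)
    interpret W: ideal "perp_inf P I w" R by (rule ideal_perp_inf)
    have "f \<in> irr_closure P I w \<longleftrightarrow> perp_inf P I w +>\<^bsub>R\<^esub> proj ?f = perp_inf P I w"
      by (simp add: irr_closure_def a_kernel_def' ring_of_type_algebra_def FactRing_def)
    also have "\<dots> \<longleftrightarrow> proj ?f \<in> perp_inf P I w"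
      using ideal.rcos_const_imp_mem[OF ideal_perp_inf proj_in_R[OF fA]] W.a_rcos_const by blast
    also have "\<dots> \<longleftrightarrow> (\<forall>y\<in>carrier A. proj ?f \<otimes>\<^bsub>R\<^esub> proj y \<in> perp_image)"
      unfolding perp_inf_eq using proj_in_R[OF fA] carrier_R by auto
    also have "\<dots> \<longleftrightarrow> (\<forall>y\<in>carrier A. ?f \<otimes>\<^bsub>A\<^esub> y \<in> perp_rep)"
    proof -
      interpret A: cring A by (rule cring_A)
      have "proj ?f \<otimes>\<^bsub>R\<^esub> proj y \<in> perp_image \<longleftrightarrow> ?f \<otimes>\<^bsub>A\<^esub> y \<in> perp_rep" if "y \<in> carrier A" for y
        using proj_perp_image_iff[OF A.m_closed[OF fA that]] proj_mult[OF fA that] by simp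
      then show ?thesis by blast
    qed
    also have "\<dots> \<longleftrightarrow> (\<forall>r s. r \<notin> P \<longrightarrow> \<Lambda> (w + r) s ?f = 0)" by (rule perp_rep_mult_iff[OF fA])
    also have "\<dots> \<longleftrightarrow> f \<in> closure_ideal"
      using w_add_notin by (auto simp: closure_ideal_def \<Lambda>_loc_alg_map)
    finally show ?thesis .
  qed
  then show ?thesis by blast
qed

end

section \<open>Coprincipal binomial ideals\<close>

lemma quot_type_monoid:
  fixes r :: "'q::comm_monoid_add rel"
  assumes r: "monoid_congruence type_monoid r"
  shows "(r `` {a} = r `` {b}) = ((a, b) \<in> r)"
    and "r `` {a} \<in> carrier (quot_monoid type_monoid r)"
    and "r `` {a} \<otimes>\<^bsub>quot_monoid type_monoid r\<^esub> r `` {b} = r `` {a + b}"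
    and "\<one>\<^bsub>quot_monoid type_monoid r\<^esub> = r `` {0}"
proof -
  have "equiv UNIV r" using r by (simp add: monoid_congruence_def type_monoid_def)
  then show "(r `` {a} = r `` {b}) = ((a, b) \<in> r)" by (simp add: eq_equiv_class_iff)
  show "r `` {a} \<otimes>\<^bsub>quot_monoid type_monoid r\<^esub> r `` {b} = r `` {a + b}"
    using comm_monoid_quot_monoid(2)[OF comm_monoid_type_monoid r, of a b] by (simp add: type_monoid_def)
qed (auto simp: quot_monoid_def type_monoid_def quotient_def)

lemma cancellative_quot_type_monoid:
  assumes r: "monoid_congruence type_monoid r" and "is_cancellative (quot_monoid type_monoid r) (r `` {h})"
    and "(a + h, b + h) \<in> r"
  shows "(a, b) \<in> r"
proof -
  note q = quot_type_monoid[OF r]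
  have "r `` {a} \<otimes>\<^bsub>quot_monoid type_monoid r\<^esub> r `` {h} = r `` {b} \<otimes>\<^bsub>quot_monoid type_monoid r\<^esub> r `` {h}"
    using assms(3) by (simp add: q)
  then have "r `` {a} = r `` {b}" using assms(2) q(2) unfolding is_cancellative_def by blast
  then show ?thesis using q(1) by blast
qed

lemma nil_quot_type_monoid:
  assumes "monoid_congruence type_monoid r" "is_nil (quot_monoid type_monoid r) (r `` {a})"
  shows "(a + b, a) \<in> r"
proof -
  note q = quot_type_monoid[OF assms(1)]
  have "r `` {a} \<otimes>\<^bsub>quot_monoid type_monoid r\<^esub> r `` {b} = r `` {a}"
    using assms(2) q(2) unfolding is_nil_def by blast
  then show ?thesis using q(1)[of "a + b" a] by (simp only: q(3))
qed

lemma pow_quot_type_monoid: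
  assumes "monoid_congruence type_monoid r"
  shows "(r `` {a}) [^]\<^bsub>quot_monoid type_monoid r\<^esub> (n::nat) = r `` {nmult n a}"
proof (induction n)
  case 0
  then show ?case using quot_type_monoid[OF assms] by (simp add: nat_pow_def)
next
  case (Suc n)
  then show ?case using quot_type_monoid(3)[OF assms, of "nmult n a" a] by (simp add: nat_pow_def add.commute)
qed

text \<open>Nil classes of the congruence have to be related to monomials in \<open>I\<close>; the
  cogenerator does this, since \<open>w + p\<close> gives a monomial of \<open>I\<close> for all
  \<open>p\<close> in \<open>P\<close> while \<open>w\<close> does not.\<close>

lemma mesoprimary_binomial_coprincipal:
  assumes "coprincipal_ideal P I" and cog: "cogenerated_by P I w"
  shows "mesoprimary_binomial I P w"
proof -
  let ?r = "induced_congruence I" and ?M = "type_monoid :: 'a monoid"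
  have prime: "monoid_prime ?M P" and meso: "mesoprimary_congruence ?M P ?r" and bin: "binomial_ideal I"
    using assms(1) by (auto simp: coprincipal_ideal_def coprincipal_congruence_def)
  have prim: "primary_congruence ?M P ?r" using meso by (simp add: mesoprimary_congruence_def)
  then have cong: "monoid_congruence ?M ?r" by (simp add: primary_congruence_def)
  note q = quot_type_monoid[OF cong]
  let ?N = "quot_monoid ?M ?r"
  have P_add: "p + a \<in> P" if "p \<in> P" for p a
    using prime that by (auto simp: monoid_prime_def monoid_ideal_def type_monoid_def)
  have canc: "is_cancellative ?N (?r `` {h})" if "h \<notin> P" for h
    using prim that by (auto simp: primary_congruence_def type_monoid_def)
  interpret primary_binomial I P
  proof
    obtain B where B: "B \<subseteq> binomials" "I = genideal type_alg B" using bin by (auto simp: binomial_ideal_def)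
    interpret T: cring "type_alg :: ('a \<Rightarrow>\<^sub>0 'b) ring" by (rule cring_from_type_algebra)
    have car: "carrier (type_alg :: ('a \<Rightarrow>\<^sub>0 'b) ring) = UNIV" by (simp add: ring_of_type_algebra_def)
    show "idl I" unfolding B(2) ideal_type_alg[symmetric] by (rule T.genideal_ideal) (simp add: car)
    show "I \<subseteq> K" if "idl K" "I \<inter> binomials \<subseteq> K" for K
    proof -
      have "B \<subseteq> I" unfolding B(2) by (rule T.genideal_self) (simp add: car)
      then have "B \<subseteq> K" using that(2) B(1) by blast
      then show ?thesis unfolding B(2) using that(1) by (intro T.genideal_minimal) (simp_all add: ideal_type_alg)
    qed
    show "p + a \<in> P" if "p \<in> P" for p a using that by (rule P_add)
    show "0 \<notin> P"
    proof
      assume "0 \<in> P"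
      then have "P = UNIV" using P_add[of 0] by auto
      then show False using prime by (simp add: monoid_prime_def type_monoid_def)
    qed
    show "a \<in> P \<or> b \<in> P" if "a + b \<in> P" for a b
      using prime that submonoid.m_closed[of "UNIV - P" ?M a b] by (auto simp: monoid_prime_def type_monoid_def)
    show "(a, b) \<in> ?r" if "h \<notin> P" "(a + h, b + h) \<in> ?r" for a b h
      using cancellative_quot_type_monoid[OF cong canc] that by blast
  qed
  have w_notin: "monomial w \<notin> I" and w_socle: "\<And>p. p \<in> P \<Longrightarrow> monomial (w + p) \<in> I"
    using cog monomial_IP_iff by (auto simp: cogenerated_by_def)
  show ?thesis
  proof
    show "monomial w \<notin> I" by (rule w_notin)
    show "monomial (w + p) \<in> I" if "p \<in> P" for p using that by (rule w_socle)
    show "\<exists>n. monomial (nmult n p) \<in> I" if p: "p \<in> P" for p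
    proof -
      obtain n :: nat where n: "n > 0" "is_nil ?N ((?r `` {p}) [^]\<^bsub>?N\<^esub> n)"
        using prim p unfolding primary_congruence_def is_nilpotent_def by blast
      \<comment> \<open>The nil class of \<open>nmult n p\<close> absorbs \<open>w\<close>. As
        \<open>nmult n p\<close> lies in \<open>P\<close>, the sum gives a monomial of
        \<open>I\<close>, and congruent monomials lie in \<open>I\<close> together.\<close>
      then have "(nmult n p + w, nmult n p) \<in> ?r"
        using nil_quot_type_monoid[OF cong] by (simp add: pow_quot_type_monoid[OF cong])
      moreover obtain m where "n = Suc m" using n(1) gr0_implies_Suc by blast
      then have "nmult n p \<in> P" using P_add p by simp
      then have "monomial (nmult n p + w) \<in> I"
        using w_socle[of "nmult n p"] by (simp add: add.commute)
      ultimately show ?thesis using induced_congruence_iff proportional_mono_I by blast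
    qed
    show "(a, b) \<in> ?r" if ab: "a \<notin> P" "b \<notin> P" "(w + a, w + b) \<in> ?r" for a b
    proof (cases "w \<in> P")
      case False
      then show ?thesis using cancellative[of w a b] ab(3) by (simp add: add.commute)
    next
      case True
      \<comment> \<open>Mesoprimarity applies only to products that are not nil. A nil class of
        \<open>w + a\<close> would absorb a further \<open>w\<close>; as \<open>w\<close> lies in
        \<open>P\<close>, this would put the monomial of \<open>w + a\<close>, hence that of
        \<open>w\<close>, into \<open>I\<close>.\<close>
      have "\<not> is_nil ?N (?r `` {w + a})"
      proof
        assume "is_nil ?N (?r `` {w + a})"
        then have "(w + a + w, w + a) \<in> ?r" by (rule nil_quot_type_monoid[OF cong])
        moreover have "monomial (w + a + w) \<in> I"
          using w_socle[OF True] mono_I_add[of "w + w" a] by (simp add: ac_simps)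
        ultimately have "monomial (w + a) \<in> I" using induced_congruence_iff proportional_mono_I by blast
        then show False using mono_I_cancel[OF ab(1)] w_notin by blast
      qed
      then have "\<not> is_nil ?N (?r `` {w} \<otimes>\<^bsub>?N\<^esub> ?r `` {a})" by (simp add: q(3))
      moreover have "?r `` {w} \<otimes>\<^bsub>?N\<^esub> ?r `` {a} = ?r `` {w} \<otimes>\<^bsub>?N\<^esub> ?r `` {b}" using ab(3) by (simp add: q)
      ultimately have "?r `` {a} = ?r `` {b}"
        using meso[unfolded mesoprimary_congruence_def Let_def, THEN conjunct2, rule_format,
            OF q(2) q(2) q(2)] canc[OF ab(1)] canc[OF ab(2)] by blast
      then show ?thesis using q(1) by blast
    qed
  qed
qed

theorem theorem7p5:
  fixes I :: "('q::comm_monoid_add \<Rightarrow>\<^sub>0 'k::field) set"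
    and P :: "'q set"
    and w :: 'q
  assumes noetherian: "finitely_generated_monoid (type_monoid :: 'q monoid)"
    and coprincipal: "coprincipal_ideal P I"
    and cogenerator: "cogenerated_by P I w"
  shows "(\<exists>!C. minimal_primary_decomposition type_alg (irr_closure P I w) C) \<and>
         (\<forall>C. minimal_primary_decomposition type_alg (irr_closure P I w) C \<longrightarrow>
            (\<forall>J\<in>C. irreducible_ideal type_alg J))"
proof -
  interpret mesoprimary_binomial I P w
    using mesoprimary_binomial_coprincipal[OF coprincipal cogenerator] .
  obtain S :: "'q set" where S: "finite S" "\<And>T. submonoid T type_monoid \<Longrightarrow> S \<subseteq> T \<Longrightarrow> T = UNIV"
    using noetherian unfolding finitely_generated_monoid_def by (auto simp: type_monoid_def)
  have gen: "T = UNIV" if "0 \<in> T" "\<And>a b. a \<in> T \<Longrightarrow> b \<in> T \<Longrightarrow> a + b \<in> T" "S \<subseteq> T" for T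
    using S(2)[of T] that by (simp add: submonoid_def type_monoid_def)
  have "\<exists>D. finite D \<and> (\<forall>A\<in>D. primary_idl A \<and> irreducible_idl A) \<and>
      (\<forall>A\<in>D. \<forall>B\<in>D. radical_of A \<subseteq> radical_of B \<longrightarrow> A = B) \<and> \<Inter>D = irr_closure P I w"
    unfolding irr_closure_eq_closure_ideal by (rule closure_ideal_decomposition[OF S(1) gen])
  then obtain D where fin: "finite D" and prim: "\<And>A. A \<in> D \<Longrightarrow> primary_idl A"
      and irred: "\<And>A. A \<in> D \<Longrightarrow> irreducible_idl A"
      and incomp: "\<And>A B. A \<in> D \<Longrightarrow> B \<in> D \<Longrightarrow> radical_of A \<subseteq> radical_of B \<Longrightarrow> A = B"
      and D: "\<Inter>D = irr_closure P I w"
    by (elim exE conjE) (rule that; simp)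
  note unique = unique_minimal_primary_decomposition[OF fin prim incomp, unfolded D]
  have min: "minimal_primary_decomposition type_alg (irr_closure P I w) D" by (rule unique(1))
  have uniq: "C = D" if "minimal_primary_decomposition type_alg (irr_closure P I w) C" for C
    using that by (rule unique(2)[rotated -1])
  show ?thesis
  proof (intro conjI ex1I allI impI ballI)
    show "minimal_primary_decomposition type_alg (irr_closure P I w) D" by (rule min)
    show "C = D" if "minimal_primary_decomposition type_alg (irr_closure P I w) C" for C
      using that by (rule uniq)
    show "irreducible_ideal type_alg J"
      if "minimal_primary_decomposition type_alg (irr_closure P I w) C" "J \<in> C" for C J
      using uniq[OF that(1)] that(2) by (intro irreducible_ideal_type_alg irred) simp
  qed
qed

end
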